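(* Let $D\subset\mathbb{Z}^d$ be finite, let $f=(f(x))_{x\in D}$ be a non-degenerate centred Gaussian vector, let $\Xi:\mathcal{P}(D)\to\mathbb{R}$ be any function on the subsets of $D$, and let $\nu:D\to\mathbb{R}$. Then the functional $\Xi(f-\nu):=\Xi(\{x\in D:f(x)>\nu(x)\})$ has the chaos expansion $$\Xi(f-\nu)=\mathbb{E}[\Xi(f-\nu)]+\sum_{m=1}^\infty Q_m[\Xi(f-\nu)],$$ where convergence occurs in $L^2$ and $$Q_m[\Xi(f-\nu)]=\frac1{m!}\sum_{x_1,\dots,x_m\in D}{:}f(x_1)\cdots f(x_m){:}\ P(\nu;x_1,\dots,x_m),$$ with $P(\nu;x_1,\dots,x_m)$ the pivotal intensity of $\Xi$ at $(x_1,\dots,x_m)$ with respect to level $\nu$.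
   Context: Chaos and Wick products: let $H$ be the Gaussian Hilbert space spanned by $\{f(x)\}_{x\in D}$, and let $\overline{\mathcal{P}_m(H)}$ be the $L^2$-closure of the set of real polynomials of degree at most $m$ in finitely many elements of $H$. The $m$-th homogeneous chaos is the orthogonal complement of $\overline{\mathcal{P}_{m-1}(H)}$ in $\overline{\mathcal{P}_m(H)}$, $Q_m$ is the orthogonal projection in $L^2$ onto it, and ${:}X_1\cdots X_n{:}=Q_n[X_1\cdots X_n]$ for $X_i\in H$. Hermite polynomials: for a non-degenerate centred Gaussian vector $X$ with density $\varphi_X$ and a multi-index $\alpha$, $H^\alpha_X(x)=(-1)^{|\alpha|}\partial^\alpha\varphi_X(x)/\varphi_X(x)$. Discrete derivatives: for $y\in D$ and $E\subseteq D$, $d_y\Xi(E)=\Xi(E\cup\{y\})-\Xi(E\setminus\{y\})$. For $y=(y_1,\dots,y_m)\in D^m$, let $\underline y=(y_1',\dots,y_n')$ be the subvector of distinct elements and $d_{\underline y}=d_{y_1'}\cdots d_{y_n'}$ the iterated derivative. For $g:D\to\mathbb{R}$ write $d_{\underline y}\Xi(g)$ for $d_{\underline y}\Xi(\{g>0\})$. Pivotal intensity: for $y\in D^m$ let $\alpha^y\in\mathbb{N}_0^D$ be its associated multi-index (counting how many times each point occurs in $y$), and let $\tilde\alpha^y_i=\max\{\alpha^y_i-1,0\}$. Then $$P(\nu;y)=\mathbb{E}\big[d_{\underline y}\Xi(f-\nu)\,H^{\tilde\alpha^y}_f(f)\,\big|\,f(\underline y)=\nu(\underline y)\big]\,\varphi_{f(\underline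 y)}(\nu(\underline y)),$$ where $\varphi_{f(\underline y)}$ is the density of $f(\underline y)$, and $H_f$ is defined with respect to the covariance matrix of the unconditioned vector $f$. *)

theory Defs
  imports "HOL-Probability.Probability"
begin

section \<open>The Hilbert space of square-integrable random variables\<close>

text \<open>Elements are measurable functions; equality in the Hilbert space is equality almost
  everywhere.\<close>

definition L2 :: "'w measure \<Rightarrow> ('w \<Rightarrow> real) set" where
  "L2 M = {X \<in> borel_measurable M. integrable M (\<lambda>\<omega>. (X \<omega>)\<^sup>2)}"

definition tendsto_L2 :: "'w measure \<Rightarrow> (nat \<Rightarrow> 'w \<Rightarrow> real) \<Rightarrow> ('w \<Rightarrow> real) \<Rightarrow> bool" where
  "tendsto_L2 M X Y \<longleftrightarrow>
     (\<forall>n. X n \<in> L2 M) \<and> Y \<in> L2 M \<and>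
     (\<lambda>n. \<integral>\<omega>. (X n \<omega> - Y \<omega>)\<^sup>2 \<partial>M) \<longlonglongrightarrow> 0"

definition L2_closure :: "'w measure \<Rightarrow> ('w \<Rightarrow> real) set \<Rightarrow> ('w \<Rightarrow> real) set" where
  "L2_closure M S = {Y. \<exists>Z. (\<forall>n. Z n \<in> S) \<and> tendsto_L2 M Z Y}"

text \<open>For a closed linear subspace \<open>S\<close> this picks a representative of the orthogonal projection of
  \<open>X\<close> onto \<open>S\<close>; it is determined up to a null set.\<close>

definition orth_proj :: "'w measure \<Rightarrow> ('w \<Rightarrow> real) set \<Rightarrow> ('w \<Rightarrow> real) \<Rightarrow> 'w \<Rightarrow> real" where
  "orth_proj M S X =
     (SOME Y. Y \<in> S \<and> (\<forall>Z\<in>S. (\<integral>\<omega>. (X \<omega> - Y \<omega>) * Z \<omega> \<partial>M) = 0))"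


section \<open>Homogeneous chaos and Wick products\<close>

text \<open>\<open>D\<close> is finite in all uses, so the linear span of the coordinates is already closed.\<close>

definition gauss_space :: "'i set \<Rightarrow> ('i \<Rightarrow> 'w \<Rightarrow> real) \<Rightarrow> ('w \<Rightarrow> real) set" where
  "gauss_space D f = {X. \<exists>c. X = (\<lambda>\<omega>. \<Sum>x\<in>D. c x * f x \<omega>)}"

text \<open>Real polynomials of degree at most \<open>m\<close> evaluated at elements \<open>X 0, \<dots>, X (k - 1)\<close> of \<open>H\<close>;
  \<open>A\<close> is a finite set of multi-indices containing the support of the coefficients \<open>c\<close>.\<close>

definition polys :: "('w \<Rightarrow> real) set \<Rightarrow> nat \<Rightarrow> ('w \<Rightarrow> real) set" where
  "polys H m =
     {Y. \<exists>(k :: nat) X (A :: (nat \<Rightarrow> nat) set) c.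
           (\<forall>i<k. X i \<in> H) \<and> finite A \<and> (\<forall>\<alpha>\<in>A. (\<Sum>i<k. \<alpha> i) \<le> m) \<and>
           Y = (\<lambda>\<omega>. \<Sum>\<alpha>\<in>A. c \<alpha> * (\<Prod>i<k. X i \<omega> ^ \<alpha> i))}"

text \<open>For \<open>m = 0\<close> there are no polynomials of degree at most \<open>m - 1\<close> other than \<open>0\<close>, so the
  orthogonality condition is void.\<close>

definition homogeneous_chaos ::
  "'w measure \<Rightarrow> ('w \<Rightarrow> real) set \<Rightarrow> nat \<Rightarrow> ('w \<Rightarrow> real) set" where
  "homogeneous_chaos M H m =
     {Y \<in> L2_closure M (polys H m).
        0 < m \<longrightarrow> (\<forall>Z \<in> L2_closure M (polys H (m - 1)). (\<integral>\<omega>. Y \<omega> * Z \<omega> \<partial>M) = 0)}"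

definition chaos_proj ::
  "'w measure \<Rightarrow> ('w \<Rightarrow> real) set \<Rightarrow> nat \<Rightarrow> ('w \<Rightarrow> real) \<Rightarrow> 'w \<Rightarrow> real" where
  "chaos_proj M H m = orth_proj M (homogeneous_chaos M H m)"

definition wick ::
  "'w measure \<Rightarrow> ('w \<Rightarrow> real) set \<Rightarrow> ('w \<Rightarrow> real) list \<Rightarrow> 'w \<Rightarrow> real" where
  "wick M H Xs = chaos_proj M H (length Xs) (\<lambda>\<omega>. \<Prod>X\<leftarrow>Xs. X \<omega>)"


section \<open>Gaussian vectors indexed by a finite set\<close>

text \<open>Matrices with rows and columns indexed by a finite set \<open>I\<close> are functions
  \<open>'i \<Rightarrow> 'i \<Rightarrow> real\<close>, of which only the entries on \<open>I \<times> I\<close> matter. Thus the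
  covariance matrix of a subvector is the same function, used with a smaller index set.\<close>

definition det_on :: "'i set \<Rightarrow> ('i \<Rightarrow> 'i \<Rightarrow> real) \<Rightarrow> real" where
  "det_on I K = (\<Sum>p | p permutes I. of_int (sign p) * (\<Prod>i\<in>I. K i (p i)))"

definition inv_on :: "'i set \<Rightarrow> ('i \<Rightarrow> 'i \<Rightarrow> real) \<Rightarrow> 'i \<Rightarrow> 'i \<Rightarrow> real" where
  "inv_on I K =
     (THE L. (\<forall>i\<in>I. \<forall>j\<in>I. (\<Sum>k\<in>I. K i k * L k j) = (if i = j then 1 else 0)) \<and>
             (\<forall>i j. i \<notin> I \<or> j \<notin> I \<longrightarrow> L i j = 0))"

definition pos_def_on :: "'i set \<Rightarrow> ('i \<Rightarrow> 'i \<Rightarrow> real) \<Rightarrow> bool" where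
  "pos_def_on I K \<longleftrightarrow>
     (\<forall>c. (\<exists>i\<in>I. c i \<noteq> 0) \<longrightarrow> 0 < (\<Sum>i\<in>I. \<Sum>j\<in>I. c i * K i j * c j))"

definition gauss_density :: "'i set \<Rightarrow> ('i \<Rightarrow> 'i \<Rightarrow> real) \<Rightarrow> ('i \<Rightarrow> real) \<Rightarrow> real" where
  "gauss_density I K x =
     exp (- (\<Sum>i\<in>I. \<Sum>j\<in>I. x i * inv_on I K i j * x j) / 2) /
     sqrt ((2 * pi) ^ card I * det_on I K)"

text \<open>The vectors are centred, so no means are subtracted.\<close>

definition cov :: "'w measure \<Rightarrow> ('i \<Rightarrow> 'w \<Rightarrow> real) \<Rightarrow> 'i \<Rightarrow> 'i \<Rightarrow> real" where
  "cov M f x y = (\<integral>\<omega>. f x \<omega> * f y \<omega> \<partial>M)"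

definition nondeg_centred_gaussian ::
  "'w measure \<Rightarrow> 'i set \<Rightarrow> ('i \<Rightarrow> 'w \<Rightarrow> real) \<Rightarrow> bool" where
  "nondeg_centred_gaussian M D f \<longleftrightarrow>
     pos_def_on D (cov M f) \<and>
     distributed M (\<Pi>\<^sub>M x\<in>D. lborel) (\<lambda>\<omega>. \<lambda>x\<in>D. f x \<omega>)
       (\<lambda>u. ennreal (gauss_density D (cov M f) u))"

text \<open>\<open>E[G(f) | f(I) = u]\<close> for \<open>I \<subseteq> D\<close>: integration against the conditional density
  \<open>z \<mapsto> \<phi>\<^bsub>f\<^esub>(u, z) / \<phi>\<^bsub>f(I)\<^esub>(u)\<close> of the remaining coordinates
  \<open>f(D - I)\<close>.\<close>

definition gauss_cond_exp ::
  "'w measure \<Rightarrow> 'i set \<Rightarrow> ('i \<Rightarrow> 'w \<Rightarrow> real) \<Rightarrow> (('i \<Rightarrow> real) \<Rightarrow> real) \<Rightarrow>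
     'i set \<Rightarrow> ('i \<Rightarrow> real) \<Rightarrow> real" where
  "gauss_cond_exp M D f G I u =
     (\<integral>z. G (merge I (D - I) (u, z)) *
          (gauss_density D (cov M f) (merge I (D - I) (u, z)) / gauss_density I (cov M f) u)
        \<partial>(\<Pi>\<^sub>M x\<in>D - I. lborel))"


section \<open>Hermite polynomials\<close>

definition partial_deriv :: "'i \<Rightarrow> (('i \<Rightarrow> real) \<Rightarrow> real) \<Rightarrow> ('i \<Rightarrow> real) \<Rightarrow> real" where
  "partial_deriv i F x = deriv (\<lambda>t. F (x(i := t))) (x i)"

text \<open>The coordinates are taken in an arbitrary order, which is irrelevant for smooth \<open>F\<close>.\<close>

definition mixed_partial ::
  "'i set \<Rightarrow> ('i \<Rightarrow> nat) \<Rightarrow> (('i \<Rightarrow> real) \<Rightarrow> real) \<Rightarrow> ('i \<Rightarrow> real) \<Rightarrow> real" where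
  "mixed_partial I \<alpha> F =
     foldr (\<lambda>i G. (partial_deriv i ^^ \<alpha> i) G) (SOME xs. distinct xs \<and> set xs = I) F"

definition hermite ::
  "'i set \<Rightarrow> ('i \<Rightarrow> 'i \<Rightarrow> real) \<Rightarrow> ('i \<Rightarrow> nat) \<Rightarrow> ('i \<Rightarrow> real) \<Rightarrow> real" where
  "hermite I K \<alpha> x =
     (- 1) ^ (\<Sum>i\<in>I. \<alpha> i) * mixed_partial I \<alpha> (gauss_density I K) x / gauss_density I K x"


section \<open>Discrete derivatives and pivotal intensities\<close>

definition excursion_set :: "'i set \<Rightarrow> ('i \<Rightarrow> real) \<Rightarrow> ('i \<Rightarrow> real) \<Rightarrow> 'i set" where
  "excursion_set D \<nu> g = {x \<in> D. g x > \<nu> x}"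

definition disc_deriv :: "'i \<Rightarrow> ('i set \<Rightarrow> real) \<Rightarrow> 'i set \<Rightarrow> real" where
  "disc_deriv y \<Xi> E = \<Xi> (E \<union> {y}) - \<Xi> (E - {y})"

text \<open>Tuples in \<open>D\<^sup>m\<close> are lists; \<open>remdups y\<close> is the subvector of distinct entries.\<close>

definition disc_derivs :: "'i list \<Rightarrow> ('i set \<Rightarrow> real) \<Rightarrow> 'i set \<Rightarrow> real" where
  "disc_derivs y \<Xi> = foldr disc_deriv (remdups y) \<Xi>"

text \<open>Natural number subtraction in \<open>count_list y x - 1\<close> is truncated at \<open>0\<close>.\<close>

definition pivotal_intensity ::
  "'w measure \<Rightarrow> 'i set \<Rightarrow> ('i \<Rightarrow> 'w \<Rightarrow> real) \<Rightarrow> ('i set \<Rightarrow> real) \<Rightarrow> ('i \<Rightarrow> real) \<Rightarrow>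
     'i list \<Rightarrow> real" where
  "pivotal_intensity M D f \<Xi> \<nu> y =
     gauss_cond_exp M D f
       (\<lambda>u. disc_derivs y \<Xi> (excursion_set D \<nu> u) *
            hermite D (cov M f) (\<lambda>x. count_list y x - 1) u)
       (set y) \<nu> *
     gauss_density (set y) (cov M f) \<nu>"

end

theory Submission
  imports Defs "Jordan_Normal_Form.Determinant" "HOL-Real_Asymp.Real_Asymp"
    "HOL-Combinatorics.Multiset_Permutations"
begin

text \<open>For a multi-index \<open>\<alpha>\<close> of order \<open>m\<close>, the Hermite variable \<open>H\<^sup>\<alpha>(f)\<close> lies in the
  \<open>m\<close>-th chaos and \<open>E[H\<^sup>\<alpha>(f) f\<^sup>\<beta>] = \<alpha>!\<close> if \<open>\<alpha> = \<beta>\<close> and \<open>0\<close> for the other \<open>\<beta>\<close> of order at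
  most \<open>m\<close>. Hence an element of the \<open>m\<close>-th chaos is determined by its inner products with the
  Hermite variables, and these are dual to the Wick monomials. The coefficients of a functional
  \<open>X\<close> are thus \<open>E[X H\<^sup>\<alpha>(f)]\<close>, the integral of \<open>X\<close> against \<open>(-1)\<^sup>m \<partial>\<^sup>\<alpha>\<phi>\<close>. When \<open>X\<close> depends only
  on the excursion set, integrating by parts once in every coordinate in the support of \<open>\<alpha>\<close>
  turns this into the pivotal intensity. Convergence holds because the polynomials in \<open>f\<close> are
  dense: their closure is stable under multiplication by \<open>sin (t f(x))\<close>, hence by bounded limits
  of polynomials in such functions, and indicators of \<open>f(x) > a\<close> are among these.\<close>

section \<open>Positive definite matrices\<close>

text \<open>The exponents \<open>count_list y x - 1\<close> in the pivotal intensity arise because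
  one integration by parts freezes a coordinate at its threshold. Nothing is then left to integrate
  in that coordinate, so its other derivatives stay on the density and form the Hermite factor. The
  factor 1/m! comes from counting: m!/\<alpha>! tuples share the multi-index \<alpha>, and the
  duality contributes \<alpha>!. Polynomials of bounded degree in finitely many variables span a
  finite-dimensional space, so every projection can be built by orthogonalisation, and only the
  final convergence has to leave bounded degree. The delicate point is that both
  \<open>orth_proj\<close> and the order of differentiation are Hilbert choices. Projections are
  therefore identified almost everywhere, by orthogonality, and iterated derivatives are handled
  inside the polynomial multiples of the density, where partial derivatives exist and
  commute.\<close>

lemma pos_def_on_subset:
  assumes "finite I" "J \<subseteq> I" "pos_def_on I K"
  shows "pos_def_on J K"
  unfolding pos_def_on_def
proof (intro allI impI)
  fix c :: "'a \<Rightarrow> real"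
  assume c: "\<exists>i\<in>J. c i \<noteq> 0"
  define c' where "c' i = (if i \<in> J then c i else 0)" for i
  have "0 < (\<Sum>i\<in>I. \<Sum>j\<in>I. c' i * K i j * c' j)"
    by (rule assms(3)[unfolded pos_def_on_def, rule_format]) (use assms(2) c in \<open>auto simp: c'_def\<close>)
  also have "\<dots> = (\<Sum>i\<in>J. \<Sum>j\<in>J. c i * K i j * c j)"
  proof (rule sum.mono_neutral_cong_right)
    fix i assume "i \<in> J"
    then show "(\<Sum>j\<in>I. c' i * K i j * c' j) = (\<Sum>j\<in>J. c i * K i j * c j)"
      using assms by (intro sum.mono_neutral_cong_right) (auto simp: c'_def)
  qed (use assms in \<open>auto simp: c'_def\<close>)
  finally show "0 < (\<Sum>i\<in>J. \<Sum>j\<in>J. c i * K i j * c j)" .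
qed

lemma pos_def_on_kernel:
  assumes "pos_def_on I K" "\<And>i. i \<in> I \<Longrightarrow> (\<Sum>j\<in>I. K i j * c j) = 0" "i \<in> I"
  shows "c i = 0"
proof (rule ccontr)
  assume "c i \<noteq> 0"
  then have "0 < (\<Sum>i\<in>I. \<Sum>j\<in>I. c i * K i j * c j)"
    using assms by (auto simp: pos_def_on_def)
  also have "\<dots> = (\<Sum>i\<in>I. c i * (\<Sum>j\<in>I. K i j * c j))"
    by (simp add: sum_distrib_left mult.assoc)
  also have "\<dots> = 0"
    using assms by simp
  finally show False by simp
qed

lemma pos_def_on_diagonal:
  assumes "finite I" "pos_def_on I K" "i \<in> I"
  shows "0 < K i i"
proof -
  have "pos_def_on {i} K"
    by (rule pos_def_on_subset[OF assms(1) _ assms(2)]) (use assms(3) in simp)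
  then have "0 < (\<Sum>a\<in>{i}. \<Sum>b\<in>{i}. (\<lambda>_. 1) a * K a b * (\<lambda>_. 1::real) b)"
    unfolding pos_def_on_def by (rule allE[where x = "\<lambda>_. 1"]) (erule mp, simp)
  then show ?thesis by simp
qed

text \<open>Induction by bordering. Let \<open>s\<close> and \<open>w\<close> solve the smaller
  system for \<open>b\<close> and for the column of \<open>a\<close>. Then \<open>s - ca * w\<close>
  on \<open>I\<close>, together with the value \<open>ca\<close> at \<open>a\<close>, satisfies
  every row except possibly row \<open>a\<close>, and that row determines \<open>ca\<close>.\<close>

lemma pos_def_on_solve:
  assumes "finite I" "pos_def_on I K"
  shows "\<exists>c. \<forall>i\<in>I. (\<Sum>k\<in>I. K i k * c k) = b i"
  using assms
proof (induction I arbitrary: b rule: finite_induct)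
  case empty
  then show ?case by simp
next
  case (insert a I)
  have pI: "pos_def_on I K"
    using insert by (intro pos_def_on_subset[of "insert a I" I]) auto
  obtain w where w: "\<And>i. i \<in> I \<Longrightarrow> (\<Sum>k\<in>I. K i k * w k) = K i a"
    using insert.IH[OF pI, of "\<lambda>i. K i a"] by auto
  obtain s where s: "\<And>i. i \<in> I \<Longrightarrow> (\<Sum>k\<in>I. K i k * s k) = b i"
    using insert.IH[OF pI, of b] by auto
  \<comment> \<open>The Schur complement of the block over \<open>I\<close>. If it were zero, the
    vector equal to 1 at \<open>a\<close> and to \<open>- w\<close> on \<open>I\<close> would lie in
    the kernel.\<close>
  define den where "den = K a a - (\<Sum>k\<in>I. K a k * w k)"
  have ex: "(\<Sum>k\<in>I. K i k * (if k = a then r else v k)) = (\<Sum>k\<in>I. K i k * v k)" for r v i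
    using insert.hyps by (intro sum.cong) auto
  have den: "den \<noteq> 0"
  proof
    assume "den = 0"
    define v where "v k = (if k = a then 1 else - w k)" for k
    have "v a = 0"
    proof (rule pos_def_on_kernel[OF insert.prems])
      fix i assume "i \<in> insert a I"
      then show "(\<Sum>j\<in>insert a I. K i j * v j) = 0"
        using insert.hyps w \<open>den = 0\<close> by (auto simp: v_def ex sum_negf den_def)
    qed simp
    then show False by (simp add: v_def)
  qed
  define ca where "ca = (b a - (\<Sum>k\<in>I. K a k * s k)) / den"
  define c where "c k = (if k = a then ca else s k - ca * w k)" for k
  have eq: "(\<Sum>k\<in>insert a I. K i k * c k)
      = K i a * ca + (\<Sum>k\<in>I. K i k * s k) - ca * (\<Sum>k\<in>I. K i k * w k)" for i
    using insert.hyps by (simp add: c_def ex right_diff_distrib sum_subtractf sum_distrib_left mult_ac)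
  have "(\<Sum>k\<in>insert a I. K i k * c k) = b i" if "i \<in> insert a I" for i
  proof (cases "i = a")
    case True
    have "K a a * ca - ca * (\<Sum>k\<in>I. K a k * w k) = ca * den"
      by (simp add: den_def algebra_simps)
    also have "\<dots> = b a - (\<Sum>k\<in>I. K a k * s k)"
      using den by (simp add: ca_def)
    finally show ?thesis unfolding eq True by simp
  qed (use that in \<open>simp add: eq w s\<close>)
  then show ?case by blast
qed

text \<open>The definite description in \<open>inv_on\<close> carries information only once
  existence and uniqueness are known. The columns come from \<open>pos_def_on_solve\<close>;
  prescribing zeros outside \<open>I\<close> makes uniqueness hold for functions on the whole index
  type.\<close>

lemma inv_on_properties:
  assumes "finite I" "pos_def_on I K"
  shows "\<And>i j. i \<in> I \<Longrightarrow> j \<in> I \<Longrightarrow> (\<Sum>k\<in>I. K i k * inv_on I K k j) = (if i = j then 1 else 0)"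
    and "\<And>i j. i \<notin> I \<or> j \<notin> I \<Longrightarrow> inv_on I K i j = 0"
proof -
  let ?P = "\<lambda>L. (\<forall>i\<in>I. \<forall>j\<in>I. (\<Sum>k\<in>I. K i k * L k j) = (if i = j then 1 else 0)) \<and>
             (\<forall>i j. i \<notin> I \<or> j \<notin> I \<longrightarrow> L i j = 0)"
  have "\<exists>L. ?P L"
  proof -
    have "\<forall>j. \<exists>c. \<forall>i\<in>I. (\<Sum>k\<in>I. K i k * c k) = (if i = j then 1 else 0)"
      by (intro allI pos_def_on_solve[OF assms])
    then obtain C where C: "\<And>i j. i \<in> I \<Longrightarrow> (\<Sum>k\<in>I. K i k * C j k) = (if i = j then 1 else 0)"
      by metis
    show ?thesis
      by (rule exI[of _ "\<lambda>k j. if k \<in> I \<and> j \<in> I then C j k else 0"]) (auto simp: C)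
  qed
  moreover have "L = L'" if L: "?P L" and L': "?P L'" for L L'
  proof (intro ext)
    fix k j
    show "L k j = L' k j"
    proof (cases "k \<in> I \<and> j \<in> I")
      case True
      have "L k j - L' k j = 0"
      proof (rule pos_def_on_kernel[OF assms(2), where c = "\<lambda>k. L k j - L' k j"])
        fix i assume "i \<in> I"
        then show "(\<Sum>k\<in>I. K i k * (L k j - L' k j)) = 0"
          using L L' True by (simp add: right_diff_distrib sum_subtractf)
      qed (use True in simp)
      then show ?thesis by simp
    qed (use L L' in auto)
  qed
  ultimately have "\<exists>!L. ?P L"
    by blast
  then have "?P (inv_on I K)"
    unfolding inv_on_def by (rule theI'[of ?P])
  then show "\<And>i j. i \<in> I \<Longrightarrow> j \<in> I \<Longrightarrow> (\<Sum>k\<in>I. K i k * inv_on I K k j) = (if i = j then 1 else 0)"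
    and "\<And>i j. i \<notin> I \<or> j \<notin> I \<Longrightarrow> inv_on I K i j = 0"
    by blast+
qed

text \<open>With L the inverse, evaluate the product of the transpose of L, K and L in two ways:
  cancelling K against the right factor leaves the transpose of L, cancelling it against the left
  factor by symmetry of K leaves L.\<close>

lemma inv_on_symmetric:
  assumes "finite I" "pos_def_on I K" and sym: "\<And>i j. K i j = K j i"
  shows "inv_on I K i j = inv_on I K j i"
proof (cases "i \<in> I \<and> j \<in> I")
  case True
  let ?L = "inv_on I K"
  note L = inv_on_properties(1)[OF assms(1,2)]
  have "(\<Sum>k\<in>I. ?L k i * (\<Sum>l\<in>I. K k l * ?L l j)) = (\<Sum>k\<in>I. \<Sum>l\<in>I. ?L l j * (K l k * ?L k i))"
    unfolding sum_distrib_left by (intro sum.cong refl) (simp add: sym mult_ac)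
  also have "\<dots> = (\<Sum>l\<in>I. ?L l j * (\<Sum>k\<in>I. K l k * ?L k i))"
    by (subst sum.swap) (simp add: sum_distrib_left)
  finally show ?thesis
    using True assms by (simp add: L if_distrib[of "(*) _"] cong: if_cong)
next
  case False
  then show ?thesis
    using inv_on_properties(2)[OF assms(1,2)] by auto
qed

text \<open>Cauchy-Schwarz in the inner product given by \<open>K\<close>. With w the inverse matrix
  applied to u, the coordinate u_i is the product of the unit vector e_i with w, and the form on the
  right is the square norm of w. This is what makes the density decay in every coordinate.\<close>

lemma coordinate_le_inv_form:
  assumes "finite I" "pos_def_on I K" and sym: "\<And>i j. K i j = K j i" and i: "i \<in> I"
  shows "(u i)\<^sup>2 \<le> K i i * (\<Sum>a\<in>I. \<Sum>b\<in>I. u a * inv_on I K a b * u b)"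
proof -
  let ?L = "inv_on I K"
  define w where "w k = (\<Sum>j\<in>I. ?L k j * u j)" for k
  have Kw: "(\<Sum>k\<in>I. K a k * w k) = u a" if "a \<in> I" for a
  proof -
    have "(\<Sum>k\<in>I. K a k * w k) = (\<Sum>j\<in>I. (\<Sum>k\<in>I. K a k * ?L k j) * u j)"
      unfolding w_def sum_distrib_left sum_distrib_right by (subst sum.swap) (simp add: mult_ac)
    also have "\<dots> = (\<Sum>j\<in>I. (if a = j then 1 else 0) * u j)"
      using that by (intro sum.cong refl) (simp add: inv_on_properties(1)[OF assms(1,2)])
    finally show ?thesis
      using that assms by (simp add: if_distrib[of "\<lambda>x. x * _"] cong: if_cong)
  qed
  have wu: "(\<Sum>k\<in>I. w k * u k) = (\<Sum>a\<in>I. \<Sum>b\<in>I. u a * ?L a b * u b)"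
    by (simp add: w_def sum_distrib_left sum_distrib_right mult_ac)
  have pos: "0 < K i i"
    using assms by (intro pos_def_on_diagonal)
  \<comment> \<open>The minimiser of the square norm of w + t e_i as a quadratic in
    \<open>t\<close>.\<close>
  define t where "t = - u i / K i i"
  define c where "c k = w k + (if k = i then t else 0)" for k
  have Kc: "(\<Sum>j\<in>I. K a j * c j) = u a + K a i * t" if "a \<in> I" for a
    using that i assms(1) by (simp add: c_def distrib_left sum.distrib Kw if_distrib[of "(*) _"] cong: if_cong)
  have "0 \<le> (\<Sum>a\<in>I. \<Sum>b\<in>I. c a * K a b * c b)"
  proof (cases "\<exists>a\<in>I. c a \<noteq> 0")
    case True
    then show ?thesis using assms(2) by (auto simp: pos_def_on_def intro: less_imp_le)
  qed simp
  also have "\<dots> = (\<Sum>a\<in>I. c a * (u a + K a i * t))"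
    by (intro sum.cong refl) (simp add: mult.assoc Kc flip: sum_distrib_left)
  also have "\<dots> = (\<Sum>a\<in>I. w a * u a) + t * (\<Sum>a\<in>I. w a * K a i)
      + (\<Sum>a\<in>I. if a = i then t * (u a + K a i * t) else 0)"
    unfolding sum_distrib_left sum.distrib[symmetric]
    by (intro sum.cong refl) (simp add: c_def algebra_simps)
  also have "(\<Sum>a\<in>I. w a * K a i) = u i"
    by (subst Kw[OF i, symmetric], rule sum.cong[OF refl], subst sym, rule mult.commute)
  also have "(\<Sum>a\<in>I. if a = i then t * (u a + K a i * t) else 0) = t * (u i + K i i * t)"
    using i assms(1) by simp
  finally have "0 \<le> (\<Sum>a\<in>I. w a * u a) + t * u i + t * (u i + K i i * t)" .
  also have "\<dots> = (\<Sum>a\<in>I. \<Sum>b\<in>I. u a * ?L a b * u b) - (u i)\<^sup>2 / K i i"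
    using pos unfolding wu by (simp add: t_def field_simps power2_eq_square)
  finally have "(u i)\<^sup>2 / K i i \<le> (\<Sum>a\<in>I. \<Sum>b\<in>I. u a * ?L a b * u b)"
    by simp
  then show ?thesis
    using pos by (simp add: pos_divide_le_eq mult.commute)
qed

text \<open>Enumerating the index set leads to matrices over natural numbers, where a vanishing
  determinant yields a kernel vector, contrary to positive definiteness. The sign is left open;
  \<open>density_nonneg\<close> obtains the sign of the density from its total mass.\<close>

lemma det_on_nonzero:
  assumes "finite I" "pos_def_on I K"
  shows "det_on I K \<noteq> 0"
proof -
  define n where "n = card I"
  let ?N = "{0..<n}"
  obtain b where b: "bij_betw b ?N I"
    using ex_bij_betw_nat_finite[OF assms(1)] unfolding n_def by blast
  define b' where "b' = inv_into ?N b"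
  have inv: "b' (b i) = i" if "i \<in> ?N" for i
    using b that unfolding b'_def by (meson bij_betw_inv_into_left)
  have inv': "b (b' i) = i" if "i \<in> I" for i
    using b that unfolding b'_def by (meson bij_betw_inv_into_right)
  have b'bij: "bij_betw b' I ?N"
    using b unfolding b'_def by (rule bij_betw_inv_into)
  define A where "A = Matrix.mat n n (\<lambda>(i, j). K (b i) (b j))"
  have A: "A \<in> carrier_mat n n" by (simp add: A_def)
  \<comment> \<open>Transport along the enumeration is a sign-preserving bijection between the
    permutations of the two index sets, with inverse \<open>\<tau>\<close>.\<close>
  define \<sigma> where "\<sigma> = map_permutation ?N b"
  define \<tau> where "\<tau> = map_permutation I b'"
  have \<sigma>: "\<tau> (\<sigma> q) = q" "\<sigma> q permutes I" "sign (\<sigma> q) = sign q" if q: "q permutes ?N" for q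
    using map_permutation_compose_inv[OF b q, of b'] inv map_permutation_permutes[OF b q]
      sign_map_permutation[OF bij_betw_imp_inj_on[OF b] q]
    by (simp_all add: \<sigma>_def \<tau>_def)
  have \<tau>: "\<sigma> (\<tau> p) = p" "\<tau> p permutes ?N" if p: "p permutes I" for p
    using map_permutation_compose_inv[OF b'bij p, of b] inv' map_permutation_permutes[OF b'bij p]
    by (simp_all add: \<sigma>_def \<tau>_def)
  have prod_eq: "(\<Prod>x\<in>I. K x (\<sigma> q x)) = (\<Prod>i\<in>?N. A $$ (i, q i))" if q: "q permutes ?N" for q
  proof -
    have "(\<Prod>x\<in>I. K x (\<sigma> q x)) = (\<Prod>i\<in>?N. K (b i) (\<sigma> q (b i)))"
      by (rule prod.reindex_bij_betw[OF b, symmetric])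
    also have "\<dots> = (\<Prod>i\<in>?N. A $$ (i, q i))"
    proof (intro prod.cong refl)
      fix i assume i: "i \<in> ?N"
      then have qi: "q i \<in> ?N" by (rule permutes_in_image[OF q, THEN iffD2])
      have "\<sigma> q (b i) = b (q i)"
        unfolding \<sigma>_def using i by (rule map_permutation_apply[OF bij_betw_imp_inj_on[OF b]])
      then show "K (b i) (\<sigma> q (b i)) = A $$ (i, q i)"
        using i qi by (simp add: A_def)
    qed
    finally show ?thesis .
  qed
  have "Determinant.det A = (\<Sum>q | q permutes ?N. signof q * (\<Prod>i\<in>?N. A $$ (i, q i)))"
    by (rule Determinant.det_def'[OF A])
  also have "\<dots> = (\<Sum>q | q permutes ?N. of_int (sign (\<sigma> q)) * (\<Prod>x\<in>I. K x (\<sigma> q x)))"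
    by (intro sum.cong refl) (simp add: \<sigma> prod_eq)
  also have "\<dots> = det_on I K"
    unfolding det_on_def
    by (rule sum.reindex_bij_betw, rule bij_betw_byWitness[where f' = \<tau>]) (auto simp: \<sigma> \<tau>)
  finally have "Determinant.det A = det_on I K" .
  moreover have "Determinant.det A \<noteq> 0"
  proof
    assume "Determinant.det A = 0"
    then obtain v where v: "v \<in> carrier_vec n" "v \<noteq> 0\<^sub>v n" "A *\<^sub>v v = 0\<^sub>v n"
      using det_0_iff_vec_prod_zero_field[OF A] by blast
    define c where "c x = vec_index v (b' x)" for x
    have "c x = 0" if "x \<in> I" for x
    proof (rule pos_def_on_kernel[OF assms(2) _ that])
      fix x assume x: "x \<in> I"
      then have N: "b' x < n" using b'bij by (auto simp: bij_betw_def)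
      have "(\<Sum>y\<in>I. K x y * c y) = (\<Sum>j\<in>?N. K x (b j) * c (b j))"
        by (rule sum.reindex_bij_betw[OF b, symmetric])
      also have "\<dots> = (\<Sum>j\<in>?N. A $$ (b' x, j) * vec_index v j)"
        using x N by (intro sum.cong refl) (simp add: A_def c_def inv inv')
      also have "\<dots> = vec_index (A *\<^sub>v v) (b' x)"
        using N A v(1) by (simp add: scalar_prod_def)
      finally show "(\<Sum>y\<in>I. K x y * c y) = 0" using v N by simp
    qed
    then have "vec_index v i = 0" if "i < n" for i
      using that b inv[of i] unfolding c_def by (metis atLeastLessThan_iff bij_betwE le0)
    then have "v = 0\<^sub>v n"
      using v(1) by (intro eq_vecI) auto
    then show False using v by simp
  qed
  ultimately show ?thesis by simp
qed

section \<open>Polynomials and derivatives of the Gaussian density\<close>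

text \<open>A relation keeps differentiability and value together, while \<open>deriv\<close> is
  meaningless where no derivative exists. Letting \<open>t\<close> vary freely gives the derivative
  along whole coordinate lines, as the fundamental theorem of calculus requires later.\<close>

definition has_pd :: "'i \<Rightarrow> (('i \<Rightarrow> real) \<Rightarrow> real) \<Rightarrow> (('i \<Rightarrow> real) \<Rightarrow> real) \<Rightarrow> bool" where
  "has_pd i F G \<longleftrightarrow>
     (\<forall>u t. ((\<lambda>s. F (u(i := s))) has_real_derivative G (u(i := t))) (at t))"

lemma has_pd_imp_partial_deriv:
  assumes "has_pd i F G"
  shows "partial_deriv i F = G"
proof
  fix u
  have "((\<lambda>s. F (u(i := s))) has_real_derivative G (u(i := u i))) (at (u i))"
    using assms unfolding has_pd_def by blast
  then show "partial_deriv i F u = G u"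
    unfolding partial_deriv_def by (simp add: DERIV_imp_deriv)
qed

lemma has_pd_const: "has_pd i (\<lambda>_. c) (\<lambda>_. 0)"
  by (simp add: has_pd_def)

lemma has_pd_coord: "has_pd i (\<lambda>u. u j) (\<lambda>_. if i = j then 1 else 0)"
  by (simp add: has_pd_def)

lemma has_pd_add: "has_pd i F F' \<Longrightarrow> has_pd i G G' \<Longrightarrow> has_pd i (\<lambda>u. F u + G u) (\<lambda>u. F' u + G' u)"
  by (simp add: has_pd_def DERIV_add)

lemma has_pd_mult:
  "has_pd i F F' \<Longrightarrow> has_pd i G G' \<Longrightarrow> has_pd i (\<lambda>u. F u * G u) (\<lambda>u. F' u * G u + F u * G' u)"
  unfolding has_pd_def by (auto intro!: derivative_eq_intros)

lemma has_pd_cmult: "has_pd i F F' \<Longrightarrow> has_pd i (\<lambda>u. c * F u) (\<lambda>u. c * F' u)"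
  unfolding has_pd_def by (auto intro!: derivative_eq_intros)

lemma has_pd_sum:
  assumes "finite A" "\<And>a. a \<in> A \<Longrightarrow> has_pd i (F a) (F' a)"
  shows "has_pd i (\<lambda>u. \<Sum>a\<in>A. F a u) (\<lambda>u. \<Sum>a\<in>A. F' a u)"
  using assms by (induction A rule: finite_induct) (simp_all add: has_pd_const has_pd_add)

lemma has_pd_exp: "has_pd i F F' \<Longrightarrow> has_pd i (\<lambda>u. exp (F u)) (\<lambda>u. F' u * exp (F u))"
  unfolding has_pd_def by (auto intro!: derivative_eq_intros)

text \<open>The number is an upper bound for the degree. Building polynomials by one coordinate
  factor at a time turns each property into a three-case induction; coefficients are recovered in
  \<open>polyf_lin_span\<close>.\<close>

inductive polyf :: "'i set \<Rightarrow> nat \<Rightarrow> (('i \<Rightarrow> real) \<Rightarrow> real) \<Rightarrow> bool"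
  for D :: "'i set" where
  polyf_const: "polyf D m (\<lambda>_. c)"
| polyf_coord_mult: "i \<in> D \<Longrightarrow> polyf D m p \<Longrightarrow> polyf D (Suc m) (\<lambda>u. u i * p u)"
| polyf_add: "polyf D m p \<Longrightarrow> polyf D m q \<Longrightarrow> polyf D m (\<lambda>u. p u + q u)"

lemma polyf_mono: "polyf D m p \<Longrightarrow> m \<le> n \<Longrightarrow> polyf D n p"
proof (induction arbitrary: n rule: polyf.induct)
  case (polyf_coord_mult i m p)
  then obtain n' where "n = Suc n'" "m \<le> n'"
    by (metis Suc_le_D Suc_le_mono)
  then show ?case using polyf_coord_mult by (auto intro: polyf.intros)
qed (auto intro: polyf.intros)

lemma polyf_coord: "i \<in> D \<Longrightarrow> polyf D (Suc m) (\<lambda>u. u i)"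
  using polyf_coord_mult[OF _ polyf_const[of D m 1], of i] by simp

lemma polyf_cmult: "polyf D m p \<Longrightarrow> polyf D m (\<lambda>u. c * p u)"
proof (induction rule: polyf.induct)
  case (polyf_coord_mult i m p)
  then show ?case
    using polyf.polyf_coord_mult[of i D m "\<lambda>u. c * p u"] by (simp add: mult_ac)
next
  case (polyf_add m p q)
  then show ?case
    using polyf.polyf_add[of D m "\<lambda>u. c * p u" "\<lambda>u. c * q u"] by (simp add: distrib_left)
qed (rule polyf_const)

lemma polyf_diff: "polyf D m p \<Longrightarrow> polyf D m q \<Longrightarrow> polyf D m (\<lambda>u. p u - q u)"
  using polyf_add[OF _ polyf_cmult[of D m q "-1"], of p] by simp

lemma polyf_mult:
  assumes "polyf D m p" "polyf D n q"
  shows "polyf D (m + n) (\<lambda>u. p u * q u)"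
  using assms(1)
proof (induction rule: polyf.induct)
  case (polyf_const m c)
  then show ?case
    using polyf_mono[OF polyf_cmult[OF assms(2), of c], of "m + n"] by simp
next
  case (polyf_coord_mult i m p)
  then show ?case
    using polyf.polyf_coord_mult[of i D "m + n" "\<lambda>u. p u * q u"] by (simp add: mult_ac)
next
  case (polyf_add m p p')
  then show ?case
    using polyf.polyf_add[of D "m + n" "\<lambda>u. p u * q u" "\<lambda>u. p' u * q u"]
    by (simp add: distrib_right)
qed

lemma polyf_sum:
  assumes "finite A" "\<And>a. a \<in> A \<Longrightarrow> polyf D m (p a)"
  shows "polyf D m (\<lambda>u. \<Sum>a\<in>A. p a u)"
  using assms by (induction A rule: finite_induct) (simp_all add: polyf_const polyf_add)

lemma polyf_cong:
  assumes "polyf D m p" "\<And>i. i \<in> D \<Longrightarrow> u i = v i"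
  shows "p u = p v"
  using assms by (induction rule: polyf.induct) auto

lemma polyf_measurable:
  assumes "polyf D m p"
  shows "p \<in> borel_measurable (\<Pi>\<^sub>M i\<in>D. lborel)"
  using assms
proof (induction rule: polyf.induct)
  case (polyf_coord_mult i m p)
  have "(\<lambda>u. u i) \<in> borel_measurable (\<Pi>\<^sub>M i\<in>D. lborel)"
    using measurable_component_singleton[OF polyf_coord_mult.hyps(1), of "\<lambda>_. lborel"] by simp
  then show ?case using polyf_coord_mult by simp
qed auto

text \<open>Exponential bounds are cruder than powers but multiply easily: a coordinate factor
  merely raises \<open>k\<close> by one. The Gaussian density absorbs any such exponential in
  \<open>exp_density_bound\<close>.\<close>

lemma polyf_exp_bound:
  assumes "finite D" "polyf D m p"
  shows "\<exists>C\<ge>0. \<exists>k::nat. \<forall>u. \<bar>p u\<bar> \<le> C * exp (k * (\<Sum>i\<in>D. \<bar>u i\<bar>))"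
  using assms(2)
proof (induction rule: polyf.induct)
  case (polyf_const m c)
  show ?case by (intro exI[of _ "\<bar>c\<bar>"] conjI exI[of _ 0]) auto
next
  case (polyf_coord_mult i m p)
  then obtain C k where C: "C \<ge> 0" "\<And>u. \<bar>p u\<bar> \<le> C * exp (real k * (\<Sum>i\<in>D. \<bar>u i\<bar>))"
    by blast
  have "\<bar>u i * p u\<bar> \<le> C * exp (real (Suc k) * (\<Sum>i\<in>D. \<bar>u i\<bar>))" for u
  proof -
    have "\<bar>u i\<bar> \<le> (\<Sum>i\<in>D. \<bar>u i\<bar>)"
      using assms(1) polyf_coord_mult.hyps by (intro member_le_sum) auto
    also have "\<dots> \<le> exp (\<Sum>i\<in>D. \<bar>u i\<bar>)"
      using exp_ge_add_one_self[of "\<Sum>i\<in>D. \<bar>u i\<bar>"] by linarith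
    finally have "\<bar>u i\<bar> * \<bar>p u\<bar> \<le> exp (\<Sum>i\<in>D. \<bar>u i\<bar>) * (C * exp (real k * (\<Sum>i\<in>D. \<bar>u i\<bar>)))"
      using C by (intro mult_mono) auto
    then show ?thesis by (simp add: abs_mult exp_add[symmetric] algebra_simps)
  qed
  then show ?case using C by blast
next
  case (polyf_add m p q)
  then obtain C k C' k' where
    C: "C \<ge> 0" "\<And>u. \<bar>p u\<bar> \<le> C * exp (real k * (\<Sum>i\<in>D. \<bar>u i\<bar>))" and
    C': "C' \<ge> 0" "\<And>u. \<bar>q u\<bar> \<le> C' * exp (real k' * (\<Sum>i\<in>D. \<bar>u i\<bar>))"
    by blast
  have "\<bar>p u + q u\<bar> \<le> (C + C') * exp (real (k + k') * (\<Sum>i\<in>D. \<bar>u i\<bar>))" for u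
  proof -
    let ?S = "\<Sum>i\<in>D. \<bar>u i\<bar>"
    have S: "0 \<le> ?S" by (simp add: sum_nonneg)
    have "C * exp (real k * ?S) \<le> C * exp (real (k + k') * ?S)"
      using C S by (intro mult_left_mono) (auto intro: mult_right_mono)
    moreover have "C' * exp (real k' * ?S) \<le> C' * exp (real (k + k') * ?S)"
      using C' S by (intro mult_left_mono) (auto intro: mult_right_mono)
    ultimately show ?thesis
      using C(2)[of u] C'(2)[of u] unfolding distrib_right by linarith
  qed
  then show ?case
    using C(1) C'(1) by (intro exI[of _ "C + C'"] conjI exI[of _ "k + k'"]) auto
qed

text \<open>The clause for \<open>m = 0\<close> repairs the truncated subtraction: the product rule
  produces u_j times q, which has degree at most 0 only because q vanishes.\<close>

lemma polyf_has_pd: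
  assumes "polyf D m p"
  shows "\<exists>q. polyf D (m - 1) q \<and> (m = 0 \<longrightarrow> q = (\<lambda>_. 0)) \<and> has_pd i p q"
  using assms
proof (induction rule: polyf.induct)
  case (polyf_const m c)
  show ?case by (intro exI[of _ "\<lambda>_. 0"]) (simp add: has_pd_const polyf.polyf_const)
next
  case (polyf_coord_mult j m p)
  then obtain q where q: "polyf D (m - 1) q" "m = 0 \<longrightarrow> q = (\<lambda>_. 0)" "has_pd i p q"
    by blast
  have "polyf D m (\<lambda>u. u j * q u)"
  proof (cases "m = 0")
    case True
    then show ?thesis using q polyf_const[of D m 0] by simp
  next
    case False
    then show ?thesis using polyf.polyf_coord_mult[OF polyf_coord_mult.hyps(1) q(1)] by simp
  qed
  moreover have "polyf D m (\<lambda>u. (if i = j then 1 else 0) * p u)"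
    using polyf_coord_mult.hyps by (intro polyf_cmult)
  ultimately have "polyf D (Suc m - 1) (\<lambda>u. (if i = j then 1 else 0) * p u + u j * q u)"
    using polyf_add by fastforce
  then show ?case
    using has_pd_mult[OF has_pd_coord[of i j] q(3)] by blast
next
  case (polyf_add m p p')
  then obtain q q' where q: "polyf D (m - 1) q" "m = 0 \<longrightarrow> q = (\<lambda>_. 0)" "has_pd i p q"
    and q': "polyf D (m - 1) q'" "m = 0 \<longrightarrow> q' = (\<lambda>_. 0)" "has_pd i p' q'"
    by blast
  show ?case
    using polyf.polyf_add[OF q(1) q'(1)] q(2) q'(2) has_pd_add[OF q(3) q'(3)] by auto
qed

text \<open>The shared witness \<open>s\<close> expresses the symmetry of second derivatives. It is
  built along the polynomial, since the product rule gives the same four terms in either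
  order.\<close>

lemma polyf_pd_commute:
  assumes "polyf D m p"
  shows "\<exists>q r s. has_pd i p q \<and> has_pd j p r \<and> has_pd j q s \<and> has_pd i r s"
  using assms
proof (induction rule: polyf.induct)
  case (polyf_const m c)
  show ?case by (intro exI conjI, (rule has_pd_const)+)
next
  case (polyf_coord_mult k m p)
  then obtain q r s where *: "has_pd i p q" "has_pd j p r" "has_pd j q s" "has_pd i r s"
    by blast
  let ?di = "if i = k then 1 else 0 :: real" and ?dj = "if j = k then 1 else 0 :: real"
  have 1: "has_pd j (\<lambda>u. ?di * p u + u k * q u) (\<lambda>u. ?di * r u + (?dj * q u + u k * s u))"
    by (rule has_pd_add[OF has_pd_cmult[OF *(2)] has_pd_mult[OF has_pd_coord *(3)]])
  have "has_pd i (\<lambda>u. ?dj * p u + u k * r u) (\<lambda>u. ?dj * q u + (?di * r u + u k * s u))"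
    by (rule has_pd_add[OF has_pd_cmult[OF *(1)] has_pd_mult[OF has_pd_coord *(4)]])
  also have "(\<lambda>u. ?dj * q u + (?di * r u + u k * s u)) = (\<lambda>u. ?di * r u + (?dj * q u + u k * s u))"
    by (rule ext) (rule add.left_commute)
  finally have 2: "has_pd i (\<lambda>u. ?dj * p u + u k * r u) (\<lambda>u. ?di * r u + (?dj * q u + u k * s u))" .
  show ?case
    by (intro exI conjI, rule has_pd_mult[OF has_pd_coord *(1)], rule has_pd_mult[OF has_pd_coord *(2)],
        rule 1, rule 2)
next
  case (polyf_add m p p')
  then obtain q r s q' r' s' where
    "has_pd i p q" "has_pd j p r" "has_pd j q s" "has_pd i r s"
    "has_pd i p' q'" "has_pd j p' r'" "has_pd j q' s'" "has_pd i r' s'"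
    by blast
  then have "has_pd i (\<lambda>u. p u + p' u) (\<lambda>u. q u + q' u)" "has_pd j (\<lambda>u. p u + p' u) (\<lambda>u. r u + r' u)"
    "has_pd j (\<lambda>u. q u + q' u) (\<lambda>u. s u + s' u)" "has_pd i (\<lambda>u. r u + r' u) (\<lambda>u. s u + s' u)"
    by (simp_all add: has_pd_add)
  then show ?case by (intro exI conjI)
qed

section \<open>Partial derivatives of the Gaussian density\<close>

locale gaussian_kernel =
  fixes D :: "'i set" and K :: "'i \<Rightarrow> 'i \<Rightarrow> real"
  assumes finite_D: "finite D"
    and pos_def: "pos_def_on D K"
    and symmetric: "\<And>i j. K i j = K j i"
begin

abbreviation \<phi> :: "('i \<Rightarrow> real) \<Rightarrow> real" where
  "\<phi> \<equiv> gauss_density D K"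

text \<open>For \<open>i\<close> in \<open>D\<close>, minus the logarithmic derivative of the
  density in direction \<open>i\<close>.\<close>

definition dual :: "'i \<Rightarrow> ('i \<Rightarrow> real) \<Rightarrow> real" where
  "dual i u = (\<Sum>j\<in>D. inv_on D K i j * u j)"

lemma dual_polyf: "polyf D 1 (dual i)"
  unfolding dual_def[abs_def]
  by (rule polyf_sum[OF finite_D], rule polyf_cmult) (use polyf_coord[of _ D 0] in simp)

lemma dual_has_pd: "has_pd j (dual i) (\<lambda>_. inv_on D K i j)"
proof -
  have "has_pd j (dual i) (\<lambda>_. \<Sum>a\<in>D. inv_on D K i a * (if j = a then 1 else 0))"
    unfolding dual_def[abs_def]
    by (rule has_pd_sum[OF finite_D], rule has_pd_cmult, rule has_pd_coord)
  moreover have "(\<Sum>a\<in>D. inv_on D K i a * (if j = a then 1 else 0)) = inv_on D K i j"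
    using finite_D inv_on_properties(2)[OF finite_D pos_def, of i j]
    by (simp add: if_distrib[of "(*) _"] cong: if_cong)
  ultimately show ?thesis by simp
qed

lemma density_has_pd:
  assumes "i \<in> D"
  shows "has_pd i \<phi> (\<lambda>u. - dual i u * \<phi> u)"
proof -
  let ?L = "inv_on D K"
  let ?d = "\<lambda>a. if i = a then 1 else 0 :: real"
  define q where "q u = (\<Sum>a\<in>D. \<Sum>b\<in>D. u a * ?L a b * u b)" for u
  have "has_pd i q (\<lambda>u. \<Sum>a\<in>D. \<Sum>b\<in>D. (?d a * ?L a b + u a * 0) * u b + u a * ?L a b * ?d b)"
    unfolding q_def[abs_def]
    by (intro has_pd_sum finite_D has_pd_mult has_pd_coord has_pd_const)
  \<comment> \<open>The two halves of the product rule agree because the inverse matrix is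
    symmetric; this 2 cancels the 2 in the exponent of the density.\<close>
  moreover have "(\<Sum>a\<in>D. \<Sum>b\<in>D. (?d a * ?L a b + u a * 0) * u b + u a * ?L a b * ?d b) = 2 * dual i u"
    for u
  proof -
    have "(\<Sum>a\<in>D. \<Sum>b\<in>D. (?d a * ?L a b + u a * 0) * u b + u a * ?L a b * ?d b)
        = (\<Sum>a\<in>D. ?d a * (\<Sum>b\<in>D. ?L a b * u b)) + (\<Sum>a\<in>D. u a * (\<Sum>b\<in>D. ?L a b * ?d b))"
      by (simp add: sum.distrib sum_distrib_left mult.assoc)
    also have "(\<Sum>a\<in>D. ?d a * (\<Sum>b\<in>D. ?L a b * u b)) = dual i u"
      using assms finite_D by (simp add: if_distrib[of "\<lambda>x. x * _"] dual_def cong: if_cong)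
    also have "(\<Sum>a\<in>D. u a * (\<Sum>b\<in>D. ?L a b * ?d b)) = (\<Sum>a\<in>D. u a * ?L a i)"
      using assms finite_D by (simp add: if_distrib[of "(*) _"] cong: if_cong)
    also have "\<dots> = dual i u"
      unfolding dual_def
      by (intro sum.cong refl) (metis inv_on_symmetric[OF finite_D pos_def symmetric] mult.commute)
    finally show ?thesis by simp
  qed
  ultimately have "has_pd i q (\<lambda>u. 2 * dual i u)" by simp
  from has_pd_cmult[OF has_pd_exp[OF has_pd_cmult[OF this, of "- 1 / 2"]],
      of "1 / sqrt ((2 * pi) ^ card D * det_on D K)"]
  show ?thesis
    unfolding gauss_density_def[abs_def] q_def[symmetric] by simp
qed

text \<open>This class contains the density and is stable under partial derivatives, each raising
  the degree bound by one. Membership thus supplies differentiability, decay and integrability of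
  all iterated derivatives.\<close>

definition gaussf :: "nat \<Rightarrow> (('i \<Rightarrow> real) \<Rightarrow> real) set" where
  "gaussf m = {\<lambda>u. p u * \<phi> u | p. polyf D m p}"

lemma density_gaussf: "\<phi> \<in> gaussf m"
  unfolding gaussf_def using polyf_const[of D m 1] by force

lemma gaussf_cmult: "g \<in> gaussf m \<Longrightarrow> (\<lambda>u. c * g u) \<in> gaussf m"
  unfolding gaussf_def using polyf_cmult[of D m _ c] by (force simp: mult.assoc)

lemma polyf_mult_gaussf:
  assumes "polyf D m p" "g \<in> gaussf n"
  shows "(\<lambda>u. p u * g u) \<in> gaussf (m + n)"
proof -
  obtain q where "polyf D n q" "g = (\<lambda>u. q u * \<phi> u)"
    using assms(2) unfolding gaussf_def by blast
  then show ?thesis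
    unfolding gaussf_def using polyf_mult[OF assms(1), of n q] by (force simp: mult.assoc)
qed

lemma polyf_density_has_pd:
  assumes "i \<in> D" "has_pd i p q"
  shows "has_pd i (\<lambda>u. p u * \<phi> u) (\<lambda>u. (q u - dual i u * p u) * \<phi> u)"
  using has_pd_mult[OF assms(2) density_has_pd[OF assms(1)]] by (simp add: algebra_simps)

lemma gaussf_has_pd:
  assumes "i \<in> D" "g \<in> gaussf m"
  shows "partial_deriv i g \<in> gaussf (Suc m)" "has_pd i g (partial_deriv i g)"
proof -
  obtain p where p: "polyf D m p" "g = (\<lambda>u. p u * \<phi> u)"
    using assms(2) unfolding gaussf_def by blast
  obtain q where q: "polyf D (m - 1) q" "has_pd i p q"
    using polyf_has_pd[OF p(1)] by blast
  have "has_pd i g (\<lambda>u. (q u - dual i u * p u) * \<phi> u)"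
    unfolding p(2) by (rule polyf_density_has_pd[OF assms(1) q(2)])
  moreover from this have eq: "partial_deriv i g = (\<lambda>u. (q u - dual i u * p u) * \<phi> u)"
    by (rule has_pd_imp_partial_deriv)
  moreover have "polyf D (Suc m) (\<lambda>u. q u - dual i u * p u)"
    using polyf_mult[OF dual_polyf p(1), of i] polyf_mono[OF q(1), of "Suc m"]
    by (intro polyf_diff) auto
  ultimately show "partial_deriv i g \<in> gaussf (Suc m)" "has_pd i g (partial_deriv i g)"
    unfolding gaussf_def by auto
qed

lemma gaussf_pd_commute:
  assumes "i \<in> D" "j \<in> D" "g \<in> gaussf m"
  shows "partial_deriv i (partial_deriv j g) = partial_deriv j (partial_deriv i g)"
proof -
  obtain p where p: "polyf D m p" "g = (\<lambda>u. p u * \<phi> u)"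
    using assms(3) unfolding gaussf_def by blast
  obtain q r s where *: "has_pd i p q" "has_pd j p r" "has_pd j q s" "has_pd i r s"
    using polyf_pd_commute[OF p(1)] by blast
  \<comment> \<open>One formula covers both orders of differentiation; what remains is to exchange
    \<open>a\<close> and \<open>b\<close> in it, using the symmetry of the inverse matrix.\<close>
  have second: "partial_deriv b (partial_deriv a g) = (\<lambda>u. (s u - (inv_on D K a b * p u + dual a u * q' u)
      - dual b u * (r' u - dual a u * p u)) * \<phi> u)"
    if "a \<in> D" "b \<in> D" "has_pd a p r'" "has_pd b p q'" "has_pd b r' s" for a b q' r'
  proof -
    have "partial_deriv a g = (\<lambda>u. (r' u - dual a u * p u) * \<phi> u)"
      unfolding p(2) by (intro has_pd_imp_partial_deriv polyf_density_has_pd that)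
    moreover have "has_pd b (\<lambda>u. r' u - dual a u * p u)
        (\<lambda>u. s u - (inv_on D K a b * p u + dual a u * q' u))"
      using has_pd_add[OF that(5) has_pd_cmult[OF has_pd_mult[OF dual_has_pd[of b a] that(4)], of "-1"]]
      by (simp add: algebra_simps)
    ultimately show ?thesis
      by (simp add: has_pd_imp_partial_deriv[OF polyf_density_has_pd[OF that(2)]])
  qed
  show ?thesis
    unfolding second[OF assms(2,1) *(2,1,4)] second[OF assms(1,2) *(1,2,3)]
    using inv_on_symmetric[OF finite_D pos_def symmetric, of i j]
    by (auto simp: algebra_simps)
qed

abbreviation iter_pd :: "('i \<Rightarrow> nat) \<Rightarrow> 'i list \<Rightarrow> (('i \<Rightarrow> real) \<Rightarrow> real) \<Rightarrow> ('i \<Rightarrow> real) \<Rightarrow> real" where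
  "iter_pd \<alpha> xs F \<equiv> foldr (\<lambda>i G. (partial_deriv i ^^ \<alpha> i) G) xs F"

lemma funpow_pd_gaussf:
  "i \<in> D \<Longrightarrow> g \<in> gaussf m \<Longrightarrow> (partial_deriv i ^^ n) g \<in> gaussf (m + n)"
  by (induction n) (auto dest: gaussf_has_pd(1))

lemma iter_pd_gaussf:
  "set xs \<subseteq> D \<Longrightarrow> g \<in> gaussf m \<Longrightarrow> iter_pd \<alpha> xs g \<in> gaussf (m + sum_list (map \<alpha> xs))"
proof (induction xs)
  case (Cons x xs)
  then have "(partial_deriv x ^^ \<alpha> x) (iter_pd \<alpha> xs g) \<in> gaussf (m + sum_list (map \<alpha> xs) + \<alpha> x)"
    by (intro funpow_pd_gaussf) auto
  then show ?case by (simp add: ac_simps)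
qed simp

lemma funpow_pd_commute:
  assumes "i \<in> D" "x \<in> D" "g \<in> gaussf m"
  shows "partial_deriv x ((partial_deriv i ^^ n) g) = (partial_deriv i ^^ n) (partial_deriv x g)"
proof (induction n)
  case (Suc n)
  have "partial_deriv x ((partial_deriv i ^^ Suc n) g) = partial_deriv i (partial_deriv x ((partial_deriv i ^^ n) g))"
    using gaussf_pd_commute[OF assms(2,1) funpow_pd_gaussf[OF assms(1,3), of n]] by simp
  then show ?case using Suc by simp
qed simp

text \<open>The additional derivative in \<open>x\<close> appears wherever the chosen order places
  \<open>x\<close>, and has to be commuted past everything in front of it.\<close>

lemma iter_pd_fun_upd_Suc:
  assumes "distinct xs" "x \<in> set xs" "set xs \<subseteq> D" "g \<in> gaussf m"
  shows "iter_pd (\<alpha>(x := Suc (\<alpha> x))) xs g = partial_deriv x (iter_pd \<alpha> xs g)"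
  using assms(1-3)
proof (induction xs)
  case (Cons y ys)
  show ?case
  proof (cases "y = x")
    case True
    then have "x \<notin> set ys" using Cons by simp
    then have "iter_pd (\<alpha>(x := Suc (\<alpha> x))) ys g = iter_pd \<alpha> ys g"
      by (intro foldr_cong) auto
    then show ?thesis using True by simp
  next
    case False
    then have "iter_pd (\<alpha>(x := Suc (\<alpha> x))) ys g = partial_deriv x (iter_pd \<alpha> ys g)"
      using Cons by auto
    moreover have "iter_pd \<alpha> ys g \<in> gaussf (m + sum_list (map \<alpha> ys))"
      using Cons assms(4) by (intro iter_pd_gaussf) auto
    ultimately show ?thesis
      using False Cons funpow_pd_commute[of y x "iter_pd \<alpha> ys g"] by auto
  qed
qed simp

text \<open>The product of the Hermite polynomial and the density. With the sign included, raising
  the multi-index in direction x is minus the derivative in x, which matches integration by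
  parts.\<close>

definition density_deriv :: "('i \<Rightarrow> nat) \<Rightarrow> ('i \<Rightarrow> real) \<Rightarrow> real" where
  "density_deriv \<alpha> u = (- 1) ^ (\<Sum>i\<in>D. \<alpha> i) * mixed_partial D \<alpha> \<phi> u"

text \<open>The order picked by \<open>SOME\<close> depends on \<open>D\<close> alone, so a single
  list serves all multi-indices and all functions.\<close>

lemma mixed_partial_list:
  obtains xs where "distinct xs" "set xs = D" "\<And>\<alpha> F. mixed_partial D \<alpha> F = iter_pd \<alpha> xs F"
proof -
  define xs where "xs = (SOME xs. distinct xs \<and> set xs = D)"
  have "distinct xs \<and> set xs = D"
    unfolding xs_def by (rule someI_ex) (use finite_distinct_list[OF finite_D] in blast)
  then show ?thesis
    using that[of xs] unfolding mixed_partial_def xs_def by blast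
qed

lemma density_deriv_gaussf: "density_deriv \<alpha> \<in> gaussf (\<Sum>i\<in>D. \<alpha> i)"
proof -
  obtain xs where xs: "distinct xs" "set xs = D" "\<And>\<alpha> F. mixed_partial D \<alpha> F = iter_pd \<alpha> xs F"
    using mixed_partial_list by blast
  have "mixed_partial D \<alpha> \<phi> \<in> gaussf (\<Sum>i\<in>D. \<alpha> i)"
    using iter_pd_gaussf[of xs \<phi> 0 \<alpha>] density_gaussf xs by (simp add: sum_list_distinct_conv_sum_set)
  then show ?thesis
    unfolding density_deriv_def[abs_def] by (rule gaussf_cmult)
qed

lemma density_deriv_zero:
  assumes "\<And>i. i \<in> D \<Longrightarrow> \<alpha> i = 0"
  shows "density_deriv \<alpha> = \<phi>"
proof -
  obtain xs where xs: "distinct xs" "set xs = D" "\<And>\<alpha> F. mixed_partial D \<alpha> F = iter_pd \<alpha> xs F"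
    using mixed_partial_list by blast
  have "iter_pd \<alpha> xs \<phi> = iter_pd (\<lambda>_. 0) xs \<phi>"
    by (rule foldr_cong) (simp_all add: xs(2) assms)
  also have "\<dots> = \<phi>"
    by (induction xs) simp_all
  finally have "mixed_partial D \<alpha> \<phi> = \<phi>"
    unfolding xs(3) .
  moreover have "(\<Sum>i\<in>D. \<alpha> i) = 0"
    by (rule sum.neutral) (simp add: assms)
  ultimately show ?thesis
    unfolding density_deriv_def by simp
qed

lemma sum_fun_upd_Suc:
  assumes "i \<in> D"
  shows "(\<Sum>x\<in>D. (\<beta>(i := Suc (\<beta> i))) x) = Suc (\<Sum>x\<in>D. \<beta> x)"
proof -
  have "(\<Sum>x\<in>D. (\<beta>(i := Suc (\<beta> i))) x) = (\<Sum>x\<in>D. \<beta> x + (if x = i then 1 else 0))"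
    by (rule sum.cong) auto
  then show ?thesis using finite_D assms by (simp add: sum.distrib)
qed

lemma density_deriv_Suc:
  assumes "x \<in> D"
  shows "density_deriv (\<alpha>(x := Suc (\<alpha> x))) = (\<lambda>u. - partial_deriv x (density_deriv \<alpha>) u)"
proof -
  obtain xs where xs: "distinct xs" "set xs = D" "\<And>\<alpha> F. mixed_partial D \<alpha> F = iter_pd \<alpha> xs F"
    using mixed_partial_list by blast
  let ?m = "mixed_partial D \<alpha> \<phi>"
  have "?m \<in> gaussf (\<Sum>i\<in>D. \<alpha> i)"
    using iter_pd_gaussf[of xs \<phi> 0 \<alpha>] density_gaussf xs by (simp add: sum_list_distinct_conv_sum_set)
  from has_pd_cmult[OF gaussf_has_pd(2)[OF assms this]]
  have "partial_deriv x (density_deriv \<alpha>) = (\<lambda>u. (- 1) ^ (\<Sum>i\<in>D. \<alpha> i) * partial_deriv x ?m u)"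
    unfolding density_deriv_def[abs_def] by (rule has_pd_imp_partial_deriv)
  moreover have "mixed_partial D (\<alpha>(x := Suc (\<alpha> x))) \<phi> = partial_deriv x ?m"
    using xs assms iter_pd_fun_upd_Suc[of xs x \<phi> 0 \<alpha>] density_gaussf by simp
  moreover have "(\<Sum>i\<in>D. (\<alpha>(x := Suc (\<alpha> x))) i) = Suc (\<Sum>i\<in>D. \<alpha> i)"
    by (rule sum_fun_upd_Suc[OF assms])
  ultimately show ?thesis by (simp add: density_deriv_def[abs_def])
qed

lemma hermite_density_deriv: "hermite D K \<alpha> u = density_deriv \<alpha> u / \<phi> u"
  by (simp add: hermite_def density_deriv_def)

end

section \<open>Integration by parts at a threshold\<close>

text \<open>Exactly one candidate set matches all the threshold comparisons, so all other products
  contain a zero factor. Writing the functional through one-dimensional indicators serves both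
  measurability and approximation by polynomials.\<close>

lemma excursion_set_expansion:
  fixes \<Xi> :: "'i set \<Rightarrow> real"
  assumes "finite D"
  shows "\<Xi> (excursion_set D \<nu> u) =
    (\<Sum>E\<in>Pow D. \<Xi> E * (\<Prod>x\<in>D. if x \<in> E then indicator {\<nu> x<..} (u x) else 1 - indicator {\<nu> x<..} (u x)))"
proof -
  let ?X = "excursion_set D \<nu> u"
  have *: "(\<Prod>x\<in>D. if x \<in> E then indicator {\<nu> x<..} (u x) else 1 - indicator {\<nu> x<..} (u x))
      = (if E = ?X then 1 else 0 :: real)" if "E \<in> Pow D" for E
  proof (cases "E = ?X")
    case True
    then show ?thesis by (auto intro!: prod.neutral simp: excursion_set_def)
  next
    case False
    have "\<exists>x\<in>D. (x \<in> E) \<noteq> (\<nu> x < u x)"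
    proof (rule ccontr)
      assume "\<not> (\<exists>x\<in>D. (x \<in> E) \<noteq> (\<nu> x < u x))"
      then have "E = ?X"
        using that by (auto simp: excursion_set_def)
      then show False using False by simp
    qed
    then obtain x where x: "x \<in> D" "(x \<in> E) \<noteq> (\<nu> x < u x)"
      by blast
    have "(\<Prod>x\<in>D. if x \<in> E then indicator {\<nu> x<..} (u x) else 1 - indicator {\<nu> x<..} (u x)) = (0::real)"
      by (rule prod_zero[OF assms], rule bexI[OF _ x(1)]) (use x(2) in \<open>auto simp: indicator_def\<close>)
    then show ?thesis using False by simp
  qed
  have "?X \<in> Pow D" by (auto simp: excursion_set_def)
  have "(\<Sum>E\<in>Pow D. \<Xi> E * (\<Prod>x\<in>D. if x \<in> E then indicator {\<nu> x<..} (u x) else 1 - indicator {\<nu> x<..} (u x)))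
      = (\<Sum>E\<in>Pow D. if E = ?X then \<Xi> E else 0)"
    by (rule sum.cong[OF refl]) (simp only: * mult_1_right mult_zero_right if_distrib[of "(*) _"])
  also have "\<dots> = \<Xi> ?X"
    using assms \<open>?X \<in> Pow D\<close> by (simp add: sum.delta)
  finally show ?thesis by simp
qed

lemma coordinate_measurable_PiM:
  "i \<in> D \<Longrightarrow> (\<lambda>u. u i) \<in> borel_measurable (\<Pi>\<^sub>M i\<in>D. lborel)"
  using measurable_component_singleton[of i D "\<lambda>_. lborel"] by simp

lemma excursion_functional_measurable:
  fixes \<Xi> :: "'i set \<Rightarrow> real"
  assumes "finite D"
  shows "(\<lambda>u. \<Xi> (excursion_set D \<nu> u)) \<in> borel_measurable (\<Pi>\<^sub>M i\<in>D. lborel)"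
proof -
  have [measurable]: "(\<lambda>u. indicator {\<nu> x<..} (u x) :: real) \<in> borel_measurable (\<Pi>\<^sub>M i\<in>D. lborel)"
    if "x \<in> D" for x
    by (rule measurable_compose[OF coordinate_measurable_PiM[OF that]]) simp
  have *: "(\<lambda>u. \<Prod>x\<in>D. if x \<in> E then indicator {\<nu> x<..} (u x) else 1 - indicator {\<nu> x<..} (u x) :: real)
      \<in> borel_measurable (\<Pi>\<^sub>M i\<in>D. lborel)" for E
    by (rule borel_measurable_prod) auto
  show ?thesis
    unfolding excursion_set_expansion[OF assms, of \<Xi>]
    by (intro borel_measurable_sum borel_measurable_times borel_measurable_const) (rule *)
qed

lemma excursion_functional_bound:
  fixes \<Xi> :: "'i set \<Rightarrow> real"
  assumes "finite D"
  shows "\<bar>\<Xi> (excursion_set D \<nu> u)\<bar> \<le> (\<Sum>E\<in>Pow D. \<bar>\<Xi> E\<bar>)"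
  by (rule member_le_sum[of "excursion_set D \<nu> u" "Pow D" "\<lambda>E. \<bar>\<Xi> E\<bar>"]) (use assms in \<open>auto simp: excursion_set_def\<close>)

text \<open>By the fundamental theorem the half-line above \<open>a\<close> contributes -A F(a) and
  the one below contributes B F(a), since F vanishes at both ends; the point \<open>a\<close> itself
  is null.\<close>

lemma integral_step_times_derivative:
  fixes F F' :: "real \<Rightarrow> real"
  assumes deriv: "\<And>t. (F has_real_derivative F' t) (at t)"
    and cont: "\<And>t. isCont F' t"
    and int: "integrable lborel F'"
    and lim: "(F \<longlongrightarrow> 0) at_top" "(F \<longlongrightarrow> 0) at_bot"
  shows "(\<integral>t. (if t > a then A else B) * F' t \<partial>lborel) = (B - A) * F a"
proof -
  have vd: "(F has_vector_derivative F' t) (at t)" for t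
    using deriv[of t] by (simp add: has_real_derivative_iff_has_vector_derivative)
  have Fa: "isCont F a"
    using deriv DERIV_isCont by blast
  have si: "set_integrable lborel S F'" if "S \<in> sets lborel" for S
    unfolding set_integrable_def
    using integrable_mult_indicator[OF that int] by simp
  have "(LBINT t=ereal a..\<infinity>. F' t) = 0 - F a"
    by (rule interval_integral_FTC_integrable)
      (use vd cont si lim Fa in \<open>auto simp: ereal_tendsto_simps1 isCont_def filterlim_at_split\<close>)
  then have 1: "(\<integral>t. indicator {a<..} t * F' t \<partial>lborel) = - F a"
    by (simp add: interval_lebesgue_integral_def set_lebesgue_integral_def)
  have "(LBINT t=-\<infinity>..ereal a. F' t) = F a - 0"
    by (rule interval_integral_FTC_integrable)
      (use vd cont si lim Fa in \<open>auto simp: ereal_tendsto_simps1 isCont_def filterlim_at_split\<close>)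
  then have 2: "(\<integral>t. indicator {..<a} t * F' t \<partial>lborel) = F a"
    by (simp add: interval_lebesgue_integral_def set_lebesgue_integral_def)
  have "(\<integral>t. (if t > a then A else B) * F' t \<partial>lborel)
      = (\<integral>t. A * (indicator {a<..} t * F' t) + B * (indicator {..<a} t * F' t) \<partial>lborel)"
  proof (rule integral_cong_AE)
    have [measurable]: "F' \<in> borel_measurable borel"
      using int by auto
    show "(\<lambda>t. (if t > a then A else B) * F' t) \<in> borel_measurable lborel"
      by simp
    show "(\<lambda>t. A * (indicator {a<..} t * F' t) + B * (indicator {..<a} t * F' t)) \<in> borel_measurable lborel"
      by simp
    show "AE t in lborel. (if t > a then A else B) * F' t
        = A * (indicator {a<..} t * F' t) + B * (indicator {..<a} t * F' t)"
      using AE_lborel_singleton[of a] by eventually_elim (auto simp: indicator_def)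
  qed
  also have "\<dots> = (B - A) * F a"
    using si[of "{a<..}"] si[of "{..<a}"] 1 2 by (simp add: set_integrable_def algebra_simps)
  finally show ?thesis .
qed

lemma measurable_merge_const:
  "(\<lambda>z. merge J (D - J) (\<nu>, z)) \<in> measurable (\<Pi>\<^sub>M i\<in>D - J. lborel) (\<Pi>\<^sub>M i\<in>D. lborel :: real measure)"
  if "J \<subseteq> D"
proof -
  have eq: "merge J (D - J) (\<nu>, z) i = (if i \<in> J then \<nu> i else if i \<in> D - J then z i else undefined)" for z i
    by (simp add: merge_def)
  have "(\<lambda>z i. merge J (D - J) (\<nu>, z) i) \<in> measurable (\<Pi>\<^sub>M i\<in>D - J. lborel) (\<Pi>\<^sub>M i\<in>D. lborel)"
  proof (rule measurable_PiM_single')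
    fix i assume "i \<in> D"
    show "(\<lambda>z. merge J (D - J) (\<nu>, z) i) \<in> measurable (\<Pi>\<^sub>M i\<in>D - J. lborel) lborel"
    proof (cases "i \<in> J")
      case False
      then show ?thesis
        using coordinate_measurable_PiM[of i "D - J"] \<open>i \<in> D\<close> by (simp add: eq)
    qed (simp add: eq)
  qed (use that in \<open>auto simp: eq PiE_def extensional_def\<close>)
  then show ?thesis by simp
qed

lemma exp_minus_square_tendsto:
  fixes c :: real
  assumes "c > 0"
  shows "((\<lambda>t. exp (- (c * t\<^sup>2))) \<longlongrightarrow> 0) at_top" "((\<lambda>t. exp (- (c * t\<^sup>2))) \<longlongrightarrow> 0) at_bot"
  using assms by - (real_asymp, real_asymp)

section \<open>Gaussian tail bounds and integration by parts in one coordinate\<close>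

context gaussian_kernel
begin

text \<open>Summing \<open>coordinate_le_inv_form\<close> over \<open>D\<close> bounds the sum of
  squares by the trace of \<open>K\<close> times the quadratic form, so the exponent of the density
  is at most minus \<open>rate\<close> times the sum of squares. The added 1 keeps the rate positive
  when \<open>D\<close> is empty.\<close>

definition rate :: real where
  "rate = 1 / (2 * (1 + (\<Sum>i\<in>D. K i i)))"

lemma rate_pos: "0 < rate"
proof -
  have "0 \<le> (\<Sum>i\<in>D. K i i)"
    by (rule sum_nonneg) (use pos_def_on_diagonal[OF finite_D pos_def] in \<open>auto intro: less_imp_le\<close>)
  then show ?thesis by (simp add: rate_def)
qed

text \<open>Half of \<open>rate\<close> is kept for the decay; the other half pays for exponential
  factors.\<close>

definition bump :: "real \<Rightarrow> real" where
  "bump t = exp (- (rate / 2 * t\<^sup>2))"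

lemma integrable_bump: "integrable lborel bump"
proof -
  define \<sigma> where "\<sigma> = sqrt (1 / rate)"
  have \<sigma>: "\<sigma>\<^sup>2 = 1 / rate" "\<sigma> > 0"
    using rate_pos by (simp_all add: \<sigma>_def)
  have "bump = (\<lambda>t. sqrt (2 * pi * \<sigma>\<^sup>2) * normal_density 0 \<sigma> t)"
    using \<sigma> rate_pos by (auto simp: bump_def normal_density_def fun_eq_iff)
  then show ?thesis
    using integrable_mult_right[of "sqrt (2 * pi * \<sigma>\<^sup>2)" lborel "normal_density 0 \<sigma>"]
      integrable_normal_density[OF \<sigma>(2)] by simp
qed

lemma bump_at_top: "(bump \<longlongrightarrow> 0) at_top"
  unfolding bump_def[abs_def] using exp_minus_square_tendsto[of "rate / 2"] rate_pos by simp

lemma bump_at_bot: "(bump \<longlongrightarrow> 0) at_bot"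
  unfolding bump_def[abs_def] using exp_minus_square_tendsto[of "rate / 2"] rate_pos by simp

lemma density_nonzero:
  assumes "J \<subseteq> D"
  shows "gauss_density J K u \<noteq> 0"
proof -
  have "finite J" using assms finite_D finite_subset by blast
  then have "det_on J K \<noteq> 0"
    by (rule det_on_nonzero) (rule pos_def_on_subset[OF finite_D assms pos_def])
  then show ?thesis by (simp add: gauss_density_def)
qed

text \<open>A majorant of product form is integrable over any subset of the coordinates and also
  controls one-dimensional slices, although the density itself does not factorise.\<close>

lemma exp_density_bound:
  "\<exists>C\<ge>0. \<forall>u. exp (k * (\<Sum>i\<in>D. \<bar>u i\<bar>)) * \<bar>\<phi> u\<bar> \<le> C * (\<Prod>i\<in>D. bump (u i))"
proof -
  \<comment> \<open>The absolute value is taken because the sign of the normalising constant is not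
    known here.\<close>
  define c where "c = \<bar>1 / sqrt ((2 * pi) ^ card D * det_on D K)\<bar>"
  define e where "e = exp (k\<^sup>2 / (2 * rate))"
  have "exp (k * (\<Sum>i\<in>D. \<bar>u i\<bar>)) * \<bar>\<phi> u\<bar> \<le> (c * e ^ card D) * (\<Prod>i\<in>D. bump (u i))" for u
  proof -
    define Q where "Q = (\<Sum>i\<in>D. \<Sum>j\<in>D. u i * inv_on D K i j * u j)"
    have le: "(u i)\<^sup>2 \<le> K i i * Q" if "i \<in> D" for i
      unfolding Q_def by (rule coordinate_le_inv_form[OF finite_D pos_def symmetric that])
    have Q0: "0 \<le> Q"
    proof (cases "D = {}")
      case False
      then obtain i where i: "i \<in> D" by blast
      have "0 \<le> K i i * Q" by (rule order_trans[OF zero_le_power2 le[OF i]])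
      then show ?thesis
        using pos_def_on_diagonal[OF finite_D pos_def i] by (simp add: zero_le_mult_iff)
    qed (simp add: Q_def)
    have "(\<Sum>i\<in>D. (u i)\<^sup>2) \<le> (\<Sum>i\<in>D. K i i * Q)"
      by (rule sum_mono) (rule le)
    also have "\<dots> = (\<Sum>i\<in>D. K i i) * Q"
      by (simp add: sum_distrib_right)
    also have "\<dots> \<le> (1 + (\<Sum>i\<in>D. K i i)) * Q"
      using Q0 by (simp add: distrib_right)
    also have "\<dots> = Q / (2 * rate)"
      by (simp add: rate_def)
    finally have main: "rate * (\<Sum>i\<in>D. (u i)\<^sup>2) \<le> Q / 2"
      using rate_pos by (simp add: field_simps)
    \<comment> \<open>Completing the square: the constant term bounds k |t| minus the half of the
      quadratic decay that is given up.\<close>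
    have pt: "k * \<bar>t\<bar> - rate * t\<^sup>2 \<le> k\<^sup>2 / (2 * rate) - rate / 2 * t\<^sup>2" for t
    proof -
      have "0 \<le> (rate * \<bar>t\<bar> - k)\<^sup>2 / (2 * rate)"
        using rate_pos by simp
      also have "\<dots> = k\<^sup>2 / (2 * rate) + rate / 2 * t\<^sup>2 - k * \<bar>t\<bar>"
        using rate_pos
        by (simp add: power2_diff power_mult_distrib add_divide_distrib diff_divide_distrib)
          (simp add: power2_eq_square)
      finally show ?thesis by simp
    qed
    have "\<phi> u = exp (- Q / 2) * (1 / sqrt ((2 * pi) ^ card D * det_on D K))"
      by (simp add: gauss_density_def Q_def)
    then have "\<bar>\<phi> u\<bar> = exp (- Q / 2) * c"
      unfolding c_def by (simp only: abs_mult abs_exp_cancel)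
    then have "exp (k * (\<Sum>i\<in>D. \<bar>u i\<bar>)) * \<bar>\<phi> u\<bar> = c * exp (k * (\<Sum>i\<in>D. \<bar>u i\<bar>) - Q / 2)"
      using mult_exp_exp[of "k * (\<Sum>i\<in>D. \<bar>u i\<bar>)" "- Q / 2"] by (simp add: mult_ac)
    also have "\<dots> \<le> c * exp (\<Sum>i\<in>D. k\<^sup>2 / (2 * rate) - rate / 2 * (u i)\<^sup>2)"
    proof (rule mult_left_mono)
      have "k * (\<Sum>i\<in>D. \<bar>u i\<bar>) - Q / 2 \<le> (\<Sum>i\<in>D. k * \<bar>u i\<bar> - rate * (u i)\<^sup>2)"
        using main by (simp add: sum_subtractf sum_distrib_left)
      also have "\<dots> \<le> (\<Sum>i\<in>D. k\<^sup>2 / (2 * rate) - rate / 2 * (u i)\<^sup>2)"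
        by (rule sum_mono) (rule pt)
      finally show "exp (k * (\<Sum>i\<in>D. \<bar>u i\<bar>) - Q / 2) \<le> exp (\<Sum>i\<in>D. k\<^sup>2 / (2 * rate) - rate / 2 * (u i)\<^sup>2)"
        by simp
    qed (simp add: c_def)
    also have "exp (\<Sum>i\<in>D. k\<^sup>2 / (2 * rate) - rate / 2 * (u i)\<^sup>2) = (\<Prod>i\<in>D. e * bump (u i))"
      unfolding exp_sum[OF finite_D] by (rule prod.cong[OF refl]) (simp add: e_def bump_def flip: exp_add)
    also have "\<dots> = e ^ card D * (\<Prod>i\<in>D. bump (u i))"
      by (simp add: prod.distrib)
    finally show ?thesis by (simp add: mult.assoc)
  qed
  moreover have "0 \<le> c * e ^ card D" by (simp add: c_def e_def)
  ultimately show ?thesis by blast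
qed

lemma gaussf_bound:
  assumes "g \<in> gaussf m"
  shows "\<exists>C\<ge>0. \<forall>u. \<bar>g u\<bar> \<le> C * (\<Prod>i\<in>D. bump (u i))"
proof -
  obtain p where p: "polyf D m p" "g = (\<lambda>u. p u * \<phi> u)"
    using assms unfolding gaussf_def by blast
  obtain C k where C: "C \<ge> 0" "\<And>u. \<bar>p u\<bar> \<le> C * exp (real k * (\<Sum>i\<in>D. \<bar>u i\<bar>))"
    using polyf_exp_bound[OF finite_D p(1)] by blast
  obtain C' where C': "C' \<ge> 0"
      "\<And>u. exp (real k * (\<Sum>i\<in>D. \<bar>u i\<bar>)) * \<bar>\<phi> u\<bar> \<le> C' * (\<Prod>i\<in>D. bump (u i))"
    using exp_density_bound[of "real k"] by blast
  have "\<bar>g u\<bar> \<le> (C * C') * (\<Prod>i\<in>D. bump (u i))" for u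
  proof -
    have "\<bar>g u\<bar> \<le> C * (exp (real k * (\<Sum>i\<in>D. \<bar>u i\<bar>)) * \<bar>\<phi> u\<bar>)"
      using mult_right_mono[OF C(2)[of u], of "\<bar>\<phi> u\<bar>"] by (simp add: p(2) abs_mult mult.assoc)
    also have "\<dots> \<le> C * (C' * (\<Prod>i\<in>D. bump (u i)))"
      using C(1) C'(2) by (rule mult_left_mono[rotated])
    finally show ?thesis by (simp add: mult.assoc)
  qed
  moreover have "0 \<le> C * C'" using C(1) C'(1) by simp
  ultimately show ?thesis by blast
qed

lemma density_measurable: "\<phi> \<in> borel_measurable (\<Pi>\<^sub>M i\<in>D. lborel)"
proof -
  have "(\<lambda>u. \<Sum>i\<in>D. \<Sum>j\<in>D. u i * inv_on D K i j * u j) \<in> borel_measurable (\<Pi>\<^sub>M i\<in>D. lborel)"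
    by (intro borel_measurable_sum borel_measurable_times borel_measurable_const coordinate_measurable_PiM)
  from measurable_compose[OF this, of "\<lambda>x. exp (- x / 2) / sqrt ((2 * pi) ^ card D * det_on D K)" borel]
  show ?thesis
    unfolding gauss_density_def[abs_def] by simp
qed

lemma gaussf_measurable:
  assumes "g \<in> gaussf m"
  shows "g \<in> borel_measurable (\<Pi>\<^sub>M i\<in>D. lborel)"
proof -
  obtain p where p: "polyf D m p" "g = (\<lambda>u. p u * \<phi> u)"
    using assms unfolding gaussf_def by blast
  show ?thesis
    unfolding p(2) using polyf_measurable[OF p(1)] density_measurable by simp
qed

text \<open>When \<open>g\<close> is h times the density of a Gaussian vector with covariance
  \<open>K\<close>, this is the conditional expectation of the functional times h, given that the
  vector equals \<nu> on \<open>J\<close>, multiplied by the density of the subvector on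
  \<open>J\<close> at \<nu>. Unnormalised, it lets \<open>J\<close> grow from the empty set, where
  it is a plain integral, to the support of the multi-index.\<close>

definition threshold_integral ::
  "('i \<Rightarrow> real) \<Rightarrow> 'i set \<Rightarrow> ('i set \<Rightarrow> real) \<Rightarrow> (('i \<Rightarrow> real) \<Rightarrow> real) \<Rightarrow> real" where
  "threshold_integral \<nu> J \<Theta> g =
     (\<integral>z. \<Theta> (excursion_set D \<nu> (merge J (D - J) (\<nu>, z))) * g (merge J (D - J) (\<nu>, z))
        \<partial>(\<Pi>\<^sub>M x\<in>D - J. lborel))"

lemma threshold_integrable:
  assumes "J \<subseteq> D" "g \<in> gaussf m"
  shows "integrable (\<Pi>\<^sub>M x\<in>D - J. lborel)
    (\<lambda>z. \<Theta> (excursion_set D \<nu> (merge J (D - J) (\<nu>, z))) * g (merge J (D - J) (\<nu>, z)))"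
proof -
  interpret product_sigma_finite "\<lambda>_. lborel :: real measure" ..
  obtain C where C: "C \<ge> 0" "\<And>u. \<bar>g u\<bar> \<le> C * (\<Prod>i\<in>D. bump (u i))"
    using gaussf_bound[OF assms(2)] by blast
  define B where "B = (\<Sum>E\<in>Pow D. \<bar>\<Theta> E\<bar>)"
  define c where "c = B * (C * (\<Prod>i\<in>J. bump (\<nu> i)))"
  have fin: "finite J" "finite (D - J)"
    using assms(1) finite_D finite_subset by auto
  have "integrable (\<Pi>\<^sub>M x\<in>D - J. lborel) (\<lambda>z. c * (\<Prod>i\<in>D - J. bump (z i)))"
    by (rule integrable_mult_right, rule product_integrable_prod[OF fin(2)]) (rule integrable_bump)
  then show ?thesis
  proof (rule Bochner_Integration.integrable_bound)
    have "(\<lambda>z. \<Theta> (excursion_set D \<nu> (merge J (D - J) (\<nu>, z)))) \<in> borel_measurable (\<Pi>\<^sub>M x\<in>D - J. lborel)"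
      by (rule measurable_compose[OF measurable_merge_const[OF assms(1)] excursion_functional_measurable[OF finite_D]])
    moreover have "(\<lambda>z. g (merge J (D - J) (\<nu>, z))) \<in> borel_measurable (\<Pi>\<^sub>M x\<in>D - J. lborel)"
      by (rule measurable_compose[OF measurable_merge_const[OF assms(1)] gaussf_measurable[OF assms(2)]])
    ultimately show "(\<lambda>z. \<Theta> (excursion_set D \<nu> (merge J (D - J) (\<nu>, z))) * g (merge J (D - J) (\<nu>, z)))
        \<in> borel_measurable (\<Pi>\<^sub>M x\<in>D - J. lborel)" by simp
    have "\<bar>\<Theta> (excursion_set D \<nu> (merge J (D - J) (\<nu>, z))) * g (merge J (D - J) (\<nu>, z))\<bar>
        \<le> c * (\<Prod>i\<in>D - J. bump (z i))" for z
    proof -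
      let ?u = "merge J (D - J) (\<nu>, z)"
      have "(\<Prod>i\<in>D. bump (?u i)) = (\<Prod>i\<in>J \<union> (D - J). bump (?u i))"
        using assms(1) by (simp add: Un_absorb1)
      also have "\<dots> = (\<Prod>i\<in>J. bump (?u i)) * (\<Prod>i\<in>D - J. bump (?u i))"
        by (rule prod.union_disjoint) (use fin in auto)
      also have "\<dots> = (\<Prod>i\<in>J. bump (\<nu> i)) * (\<Prod>i\<in>D - J. bump (z i))"
        by (intro arg_cong2[where f = "(*)"] prod.cong refl) (auto simp: merge_def)
      finally have eq: "(\<Prod>i\<in>D. bump (?u i)) = (\<Prod>i\<in>J. bump (\<nu> i)) * (\<Prod>i\<in>D - J. bump (z i))" .
      have "\<bar>\<Theta> (excursion_set D \<nu> ?u) * g ?u\<bar> \<le> B * (C * (\<Prod>i\<in>D. bump (?u i)))"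
        unfolding abs_mult B_def
        by (rule mult_mono[OF excursion_functional_bound[OF finite_D] C(2)]) (auto intro: sum_nonneg)
      then show ?thesis by (simp add: eq c_def mult.assoc)
    qed
    then show "AE z in \<Pi>\<^sub>M x\<in>D - J. lborel. norm (\<Theta> (excursion_set D \<nu> (merge J (D - J) (\<nu>, z))) * g (merge J (D - J) (\<nu>, z)))
        \<le> norm (c * (\<Prod>i\<in>D - J. bump (z i)))"
      by (intro AE_I2, unfold real_norm_def, rule order_trans[OF _ abs_ge_self])
  qed
qed

text \<open>Integrating one coordinate by parts: the functional only jumps where that coordinate crosses
  its threshold.\<close>

lemma threshold_integral_step:
  assumes J: "J \<subseteq> D" and x: "x \<in> D" "x \<notin> J" and g: "g \<in> gaussf m"
  shows "threshold_integral \<nu> J \<Theta> (\<lambda>u. - partial_deriv x g u)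
    = threshold_integral \<nu> (insert x J) (disc_deriv x \<Theta>) g"
proof -
  interpret product_sigma_finite "\<lambda>_. lborel :: real measure" ..
  let ?R = "D - insert x J"
  let ?g' = "partial_deriv x g"
  have g': "?g' \<in> gaussf (Suc m)" "has_pd x g ?g'"
    using gaussf_has_pd[OF x(1) g] by auto
  have ng': "(\<lambda>u. - ?g' u) \<in> gaussf (Suc m)"
    using gaussf_cmult[OF g'(1), of "-1"] by simp
  have DJ: "D - J = insert x ?R" using x by auto
  have inner: "(\<integral>t. \<Theta> (excursion_set D \<nu> (merge J (D - J) (\<nu>, z(x := t))))
        * - ?g' (merge J (D - J) (\<nu>, z(x := t))) \<partial>lborel)
      = disc_deriv x \<Theta> (excursion_set D \<nu> (merge (insert x J) ?R (\<nu>, z))) * g (merge (insert x J) ?R (\<nu>, z))"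
    for z
  proof -
    \<comment> \<open>The point with \<open>x\<close> frozen at its threshold. Moving only the
      coordinate \<open>x\<close> away from it, the excursion set takes just two values, and their
      difference is the discrete derivative.\<close>
    define v where "v = merge (insert x J) ?R (\<nu>, z)"
    define X where "X = excursion_set D \<nu> v"
    have vx: "v x = \<nu> x" by (simp add: v_def merge_def)
    have mv: "merge J (D - J) (\<nu>, z(x := t)) = v(x := t)" for t
      using x by (auto simp: v_def merge_def fun_eq_iff)
    have ex: "excursion_set D \<nu> (v(x := t)) = (if t > \<nu> x then X \<union> {x} else X - {x})" for t
      using x by (auto simp: X_def excursion_set_def)
    obtain C where C: "C \<ge> 0" "\<And>u. \<bar>g u\<bar> \<le> C * (\<Prod>i\<in>D. bump (u i))"
      using gaussf_bound[OF g] by blast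
    obtain C' where C': "C' \<ge> 0" "\<And>u. \<bar>?g' u\<bar> \<le> C' * (\<Prod>i\<in>D. bump (u i))"
      using gaussf_bound[OF g'(1)] by blast
    define w where "w = (\<Prod>i\<in>D - {x}. bump (v i))"
    have pr: "(\<Prod>i\<in>D. bump ((v(x := t)) i)) = bump t * w" for t
      unfolding w_def prod.remove[OF finite_D x(1)] by (auto intro!: prod.cong)
    have deriv: "((\<lambda>t. g (v(x := t))) has_real_derivative ?g' (v(x := t))) (at t)" for t
      using g'(2)[unfolded has_pd_def, rule_format, of v t] .
    have cont: "isCont (\<lambda>t. ?g' (v(x := t))) t" for t
      using gaussf_has_pd(2)[OF x(1) g'(1), unfolded has_pd_def, rule_format, of v t] by (rule DERIV_isCont)
    have lim0: "((\<lambda>t. g (v(x := t))) \<longlongrightarrow> 0) F" if "(bump \<longlongrightarrow> 0) F" for F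
    proof (rule Lim_null_comparison)
      show "\<forall>\<^sub>F t in F. norm (g (v(x := t))) \<le> C * (bump t * w)"
        using C(2)[of "v(x := t)" for t] unfolding pr by (intro always_eventually allI) simp
      show "((\<lambda>t. C * (bump t * w)) \<longlongrightarrow> 0) F"
        using tendsto_mult_left[OF tendsto_mult_right[OF that, of w], of C] by simp
    qed
    have int: "integrable lborel (\<lambda>t. ?g' (v(x := t)))"
    proof (rule Bochner_Integration.integrable_bound)
      show "integrable lborel (\<lambda>t. C' * (bump t * w))"
        using integrable_bump by simp
      have "continuous_on UNIV (\<lambda>t. ?g' (v(x := t)))"
        using cont by (simp add: continuous_at_imp_continuous_on)
      then show "(\<lambda>t. ?g' (v(x := t))) \<in> borel_measurable lborel"
        by (simp add: borel_measurable_continuous_onI)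
      show "AE t in lborel. norm (?g' (v(x := t))) \<le> norm (C' * (bump t * w))"
        using C'(2)[of "v(x := t)" for t] unfolding pr
        by (intro AE_I2, unfold real_norm_def, rule order_trans[OF _ abs_ge_self])
    qed
    have "(\<integral>t. \<Theta> (excursion_set D \<nu> (merge J (D - J) (\<nu>, z(x := t))))
        * - ?g' (merge J (D - J) (\<nu>, z(x := t))) \<partial>lborel)
      = (\<integral>t. (if t > \<nu> x then - \<Theta> (X \<union> {x}) else - \<Theta> (X - {x})) * ?g' (v(x := t)) \<partial>lborel)"
      unfolding mv ex by (rule Bochner_Integration.integral_cong[OF refl]) simp
    also have "\<dots> = (- \<Theta> (X - {x}) - - \<Theta> (X \<union> {x})) * g (v(x := \<nu> x))"
      by (rule integral_step_times_derivative[OF deriv cont int lim0[OF bump_at_top] lim0[OF bump_at_bot]])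
    also have "v(x := \<nu> x) = v" using vx by auto
    also have "(- \<Theta> (X - {x}) - - \<Theta> (X \<union> {x})) * g v = disc_deriv x \<Theta> X * g v"
      by (simp add: disc_deriv_def)
    finally show ?thesis
      unfolding X_def v_def .
  qed
  define h where "h z = \<Theta> (excursion_set D \<nu> (merge J (D - J) (\<nu>, z))) * - ?g' (merge J (D - J) (\<nu>, z))" for z
  have "integrable (\<Pi>\<^sub>M x\<in>D - J. lborel) h"
    unfolding h_def[abs_def] by (rule threshold_integrable[OF J ng'])
  then have h: "integrable (\<Pi>\<^sub>M x\<in>insert x ?R. lborel) h"
    by (subst (asm) DJ)
  have "threshold_integral \<nu> J \<Theta> (\<lambda>u. - ?g' u) = integral\<^sup>L (\<Pi>\<^sub>M x\<in>D - J. lborel) h"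
    unfolding threshold_integral_def h_def ..
  also have "\<dots> = integral\<^sup>L (\<Pi>\<^sub>M x\<in>insert x ?R. lborel) h"
    by (subst DJ) (rule refl)
  also have "\<dots> = (\<integral>z. (\<integral>t. h (z(x := t)) \<partial>lborel) \<partial>(\<Pi>\<^sub>M x\<in>?R. lborel))"
    by (rule product_integral_insert[OF _ _ h]) (use finite_D in auto)
  also have "\<dots> = threshold_integral \<nu> (insert x J) (disc_deriv x \<Theta>) g"
    unfolding h_def inner threshold_integral_def ..
  finally show ?thesis .
qed

text \<open>Each listed point spends one derivative on its own integration by parts, and \<beta>
  stays on the density. The induction generalises over \<beta> because the derivative belonging to
  the head waits inside it while the tail is processed.\<close>

lemma threshold_integral_density_deriv:
  assumes "distinct ys" "set ys \<subseteq> D"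
  shows "threshold_integral \<nu> {} \<Theta> (density_deriv (\<lambda>i. \<beta> i + of_bool (i \<in> set ys)))
    = threshold_integral \<nu> (set ys) (foldr disc_deriv ys \<Theta>) (density_deriv \<beta>)"
  using assms
proof (induction ys arbitrary: \<beta>)
  case (Cons x ys)
  have eq: "(\<lambda>i. \<beta> i + of_bool (i \<in> set (x # ys))) = (\<lambda>i. (\<beta>(x := Suc (\<beta> x))) i + of_bool (i \<in> set ys))"
    using Cons.prems by (auto simp: fun_eq_iff)
  have "threshold_integral \<nu> {} \<Theta> (density_deriv (\<lambda>i. \<beta> i + of_bool (i \<in> set (x # ys))))
      = threshold_integral \<nu> (set ys) (foldr disc_deriv ys \<Theta>) (density_deriv (\<beta>(x := Suc (\<beta> x))))"
    unfolding eq by (rule Cons.IH) (use Cons.prems in auto)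
  also have "density_deriv (\<beta>(x := Suc (\<beta> x))) = (\<lambda>u. - partial_deriv x (density_deriv \<beta>) u)"
    using Cons.prems by (intro density_deriv_Suc) simp
  also have "threshold_integral \<nu> (set ys) (foldr disc_deriv ys \<Theta>) \<dots>
      = threshold_integral \<nu> (insert x (set ys)) (disc_deriv x (foldr disc_deriv ys \<Theta>)) (density_deriv \<beta>)"
    using Cons.prems by (intro threshold_integral_step[OF _ _ _ density_deriv_gaussf]) auto
  finally show ?case by simp
qed simp

lemma threshold_integral_empty:
  "threshold_integral \<nu> {} \<Theta> g = (\<integral>u. \<Theta> (excursion_set D \<nu> u) * g u \<partial>(\<Pi>\<^sub>M x\<in>D. lborel))"
proof -
  \<comment> \<open>Points of the product space are \<open>undefined\<close> outside
    \<open>D\<close>, exactly like merged functions.\<close>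
  have "merge {} D (\<nu>, z) = z" if "z \<in> space (\<Pi>\<^sub>M x\<in>D. lborel :: real measure)" for z
    using that by (auto simp: merge_def space_PiM PiE_def extensional_def fun_eq_iff)
  then show ?thesis
    unfolding threshold_integral_def Diff_empty
    by (intro Bochner_Integration.integral_cong[OF refl]) simp
qed

lemma integrable_gaussf:
  assumes "g \<in> gaussf m"
  shows "integrable (\<Pi>\<^sub>M x\<in>D. lborel) g"
proof -
  have "integrable (\<Pi>\<^sub>M x\<in>D - {}. lborel) (\<lambda>z. 1 * g (merge {} (D - {}) (\<nu>, z)))" for \<nu> :: "'i \<Rightarrow> real"
    by (rule threshold_integrable[OF _ assms, of "{}" "\<lambda>_. 1" \<nu>]) simp
  then have "integrable (\<Pi>\<^sub>M x\<in>D. lborel) (\<lambda>z. g (merge {} D (\<lambda>_. 0, z)))"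
    by simp
  moreover have "merge {} D (\<lambda>_. 0, z) = z" if "z \<in> space (\<Pi>\<^sub>M x\<in>D. lborel :: real measure)" for z
    using that by (auto simp: merge_def space_PiM PiE_def extensional_def fun_eq_iff)
  ultimately show ?thesis
    by (subst Bochner_Integration.integrable_cong[OF refl, of _ _ "\<lambda>z. g (merge {} D (\<lambda>_. 0, z))"]) auto
qed

text \<open>The case of a constant functional in \<open>threshold_integral_step\<close>: its
  discrete derivative is zero, so any threshold will do.\<close>

lemma integral_partial_deriv:
  assumes "x \<in> D" "g \<in> gaussf m"
  shows "(\<integral>u. partial_deriv x g u \<partial>(\<Pi>\<^sub>M x\<in>D. lborel)) = 0"
proof -
  have "threshold_integral (\<lambda>_. 0) {} (\<lambda>_. 1) (\<lambda>u. - partial_deriv x g u)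
      = threshold_integral (\<lambda>_. 0) {x} (disc_deriv x (\<lambda>_. 1)) g"
    using assms by (intro threshold_integral_step) auto
  moreover have "threshold_integral (\<lambda>_. 0) {x} (disc_deriv x (\<lambda>_. 1)) g = 0"
    by (simp add: threshold_integral_def disc_deriv_def)
  ultimately show ?thesis
    unfolding threshold_integral_empty by simp
qed

lemma integral_by_parts:
  assumes "x \<in> D" "polyf D m p" "polyf D n q" "has_pd x p q" "g \<in> gaussf k"
  shows "(\<integral>u. p u * - partial_deriv x g u \<partial>(\<Pi>\<^sub>M x\<in>D. lborel)) = (\<integral>u. q u * g u \<partial>(\<Pi>\<^sub>M x\<in>D. lborel))"
proof -
  note g' = gaussf_has_pd[OF assms(1,5)]
  have "partial_deriv x (\<lambda>u. p u * g u) = (\<lambda>u. q u * g u + p u * partial_deriv x g u)"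
    by (rule has_pd_imp_partial_deriv[OF has_pd_mult[OF assms(4) g'(2)]])
  then have "(\<integral>u. q u * g u + p u * partial_deriv x g u \<partial>(\<Pi>\<^sub>M x\<in>D. lborel)) = 0"
    using integral_partial_deriv[OF assms(1) polyf_mult_gaussf[OF assms(2,5)]] by simp
  then show ?thesis
    using integrable_gaussf[OF polyf_mult_gaussf[OF assms(3,5)]]
      integrable_gaussf[OF polyf_mult_gaussf[OF assms(2) g'(1)]]
    by simp
qed

section \<open>Duality of monomials and Hermite polynomials\<close>

definition monomial :: "('i \<Rightarrow> nat) \<Rightarrow> ('i \<Rightarrow> real) \<Rightarrow> real" where
  "monomial \<beta> u = (\<Prod>i\<in>D. u i ^ \<beta> i)"

lemma monomial_polyf: "polyf D (\<Sum>i\<in>D. \<beta> i) (monomial \<beta>)"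
proof -
  have pow: "polyf D n (\<lambda>u. u i ^ n)" if "i \<in> D" for i n
    by (induction n) (use polyf_const[of D 0 1] polyf_coord_mult[OF that] in auto)
  have "polyf D (\<Sum>i\<in>A. \<beta> i) (\<lambda>u. \<Prod>i\<in>A. u i ^ \<beta> i)" if "A \<subseteq> D" for A
    using finite_subset[OF that finite_D] that
  proof (induction A rule: finite_induct)
    case empty
    then show ?case using polyf_const[of D 0 1] by simp
  next
    case (insert a A)
    then show ?case using polyf_mult[OF pow[of a "\<beta> a"]] by simp
  qed
  then show ?thesis unfolding monomial_def[abs_def] by blast
qed

lemma monomial_has_pd:
  assumes "x \<in> D"
  shows "has_pd x (monomial \<beta>) (\<lambda>u. real (\<beta> x) * monomial (\<beta>(x := \<beta> x - 1)) u)"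
proof -
  have split: "monomial \<beta> (u(x := t)) = t ^ \<beta> x * (\<Prod>i\<in>D - {x}. u i ^ \<beta> i)" for \<beta> u t
    unfolding monomial_def prod.remove[OF finite_D assms] by (auto intro!: prod.cong)
  have "(\<Prod>i\<in>D - {x}. u i ^ (\<beta>(x := n)) i) = (\<Prod>i\<in>D - {x}. u i ^ \<beta> i)" for u :: "'i \<Rightarrow> real" and n
    by (rule prod.cong) auto
  then show ?thesis
    unfolding has_pd_def split by (auto intro!: derivative_eq_intros)
qed

text \<open>Moving one derivative from the density to the monomial lowers both multi-indices at a
  point x and releases the factor \<beta>_x; iterating builds up the factorials. The total mass is
  an assumption here and is supplied once \<open>K\<close> is the covariance of a random
  vector.\<close>

lemma integral_monomial_density_deriv:
  assumes "(\<Sum>i\<in>D. \<beta> i) \<le> (\<Sum>i\<in>D. \<alpha> i)" and total: "(\<integral>u. \<phi> u \<partial>(\<Pi>\<^sub>M x\<in>D. lborel)) = 1"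
  shows "(\<integral>u. monomial \<beta> u * density_deriv \<alpha> u \<partial>(\<Pi>\<^sub>M x\<in>D. lborel))
    = (if \<forall>i\<in>D. \<alpha> i = \<beta> i then (\<Prod>i\<in>D. fact (\<alpha> i)) else 0)"
  using assms(1)
proof (induction "\<Sum>i\<in>D. \<alpha> i" arbitrary: \<alpha> \<beta>)
  case 0
  then have z: "\<alpha> i = 0" "\<beta> i = 0" if "i \<in> D" for i
    using that finite_D by auto
  then have "monomial \<beta> u = 1" for u
    by (auto simp: monomial_def intro!: prod.neutral)
  then show ?case using z total by (simp add: density_deriv_zero)
next
  case (Suc n)
  have "\<exists>x\<in>D. \<alpha> x \<noteq> 0"
  proof (rule ccontr)
    assume "\<not> (\<exists>x\<in>D. \<alpha> x \<noteq> 0)"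
    then have "(\<Sum>i\<in>D. \<alpha> i) = 0" by simp
    then show False using Suc.hyps(2) by simp
  qed
  then obtain x where x: "x \<in> D" "\<alpha> x \<noteq> 0"
    by blast
  define \<alpha>' where "\<alpha>' = \<alpha>(x := \<alpha> x - 1)"
  define \<beta>' where "\<beta>' = \<beta>(x := \<beta> x - 1)"
  have \<alpha>: "\<alpha> = \<alpha>'(x := Suc (\<alpha>' x))"
    using x(2) by (auto simp: \<alpha>'_def)
  have dec: "(\<Sum>i\<in>D. \<gamma> i) = Suc (\<Sum>i\<in>D. (\<gamma>(x := \<gamma> x - 1)) i)" if "\<gamma> x \<noteq> 0" for \<gamma> :: "'i \<Rightarrow> nat"
  proof -
    have "(\<Sum>i\<in>D. \<gamma> i) = (\<Sum>i\<in>D. (\<gamma>(x := \<gamma> x - 1)) i + (if i = x then 1 else 0))"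
      by (rule sum.cong) (use that in auto)
    then show ?thesis using x(1) finite_D by (simp add: sum.distrib)
  qed
  have "(\<integral>u. monomial \<beta> u * density_deriv \<alpha> u \<partial>(\<Pi>\<^sub>M x\<in>D. lborel))
      = (\<integral>u. (real (\<beta> x) * monomial \<beta>' u) * density_deriv \<alpha>' u \<partial>(\<Pi>\<^sub>M x\<in>D. lborel))"
    unfolding \<alpha> density_deriv_Suc[OF x(1)] \<beta>'_def
    by (rule integral_by_parts[OF x(1) monomial_polyf polyf_cmult[OF monomial_polyf] monomial_has_pd[OF x(1)] density_deriv_gaussf])
  also have "\<dots> = real (\<beta> x) * (\<integral>u. monomial \<beta>' u * density_deriv \<alpha>' u \<partial>(\<Pi>\<^sub>M x\<in>D. lborel))"
    by (simp add: mult.assoc)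
  also have "\<dots> = (if \<forall>i\<in>D. \<alpha> i = \<beta> i then (\<Prod>i\<in>D. fact (\<alpha> i)) else 0)"
  \<comment> \<open>If \<beta>_x is 0 the prefactor vanishes while \<alpha> and \<beta> differ at
    \<open>x\<close>. Otherwise both orders drop by one, which preserves the inequality demanded by
    the induction hypothesis.\<close>
  proof (cases "\<beta> x = 0")
    case True
    then show ?thesis using x by auto
  next
    case False
    have "(\<integral>u. monomial \<beta>' u * density_deriv \<alpha>' u \<partial>(\<Pi>\<^sub>M x\<in>D. lborel))
        = (if \<forall>i\<in>D. \<alpha>' i = \<beta>' i then (\<Prod>i\<in>D. fact (\<alpha>' i)) else 0)"
      using Suc.hyps(2) Suc.prems dec[of \<alpha>] dec[of \<beta>] x(2) False
      by (intro Suc.hyps(1)) (simp_all add: \<alpha>'_def \<beta>'_def)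
    moreover have "(\<forall>i\<in>D. \<alpha>' i = \<beta>' i) \<longleftrightarrow> (\<forall>i\<in>D. \<alpha> i = \<beta> i)"
    proof (rule ball_cong[OF refl])
      fix i
      show "\<alpha>' i = \<beta>' i \<longleftrightarrow> \<alpha> i = \<beta> i"
        unfolding \<alpha>'_def \<beta>'_def fun_upd_apply using x(2) False by (cases "i = x") (simp_all, arith)
    qed
    moreover have "real (\<beta> x) * (\<Prod>i\<in>D. fact (\<alpha>' i)) = (\<Prod>i\<in>D. fact (\<alpha> i))" if "\<forall>i\<in>D. \<alpha> i = \<beta> i"
    proof -
      have "(\<Prod>i\<in>D - {x}. fact (\<alpha>' i)) = (\<Prod>i\<in>D - {x}. fact (\<alpha> i) :: real)"
        by (rule prod.cong) (auto simp: \<alpha>'_def)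
      moreover have "fact (\<alpha> x) = real (\<alpha> x) * fact (\<alpha>' x)"
        using x(2) by (simp add: \<alpha>'_def fact_reduce)
      ultimately show ?thesis
        using that x(1) by (simp add: prod.remove[OF finite_D x(1)])
    qed
    ultimately show ?thesis by simp
  qed
  finally show ?case .
qed

end

section \<open>Projections in the space of square-integrable functions\<close>

lemma L2_D:
  assumes "X \<in> L2 M"
  shows "X \<in> borel_measurable M" "integrable M (\<lambda>\<omega>. (X \<omega>)\<^sup>2)"
  using assms by (auto simp: L2_def)

lemma L2_integrable_mult:
  assumes "X \<in> L2 M" "Y \<in> L2 M"
  shows "integrable M (\<lambda>\<omega>. X \<omega> * Y \<omega>)"
proof (rule Bochner_Integration.integrable_bound)
  show "integrable M (\<lambda>\<omega>. (X \<omega>)\<^sup>2 + (Y \<omega>)\<^sup>2)"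
    using assms L2_D by (intro Bochner_Integration.integrable_add) auto
  show "(\<lambda>\<omega>. X \<omega> * Y \<omega>) \<in> borel_measurable M"
    using assms L2_D by (intro borel_measurable_times) auto
  have "\<bar>a * b\<bar> \<le> \<bar>a\<^sup>2 + b\<^sup>2\<bar>" for a b :: real
  proof -
    have "0 \<le> (\<bar>a\<bar> - \<bar>b\<bar>)\<^sup>2" by simp
    then have "2 * (\<bar>a\<bar> * \<bar>b\<bar>) \<le> a\<^sup>2 + b\<^sup>2" by (simp add: power2_diff)
    moreover have "0 \<le> \<bar>a\<bar> * \<bar>b\<bar>" by simp
    ultimately show ?thesis unfolding abs_mult by linarith
  qed
  then show "AE \<omega> in M. norm (X \<omega> * Y \<omega>) \<le> norm ((X \<omega>)\<^sup>2 + (Y \<omega>)\<^sup>2)"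
    by simp
qed

lemma L2_cmult:
  assumes "X \<in> L2 M"
  shows "(\<lambda>\<omega>. c * X \<omega>) \<in> L2 M"
  using L2_D[OF assms] by (simp add: L2_def power_mult_distrib)

lemma L2_add:
  assumes "X \<in> L2 M" "Y \<in> L2 M"
  shows "(\<lambda>\<omega>. X \<omega> + Y \<omega>) \<in> L2 M"
proof -
  have "integrable M (\<lambda>\<omega>. (X \<omega>)\<^sup>2 + (Y \<omega>)\<^sup>2 + 2 * (X \<omega> * Y \<omega>))"
    using L2_D[OF assms(1)] L2_D[OF assms(2)] L2_integrable_mult[OF assms] by simp
  then show ?thesis
    using L2_D[OF assms(1)] L2_D[OF assms(2)] by (simp add: L2_def power2_sum mult.assoc)
qed

lemma L2_diff: "X \<in> L2 M \<Longrightarrow> Y \<in> L2 M \<Longrightarrow> (\<lambda>\<omega>. X \<omega> - Y \<omega>) \<in> L2 M"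
  using L2_add[OF _ L2_cmult[of Y M "-1"], of X] by simp

lemma L2_zero: "(\<lambda>_. 0) \<in> L2 M"
  by (simp add: L2_def)

lemma L2_sum:
  assumes "finite A" "\<And>a. a \<in> A \<Longrightarrow> X a \<in> L2 M"
  shows "(\<lambda>\<omega>. \<Sum>a\<in>A. X a \<omega>) \<in> L2 M"
  using assms by (induction A rule: finite_induct) (simp_all add: L2_zero L2_add)

definition L2_ip :: "'w measure \<Rightarrow> ('w \<Rightarrow> real) \<Rightarrow> ('w \<Rightarrow> real) \<Rightarrow> real" where
  "L2_ip M X Y = (\<integral>\<omega>. X \<omega> * Y \<omega> \<partial>M)"

lemma L2_ip_commute: "L2_ip M X Y = L2_ip M Y X"
  by (simp add: L2_ip_def mult.commute)

lemma L2_ip_add_left: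
  "X \<in> L2 M \<Longrightarrow> Y \<in> L2 M \<Longrightarrow> Z \<in> L2 M \<Longrightarrow> L2_ip M (\<lambda>\<omega>. X \<omega> + Y \<omega>) Z = L2_ip M X Z + L2_ip M Y Z"
  by (simp add: L2_ip_def distrib_right L2_integrable_mult)

lemma L2_ip_diff_left:
  "X \<in> L2 M \<Longrightarrow> Y \<in> L2 M \<Longrightarrow> Z \<in> L2 M \<Longrightarrow> L2_ip M (\<lambda>\<omega>. X \<omega> - Y \<omega>) Z = L2_ip M X Z - L2_ip M Y Z"
  by (simp add: L2_ip_def left_diff_distrib L2_integrable_mult)

lemma L2_ip_cmult_left: "L2_ip M (\<lambda>\<omega>. c * X \<omega>) Z = c * L2_ip M X Z"
  by (simp add: L2_ip_def mult.assoc)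

lemma L2_ip_add_right:
  "X \<in> L2 M \<Longrightarrow> Y \<in> L2 M \<Longrightarrow> Z \<in> L2 M \<Longrightarrow> L2_ip M Z (\<lambda>\<omega>. X \<omega> + Y \<omega>) = L2_ip M Z X + L2_ip M Z Y"
  by (simp add: L2_ip_commute[of M Z] L2_ip_add_left)

lemma L2_ip_diff_right:
  "X \<in> L2 M \<Longrightarrow> Y \<in> L2 M \<Longrightarrow> Z \<in> L2 M \<Longrightarrow> L2_ip M Z (\<lambda>\<omega>. X \<omega> - Y \<omega>) = L2_ip M Z X - L2_ip M Z Y"
  by (simp add: L2_ip_commute[of M Z] L2_ip_diff_left)

lemma L2_ip_cmult_right: "L2_ip M Z (\<lambda>\<omega>. c * X \<omega>) = c * L2_ip M Z X"
  by (simp add: L2_ip_commute[of M Z] L2_ip_cmult_left)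

lemma L2_ip_sum_right:
  assumes "finite A" "\<And>a. a \<in> A \<Longrightarrow> X a \<in> L2 M" "Z \<in> L2 M"
  shows "L2_ip M Z (\<lambda>\<omega>. \<Sum>a\<in>A. X a \<omega>) = (\<Sum>a\<in>A. L2_ip M Z (X a))"
  using assms(1,2)
proof (induction A rule: finite_induct)
  case empty
  then show ?case by (simp add: L2_ip_def)
next
  case (insert a A)
  then show ?case using assms(3) by (simp add: L2_ip_add_right L2_sum)
qed

lemma L2_ip_self_nonneg: "0 \<le> L2_ip M X X"
  by (simp add: L2_ip_def)

lemma L2_ip_self_zero:
  assumes "X \<in> L2 M" "L2_ip M X X = 0"
  shows "AE \<omega> in M. X \<omega> = 0"
proof -
  have "(\<integral>\<omega>. (X \<omega>)\<^sup>2 \<partial>M) = 0"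
    using assms(2) by (simp add: L2_ip_def power2_eq_square)
  then have "AE \<omega> in M. (X \<omega>)\<^sup>2 = 0"
    using integral_nonneg_eq_0_iff_AE[OF L2_D(2)[OF assms(1)]] by simp
  then show ?thesis by simp
qed

lemma L2_ip_cong_AE:
  assumes "X \<in> L2 M" "X' \<in> L2 M" "Z \<in> L2 M" "AE \<omega> in M. X \<omega> = X' \<omega>"
  shows "L2_ip M X Z = L2_ip M X' Z"
  unfolding L2_ip_def
proof (rule integral_cong_AE)
  show "AE \<omega> in M. X \<omega> * Z \<omega> = X' \<omega> * Z \<omega>"
    using assms(4) by eventually_elim simp
qed (use assms L2_D(1) in \<open>auto intro!: borel_measurable_times\<close>)

lemma L2_Cauchy_Schwarz:
  assumes "X \<in> L2 M" "Y \<in> L2 M"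
  shows "(L2_ip M X Y)\<^sup>2 \<le> L2_ip M X X * L2_ip M Y Y"
proof -
  let ?a = "L2_ip M X X" and ?b = "L2_ip M X Y" and ?c = "L2_ip M Y Y"
  have q: "0 \<le> ?a * s\<^sup>2 + 2 * ?b * (s * t) + ?c * t\<^sup>2" for s t
  proof -
    have "0 \<le> L2_ip M (\<lambda>\<omega>. s * X \<omega> + t * Y \<omega>) (\<lambda>\<omega>. s * X \<omega> + t * Y \<omega>)"
      by (rule L2_ip_self_nonneg)
    also have "\<dots> = ?a * s\<^sup>2 + 2 * ?b * (s * t) + ?c * t\<^sup>2"
      using assms
      by (simp add: L2_ip_add_left L2_ip_add_right L2_ip_cmult_left L2_ip_cmult_right L2_cmult L2_add
          L2_ip_commute[of M Y X] power2_eq_square algebra_simps)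
    finally show ?thesis .
  qed
  show ?thesis
  proof (cases "?c = 0")
    case True
    have "?b = 0"
    proof (rule ccontr)
      assume "?b \<noteq> 0"
      \<comment> \<open>With ?c equal to 0 the expression is affine in the second argument, whose
        value is chosen to make it -1.\<close>
      then have "?a * 1\<^sup>2 + 2 * ?b * (1 * (- (?a + 1) / (2 * ?b))) + ?c * (- (?a + 1) / (2 * ?b))\<^sup>2 = - 1"
        using True by (simp add: field_simps)
      then show False using q[of 1 "- (?a + 1) / (2 * ?b)"] by simp
    qed
    then show ?thesis using True by simp
  next
    case False
    then have c: "0 < ?c" using L2_ip_self_nonneg[of M Y] by simp
    \<comment> \<open>The arguments s = ?c and t = - ?b turn the quadratic into ?c times the
      difference to be shown nonnegative.\<close>
    have "0 \<le> ?a * ?c\<^sup>2 + 2 * ?b * (?c * - ?b) + ?c * (- ?b)\<^sup>2" by (rule q)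
    also have "\<dots> = ?c * (?a * ?c - ?b\<^sup>2)"
      by (simp add: power2_eq_square algebra_simps)
    finally show ?thesis using c by (simp add: zero_le_mult_iff)
  qed
qed

lemma tendsto_L2_ip:
  assumes "tendsto_L2 M Z Y" "W \<in> L2 M"
  shows "(\<lambda>n. L2_ip M W (Z n)) \<longlonglongrightarrow> L2_ip M W Y"
proof -
  have ZY: "\<And>n. Z n \<in> L2 M" "Y \<in> L2 M"
    and lim: "(\<lambda>n. \<integral>\<omega>. (Z n \<omega> - Y \<omega>)\<^sup>2 \<partial>M) \<longlonglongrightarrow> 0"
    using assms(1) by (auto simp: tendsto_L2_def)
  let ?d = "\<lambda>n \<omega>. Z n \<omega> - Y \<omega>"
  have "(\<lambda>n. L2_ip M W W * L2_ip M (?d n) (?d n)) \<longlonglongrightarrow> L2_ip M W W * 0"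
    by (rule tendsto_mult_left) (use lim in \<open>simp add: L2_ip_def power2_eq_square\<close>)
  then have "(\<lambda>n. (L2_ip M W (?d n))\<^sup>2) \<longlonglongrightarrow> 0"
    by (intro tendsto_sandwich[of "\<lambda>_. 0" "\<lambda>n. (L2_ip M W (?d n))\<^sup>2" sequentially
        "\<lambda>n. L2_ip M W W * L2_ip M (?d n) (?d n)" 0])
      (auto intro!: always_eventually L2_Cauchy_Schwarz assms(2) L2_diff ZY)
  then have "(\<lambda>n. L2_ip M W (?d n)) \<longlonglongrightarrow> 0"
    by (simp add: power_tendsto_0_iff)
  then have "(\<lambda>n. L2_ip M W (Z n) - L2_ip M W Y) \<longlonglongrightarrow> 0"
    by (simp add: L2_ip_diff_right ZY assms(2))
  then show ?thesis
    by (rule LIM_zero_cancel)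
qed

lemma L2_closure_subset_L2: "L2_closure M S \<subseteq> L2 M"
  by (auto simp: L2_closure_def tendsto_L2_def)

lemma subset_L2_closure:
  assumes "S \<subseteq> L2 M"
  shows "S \<subseteq> L2_closure M S"
proof
  fix Y assume "Y \<in> S"
  then have "tendsto_L2 M (\<lambda>_. Y) Y"
    using assms by (auto simp: tendsto_L2_def)
  then show "Y \<in> L2_closure M S"
    using \<open>Y \<in> S\<close> unfolding L2_closure_def by (intro CollectI exI[of _ "\<lambda>_. Y"]) simp
qed

lemma L2_closure_orthogonal:
  assumes "W \<in> L2 M" "\<And>Z. Z \<in> S \<Longrightarrow> L2_ip M W Z = 0" "Y \<in> L2_closure M S"
  shows "L2_ip M W Y = 0"
proof -
  obtain Z where "\<And>n. Z n \<in> S" "tendsto_L2 M Z Y"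
    using assms(3) unfolding L2_closure_def by blast
  then have "(\<lambda>n. 0) \<longlonglongrightarrow> L2_ip M W Y"
    using tendsto_L2_ip[OF _ assms(1)] assms(2) by fastforce
  then show ?thesis
    using LIMSEQ_unique tendsto_const by blast
qed

lemma L2_closure_cmult:
  assumes "\<And>c Y. Y \<in> S \<Longrightarrow> (\<lambda>\<omega>. c * Y \<omega>) \<in> S" "Y \<in> L2_closure M S"
  shows "(\<lambda>\<omega>. c * Y \<omega>) \<in> L2_closure M S"
proof -
  obtain Z where Z: "\<And>n. Z n \<in> S" "tendsto_L2 M Z Y"
    using assms(2) unfolding L2_closure_def by blast
  have "(c * Z n \<omega> - c * Y \<omega>)\<^sup>2 = c\<^sup>2 * (Z n \<omega> - Y \<omega>)\<^sup>2" for n \<omega>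
    by (simp add: power_mult_distrib[symmetric] right_diff_distrib)
  then have "tendsto_L2 M (\<lambda>n \<omega>. c * Z n \<omega>) (\<lambda>\<omega>. c * Y \<omega>)"
    using Z(2) tendsto_mult_left[of "\<lambda>n. \<integral>\<omega>. (Z n \<omega> - Y \<omega>)\<^sup>2 \<partial>M" 0 sequentially "c\<^sup>2"]
    by (auto simp: tendsto_L2_def L2_cmult)
  then show ?thesis
    unfolding L2_closure_def
    by (intro CollectI exI[of _ "\<lambda>n \<omega>. c * Z n \<omega>"] conjI allI assms(1) Z(1))
qed

lemma L2_closure_add:
  assumes "\<And>Y Y'. Y \<in> S \<Longrightarrow> Y' \<in> S \<Longrightarrow> (\<lambda>\<omega>. Y \<omega> + Y' \<omega>) \<in> S"
    "Y \<in> L2_closure M S" "Y' \<in> L2_closure M S"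
  shows "(\<lambda>\<omega>. Y \<omega> + Y' \<omega>) \<in> L2_closure M S"
proof -
  obtain Z where Z: "\<And>n. Z n \<in> S" "tendsto_L2 M Z Y"
    using assms(2) unfolding L2_closure_def by blast
  obtain Z' where Z': "\<And>n. Z' n \<in> S" "tendsto_L2 M Z' Y'"
    using assms(3) unfolding L2_closure_def by blast
  have m: "\<And>n. Z n \<in> L2 M" "\<And>n. Z' n \<in> L2 M" "Y \<in> L2 M" "Y' \<in> L2 M"
    using Z(2) Z'(2) by (auto simp: tendsto_L2_def)
  have i: "integrable M (\<lambda>\<omega>. (Z n \<omega> - Y \<omega>)\<^sup>2)" "integrable M (\<lambda>\<omega>. (Z' n \<omega> - Y' \<omega>)\<^sup>2)"
    "integrable M (\<lambda>\<omega>. (Z n \<omega> + Z' n \<omega> - (Y \<omega> + Y' \<omega>))\<^sup>2)" for n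
    using L2_D(2)[OF L2_diff[OF m(1,3)]] L2_D(2)[OF L2_diff[OF m(2,4)]]
      L2_D(2)[OF L2_diff[OF L2_add[OF m(1,2)] L2_add[OF m(3,4)]]] by auto
  have le: "(\<integral>\<omega>. (Z n \<omega> + Z' n \<omega> - (Y \<omega> + Y' \<omega>))\<^sup>2 \<partial>M)
      \<le> 2 * (\<integral>\<omega>. (Z n \<omega> - Y \<omega>)\<^sup>2 \<partial>M) + 2 * (\<integral>\<omega>. (Z' n \<omega> - Y' \<omega>)\<^sup>2 \<partial>M)" for n
  proof -
    have "(a + a' - (b + b'))\<^sup>2 \<le> 2 * (a - b)\<^sup>2 + 2 * (a' - b')\<^sup>2" for a a' b b' :: real
    proof -
      have "0 \<le> ((a - b) - (a' - b'))\<^sup>2" by simp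
      then show ?thesis by (simp add: power2_eq_square algebra_simps)
    qed
    then have "(\<integral>\<omega>. (Z n \<omega> + Z' n \<omega> - (Y \<omega> + Y' \<omega>))\<^sup>2 \<partial>M)
      \<le> (\<integral>\<omega>. 2 * (Z n \<omega> - Y \<omega>)\<^sup>2 + 2 * (Z' n \<omega> - Y' \<omega>)\<^sup>2 \<partial>M)"
      using i by (intro integral_mono) auto
    then show ?thesis using i by simp
  qed
  have "(\<lambda>n. 2 * (\<integral>\<omega>. (Z n \<omega> - Y \<omega>)\<^sup>2 \<partial>M) + 2 * (\<integral>\<omega>. (Z' n \<omega> - Y' \<omega>)\<^sup>2 \<partial>M)) \<longlonglongrightarrow> 2 * 0 + 2 * 0"
    using Z(2) Z'(2) by (intro tendsto_add tendsto_mult_left) (auto simp: tendsto_L2_def)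
  then have "(\<lambda>n. \<integral>\<omega>. (Z n \<omega> + Z' n \<omega> - (Y \<omega> + Y' \<omega>))\<^sup>2 \<partial>M) \<longlonglongrightarrow> 0"
    by (intro tendsto_sandwich[of "\<lambda>_. 0" "\<lambda>n. \<integral>\<omega>. (Z n \<omega> + Z' n \<omega> - (Y \<omega> + Y' \<omega>))\<^sup>2 \<partial>M" sequentially
        "\<lambda>n. 2 * (\<integral>\<omega>. (Z n \<omega> - Y \<omega>)\<^sup>2 \<partial>M) + 2 * (\<integral>\<omega>. (Z' n \<omega> - Y' \<omega>)\<^sup>2 \<partial>M)" 0])
      (auto intro!: always_eventually le)
  then have "tendsto_L2 M (\<lambda>n \<omega>. Z n \<omega> + Z' n \<omega>) (\<lambda>\<omega>. Y \<omega> + Y' \<omega>)"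
    using m by (simp add: tendsto_L2_def L2_add)
  then show ?thesis
    unfolding L2_closure_def
    by (intro CollectI exI[of _ "\<lambda>n \<omega>. Z n \<omega> + Z' n \<omega>"] conjI allI assms(1) Z(1) Z'(1))
qed

section \<open>Finite-dimensional spans and their projections\<close>

definition lin_span :: "'a set \<Rightarrow> ('a \<Rightarrow> 'w \<Rightarrow> real) \<Rightarrow> ('w \<Rightarrow> real) set" where
  "lin_span A e = {Y. \<exists>c. Y = (\<lambda>\<omega>. \<Sum>a\<in>A. c a * e a \<omega>)}"

lemma lin_span_add: "Y \<in> lin_span A e \<Longrightarrow> Y' \<in> lin_span A e \<Longrightarrow> (\<lambda>\<omega>. Y \<omega> + Y' \<omega>) \<in> lin_span A e"
proof -
  assume "Y \<in> lin_span A e" "Y' \<in> lin_span A e"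
  then obtain c c' where "Y = (\<lambda>\<omega>. \<Sum>a\<in>A. c a * e a \<omega>)" "Y' = (\<lambda>\<omega>. \<Sum>a\<in>A. c' a * e a \<omega>)"
    unfolding lin_span_def by blast
  then have "(\<lambda>\<omega>. Y \<omega> + Y' \<omega>) = (\<lambda>\<omega>. \<Sum>a\<in>A. (c a + c' a) * e a \<omega>)"
    by (simp add: distrib_right sum.distrib)
  then show ?thesis unfolding lin_span_def by (intro CollectI exI)
qed

lemma lin_span_cmult: "Y \<in> lin_span A e \<Longrightarrow> (\<lambda>\<omega>. t * Y \<omega>) \<in> lin_span A e"
proof -
  assume "Y \<in> lin_span A e"
  then obtain c where "Y = (\<lambda>\<omega>. \<Sum>a\<in>A. c a * e a \<omega>)"
    unfolding lin_span_def by blast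
  then have "(\<lambda>\<omega>. t * Y \<omega>) = (\<lambda>\<omega>. \<Sum>a\<in>A. (t * c a) * e a \<omega>)"
    by (simp add: sum_distrib_left mult.assoc)
  then show ?thesis unfolding lin_span_def by (intro CollectI exI)
qed

lemma lin_span_diff: "Y \<in> lin_span A e \<Longrightarrow> Y' \<in> lin_span A e \<Longrightarrow> (\<lambda>\<omega>. Y \<omega> - Y' \<omega>) \<in> lin_span A e"
  using lin_span_add[of Y A e "\<lambda>\<omega>. - 1 * Y' \<omega>"] lin_span_cmult[of Y' A e "-1"] by simp

lemma lin_span_base:
  assumes "finite A" "a \<in> A"
  shows "e a \<in> lin_span A e"
proof -
  have "e a = (\<lambda>\<omega>. \<Sum>b\<in>A. (if b = a then 1 else 0) * e b \<omega>)"
    using assms by (simp add: if_distrib[of "\<lambda>x. x * _"] cong: if_cong)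
  then show ?thesis unfolding lin_span_def by (intro CollectI exI)
qed

lemma lin_span_mono:
  assumes "finite B" "A \<subseteq> B"
  shows "lin_span A e \<subseteq> lin_span B e"
proof
  fix Y assume "Y \<in> lin_span A e"
  then obtain c where c: "Y = (\<lambda>\<omega>. \<Sum>a\<in>A. c a * e a \<omega>)"
    unfolding lin_span_def by blast
  have "Y = (\<lambda>\<omega>. \<Sum>a\<in>B. (if a \<in> A then c a else 0) * e a \<omega>)"
    unfolding c by (intro ext sum.mono_neutral_cong_left assms) auto
  then show "Y \<in> lin_span B e" unfolding lin_span_def by (intro CollectI exI)
qed

lemma lin_span_L2:
  assumes "finite A" "\<And>a. a \<in> A \<Longrightarrow> e a \<in> L2 M"
  shows "lin_span A e \<subseteq> L2 M"
  unfolding lin_span_def using assms by (auto intro!: L2_sum L2_cmult)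

lemma lin_span_orthogonal:
  assumes "finite A" "\<And>a. a \<in> A \<Longrightarrow> e a \<in> L2 M" "W \<in> L2 M"
    and "\<And>a. a \<in> A \<Longrightarrow> L2_ip M W (e a) = 0" "Y \<in> lin_span A e"
  shows "L2_ip M W Y = 0"
proof -
  obtain c where c: "Y = (\<lambda>\<omega>. \<Sum>a\<in>A. c a * e a \<omega>)"
    using assms(5) unfolding lin_span_def by blast
  have "L2_ip M W Y = (\<Sum>a\<in>A. L2_ip M W (\<lambda>\<omega>. c a * e a \<omega>))"
    unfolding c using assms by (intro L2_ip_sum_right L2_cmult)
  then show ?thesis using assms(4) by (simp add: L2_ip_cmult_right)
qed

text \<open>Gram-Schmidt by induction over the generators: the residual \<open>r\<close> of the new
  generator against the old span gives one more orthogonal direction, and the component of X along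
  it is added.\<close>

lemma lin_span_projection:
  assumes "finite A" "\<And>a. a \<in> A \<Longrightarrow> e a \<in> L2 M" "X \<in> L2 M"
  shows "\<exists>Y\<in>lin_span A e. \<forall>Z\<in>lin_span A e. L2_ip M (\<lambda>\<omega>. X \<omega> - Y \<omega>) Z = 0"
proof -
  have "\<exists>Y\<in>lin_span A e. \<forall>a\<in>A. L2_ip M (\<lambda>\<omega>. X \<omega> - Y \<omega>) (e a) = 0"
    using assms
  proof (induction A arbitrary: X rule: finite_induct)
    case empty
    show ?case by (intro bexI[of _ "\<lambda>_. 0"]) (auto simp: lin_span_def)
  next
    case (insert a A)
    have eA: "\<And>b. b \<in> A \<Longrightarrow> e b \<in> L2 M" and ea: "e a \<in> L2 M" and X: "X \<in> L2 M"
      using insert.prems by auto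
    have VL: "lin_span A e \<subseteq> L2 M" by (rule lin_span_L2[OF insert.hyps(1) eA])
    have sub: "lin_span A e \<subseteq> lin_span (insert a A) e"
      by (rule lin_span_mono) (use insert.hyps in auto)
    obtain P where P: "P \<in> lin_span A e" "\<And>b. b \<in> A \<Longrightarrow> L2_ip M (\<lambda>\<omega>. e a \<omega> - P \<omega>) (e b) = 0"
      using insert.IH[OF eA ea] by blast
    obtain Y0 where Y0: "Y0 \<in> lin_span A e" "\<And>b. b \<in> A \<Longrightarrow> L2_ip M (\<lambda>\<omega>. X \<omega> - Y0 \<omega>) (e b) = 0"
      using insert.IH[OF eA X] by blast
    define r where "r = (\<lambda>\<omega>. e a \<omega> - P \<omega>)"
    have L: "P \<in> L2 M" "Y0 \<in> L2 M" "r \<in> L2 M" "(\<lambda>\<omega>. X \<omega> - Y0 \<omega>) \<in> L2 M"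
      using P(1) Y0(1) VL ea X by (auto simp: r_def intro: L2_diff)
    have rb: "L2_ip M r (e b) = 0" if "b \<in> A" for b
      using P(2)[OF that] by (simp add: r_def)
    have rP: "L2_ip M r P = 0"
      by (rule lin_span_orthogonal[OF insert.hyps(1) eA L(3) rb P(1)])
    have YP: "L2_ip M (\<lambda>\<omega>. X \<omega> - Y0 \<omega>) P = 0"
      by (rule lin_span_orthogonal[OF insert.hyps(1) eA L(4) Y0(2) P(1)])
    have ea_eq: "e a = (\<lambda>\<omega>. r \<omega> + P \<omega>)" by (simp add: r_def)
    \<comment> \<open>The generators may be linearly dependent. If \<open>r\<close> has norm zero
      the quotient is 0 by convention, and Cauchy-Schwarz still gives orthogonality to
      \<open>r\<close>.\<close>
    define t where "t = L2_ip M (\<lambda>\<omega>. X \<omega> - Y0 \<omega>) r / L2_ip M r r"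
    define Y where "Y = (\<lambda>\<omega>. Y0 \<omega> + t * r \<omega>)"
    have XY: "(\<lambda>\<omega>. X \<omega> - Y \<omega>) = (\<lambda>\<omega>. (X \<omega> - Y0 \<omega>) - t * r \<omega>)"
      by (simp add: Y_def algebra_simps)
    have split: "L2_ip M (\<lambda>\<omega>. X \<omega> - Y \<omega>) Z = L2_ip M (\<lambda>\<omega>. X \<omega> - Y0 \<omega>) Z - t * L2_ip M r Z"
      if "Z \<in> L2 M" for Z
      unfolding XY by (simp add: L2_ip_diff_left[OF L(4) L2_cmult[OF L(3)] that] L2_ip_cmult_left)
    have "L2_ip M (\<lambda>\<omega>. X \<omega> - Y \<omega>) r = 0"
    proof (cases "L2_ip M r r = 0")
      case True
      have "(L2_ip M (\<lambda>\<omega>. X \<omega> - Y0 \<omega>) r)\<^sup>2 \<le> 0"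
        using L2_Cauchy_Schwarz[OF L(4,3)] True by simp
      then show ?thesis using True by (simp add: split[OF L(3)])
    qed (simp add: split[OF L(3)] t_def)
    moreover have "L2_ip M (\<lambda>\<omega>. X \<omega> - Y \<omega>) P = 0"
      by (simp add: split[OF L(1)] YP rP)
    ultimately have "L2_ip M (\<lambda>\<omega>. X \<omega> - Y \<omega>) (e a) = 0"
      unfolding ea_eq XY
      using L by (subst L2_ip_add_right) (auto intro: L2_diff L2_cmult)
    moreover have "L2_ip M (\<lambda>\<omega>. X \<omega> - Y \<omega>) (e b) = 0" if "b \<in> A" for b
      by (simp add: split[OF eA[OF that]] Y0(2)[OF that] rb[OF that])
    moreover have "r \<in> lin_span (insert a A) e"
      unfolding r_def using insert.hyps P(1) sub by (intro lin_span_diff lin_span_base) auto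
    then have "Y \<in> lin_span (insert a A) e"
      unfolding Y_def using Y0(1) sub by (intro lin_span_add lin_span_cmult) auto
    ultimately show ?case by blast
  qed
  then obtain Y where Y: "Y \<in> lin_span A e" "\<And>a. a \<in> A \<Longrightarrow> L2_ip M (\<lambda>\<omega>. X \<omega> - Y \<omega>) (e a) = 0"
    by blast
  have "(\<lambda>\<omega>. X \<omega> - Y \<omega>) \<in> L2 M"
    using lin_span_L2[of A e M, OF assms(1,2)] Y(1) assms(3) by (intro L2_diff) auto
  then show ?thesis
    using lin_span_orthogonal[of A e M, OF assms(1,2) _ Y(2)] Y(1) by blast
qed

text \<open>The residual of Z against the span is orthogonal to the span, hence by continuity to its
  closure and to Z itself. Being orthogonal to itself, it is null.\<close>

lemma L2_closure_lin_span:
  assumes "finite A" "\<And>a. a \<in> A \<Longrightarrow> e a \<in> L2 M" "Z \<in> L2_closure M (lin_span A e)"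
  shows "\<exists>Y\<in>lin_span A e. AE \<omega> in M. Z \<omega> = Y \<omega>"
proof -
  have Z: "Z \<in> L2 M" using assms(3) L2_closure_subset_L2 by blast
  obtain Y where Y: "Y \<in> lin_span A e" "\<And>W. W \<in> lin_span A e \<Longrightarrow> L2_ip M (\<lambda>\<omega>. Z \<omega> - Y \<omega>) W = 0"
    using lin_span_projection[of A e M, OF assms(1,2) Z] by blast
  have YL: "Y \<in> L2 M" using Y(1) lin_span_L2[of A e M, OF assms(1,2)] by blast
  have D: "(\<lambda>\<omega>. Z \<omega> - Y \<omega>) \<in> L2 M" by (rule L2_diff[OF Z YL])
  have "L2_ip M (\<lambda>\<omega>. Z \<omega> - Y \<omega>) Z = 0"
    by (rule L2_closure_orthogonal[OF D Y(2) assms(3)])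
  then have "L2_ip M (\<lambda>\<omega>. Z \<omega> - Y \<omega>) (\<lambda>\<omega>. Z \<omega> - Y \<omega>) = 0"
    using Y(2)[OF Y(1)] by (simp add: L2_ip_diff_right[OF Z YL D])
  from L2_ip_self_zero[OF D this] show ?thesis
    using Y(1) by (intro bexI[OF _ Y(1)]) (auto elim: eventually_mono)
qed

section \<open>The homogeneous chaos of a finite Gaussian vector\<close>

lemma lin_span_sum:
  assumes "finite B" "\<And>b. b \<in> B \<Longrightarrow> Y b \<in> lin_span A e"
  shows "(\<lambda>\<omega>. \<Sum>b\<in>B. Y b \<omega>) \<in> lin_span A e"
  using assms
proof (induction B rule: finite_induct)
  case empty
  show ?case by (auto simp: lin_span_def intro!: exI[of _ "\<lambda>_. 0"])
next
  case (insert b B)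
  then show ?case by (simp add: lin_span_add)
qed

text \<open>The multinomial coefficient, multiplied out to stay in the natural numbers: such lists
  are the arrangements of the multiset with multiplicities \<alpha>.\<close>

lemma card_lists_with_count:
  assumes "finite D" "\<And>x. x \<notin> D \<Longrightarrow> \<alpha> x = 0"
  shows "card {xs. count_list xs = \<alpha>} * (\<Prod>x\<in>D. fact (\<alpha> x)) = (fact (\<Sum>x\<in>D. \<alpha> x) :: nat)"
proof -
  define A where "A = Abs_multiset \<alpha>"
  have "finite {x. 0 < \<alpha> x}"
    by (rule finite_subset[OF _ assms(1)]) (use assms(2) in fastforce)
  then have A: "count A = \<alpha>"
    by (simp add: A_def count_Abs_multiset)
  have sub: "set_mset A \<subseteq> D"
    using A assms(2) by (metis count_eq_zero_iff subsetI)
  have "permutations_of_multiset A = {xs. count_list xs = \<alpha>}"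
    unfolding permutations_of_multiset_def multiset_eq_iff A count_mset by auto
  moreover have "(\<Prod>x\<in>set_mset A. fact (count A x)) = (\<Prod>x\<in>D. fact (\<alpha> x) :: nat)"
    using sub assms(1) A by (intro prod.mono_neutral_cong_left) (auto simp: not_in_iff)
  moreover have "size A = (\<Sum>x\<in>D. \<alpha> x)"
    unfolding size_multiset_overloaded_eq
    using sub assms(1) A by (intro sum.mono_neutral_cong_left) (auto simp: not_in_iff)
  ultimately show ?thesis
    using card_permutations_of_multiset_aux[of A] by metis
qed

context gaussian_kernel
begin

text \<open>Vanishing outside \<open>D\<close> makes the set finite and turns agreement on
  \<open>D\<close> into equality of functions.\<close>

definition multi_indices :: "nat \<Rightarrow> ('i \<Rightarrow> nat) set" where
  "multi_indices m = {\<beta>. (\<forall>x. x \<notin> D \<longrightarrow> \<beta> x = 0) \<and> (\<Sum>x\<in>D. \<beta> x) \<le> m}"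

lemma finite_multi_indices: "finite (multi_indices m)"
proof (rule finite_subset)
  show "multi_indices m \<subseteq> {\<beta>. \<forall>x. (x \<in> D \<longrightarrow> \<beta> x \<in> {..m}) \<and> (x \<notin> D \<longrightarrow> \<beta> x = 0)}"
  proof
    fix \<beta> assume \<beta>: "\<beta> \<in> multi_indices m"
    have "\<beta> x \<le> m" if "x \<in> D" for x
      using member_le_sum[OF that _ finite_D, of \<beta>] \<beta> by (simp add: multi_indices_def)
    then show "\<beta> \<in> {\<beta>. \<forall>x. (x \<in> D \<longrightarrow> \<beta> x \<in> {..m}) \<and> (x \<notin> D \<longrightarrow> \<beta> x = 0)}"
      using \<beta> by (simp add: multi_indices_def)
  qed
  show "finite {\<beta>. \<forall>x. (x \<in> D \<longrightarrow> \<beta> x \<in> {..m}) \<and> (x \<notin> D \<longrightarrow> \<beta> x = (0::nat))}"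
    by (rule finite_set_of_finite_funs[OF finite_D]) simp
qed

lemma multi_indices_mono: "m \<le> n \<Longrightarrow> multi_indices m \<subseteq> multi_indices n"
  by (auto simp: multi_indices_def)

lemma monomial_Suc:
  assumes "i \<in> D"
  shows "monomial (\<beta>(i := Suc (\<beta> i))) u = u i * monomial \<beta> u"
proof -
  have "(\<Prod>x\<in>D. u x ^ (\<beta>(i := Suc (\<beta> i))) x) = (\<Prod>x\<in>D. u x ^ \<beta> x * (if x = i then u i else 1))"
    by (rule prod.cong) auto
  then show ?thesis
    unfolding monomial_def using finite_D assms by (simp add: prod.distrib mult.commute)
qed

text \<open>Passes from the inductive description to finitely many coefficients, so that the results
  on spans apply.\<close>

lemma polyf_lin_span: "polyf D m p \<Longrightarrow> p \<in> lin_span (multi_indices m) monomial"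
proof (induction rule: polyf.induct)
  case (polyf_const m c)
  have "monomial (\<lambda>_. 0) = (\<lambda>_. 1)"
    by (simp add: monomial_def[abs_def])
  then show ?case
    using lin_span_cmult[OF lin_span_base[OF finite_multi_indices, of "\<lambda>_. 0" m monomial], of c]
    by (simp add: multi_indices_def)
next
  case (polyf_coord_mult i m p)
  then obtain c where c: "p = (\<lambda>u. \<Sum>\<beta>\<in>multi_indices m. c \<beta> * monomial \<beta> u)"
    unfolding lin_span_def by blast
  have "(\<lambda>u. u i * p u) = (\<lambda>u. \<Sum>\<beta>\<in>multi_indices m. c \<beta> * monomial (\<beta>(i := Suc (\<beta> i))) u)"
    unfolding c monomial_Suc[OF polyf_coord_mult.hyps(1)] sum_distrib_left by (simp add: mult_ac)
  moreover have "\<beta>(i := Suc (\<beta> i)) \<in> multi_indices (Suc m)" if "\<beta> \<in> multi_indices m" for \<beta>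
    using that polyf_coord_mult.hyps(1) sum_fun_upd_Suc[OF polyf_coord_mult.hyps(1), of \<beta>]
    unfolding multi_indices_def by auto
  ultimately show ?case
    by (simp only:) (intro lin_span_sum lin_span_cmult lin_span_base finite_multi_indices)
next
  case (polyf_add m p q)
  then show ?case by (simp add: lin_span_add)
qed

lemma lin_span_polyf:
  assumes "p \<in> lin_span (multi_indices m) monomial"
  shows "polyf D m p"
proof -
  obtain c where c: "p = (\<lambda>u. \<Sum>\<beta>\<in>multi_indices m. c \<beta> * monomial \<beta> u)"
    using assms unfolding lin_span_def by blast
  have "polyf D m (\<lambda>u. c \<beta> * monomial \<beta> u)" if "\<beta> \<in> multi_indices m" for \<beta>
    using that by (intro polyf_cmult polyf_mono[OF monomial_polyf]) (simp add: multi_indices_def)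
  then show ?thesis
    unfolding c by (intro polyf_sum finite_multi_indices)
qed

lemma hermite_polyf: "polyf D (\<Sum>i\<in>D. \<alpha> i) (hermite D K \<alpha>)"
proof -
  obtain p where p: "polyf D (\<Sum>i\<in>D. \<alpha> i) p" "density_deriv \<alpha> = (\<lambda>u. p u * \<phi> u)"
    using density_deriv_gaussf[of \<alpha>] unfolding gaussf_def by blast
  have "hermite D K \<alpha> = p"
    using density_nonzero[of D] by (simp add: fun_eq_iff hermite_density_deriv p(2))
  then show ?thesis using p(1) by simp
qed

lemma density_times_hermite: "\<phi> u * hermite D K \<alpha> u = density_deriv \<alpha> u"
  using density_nonzero[of D u] by (simp add: hermite_density_deriv)

lemma monomial_count_list:
  assumes "set xs \<subseteq> D"
  shows "monomial (count_list xs) u = (\<Prod>x\<leftarrow>xs. u x)"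
  using assms
proof (induction xs)
  case Nil
  show ?case by (simp add: monomial_def)
next
  case (Cons x xs)
  have "count_list (x # xs) = (count_list xs)(x := Suc (count_list xs x))"
    by (auto simp: fun_eq_iff)
  moreover have "monomial ((count_list xs)(x := Suc (count_list xs x))) u = u x * monomial (count_list xs) u"
    by (rule monomial_Suc) (use Cons.prems in simp)
  ultimately have "monomial (count_list (x # xs)) u = u x * monomial (count_list xs) u"
    by (simp only:)
  then show ?case
    using Cons by (simp del: count_list.simps)
qed

end

section \<open>Random variables that are functions of the Gaussian vector\<close>

locale gaussian_vector = prob_space M for M :: "'w measure" +
  fixes D :: "'i set" and f :: "'i \<Rightarrow> 'w \<Rightarrow> real"
  assumes finite_D: "finite D" and gaussian: "nondeg_centred_gaussian M D f"

sublocale gaussian_vector \<subseteq> gaussian_kernel D "cov M f"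
  by unfold_locales
    (use finite_D gaussian in \<open>auto simp: nondeg_centred_gaussian_def cov_def mult.commute\<close>)

context gaussian_vector
begin

abbreviation H :: "('w \<Rightarrow> real) set" where
  "H \<equiv> gauss_space D f"

abbreviation chaos :: "nat \<Rightarrow> ('w \<Rightarrow> real) set" where
  "chaos m \<equiv> homogeneous_chaos M H m"

definition at_f :: "(('i \<Rightarrow> real) \<Rightarrow> real) \<Rightarrow> 'w \<Rightarrow> real" where
  "at_f h \<omega> = h (\<lambda>x. f x \<omega>)"

text \<open>The law of the vector lives on functions that are \<open>undefined\<close> outside
  \<open>D\<close>, whereas \<open>at_f\<close> inserts the values of \<open>f\<close> at all
  indices. For functions that see only \<open>D\<close>, both give the same random variable.\<close>

definition local_on_D :: "(('i \<Rightarrow> real) \<Rightarrow> real) \<Rightarrow> bool" where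
  "local_on_D h \<longleftrightarrow> h \<in> borel_measurable (\<Pi>\<^sub>M x\<in>D. lborel) \<and> (\<forall>u v. (\<forall>x\<in>D. u x = v x) \<longrightarrow> h u = h v)"

lemma local_on_D_mult: "local_on_D h \<Longrightarrow> local_on_D k \<Longrightarrow> local_on_D (\<lambda>u. h u * k u)"
  unfolding local_on_D_def by (auto intro!: borel_measurable_times arg_cong2[where f = "(*)"])

lemma polyf_local: "polyf D m p \<Longrightarrow> local_on_D p"
  unfolding local_on_D_def using polyf_measurable polyf_cong by blast

lemma excursion_functional_local: "local_on_D (\<lambda>u. \<Xi> (excursion_set D \<nu> u))"
proof -
  have "excursion_set D \<nu> u = excursion_set D \<nu> v" if "\<forall>x\<in>D. u x = v x" for u v
    using that by (auto simp: excursion_set_def)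
  then show ?thesis
    unfolding local_on_D_def using excursion_functional_measurable[OF finite_D] by metis
qed

lemma distributed_f:
  "distributed M (\<Pi>\<^sub>M x\<in>D. lborel) (\<lambda>\<omega>. \<lambda>x\<in>D. f x \<omega>) (\<lambda>u. ennreal (\<phi> u))"
  using gaussian by (simp add: nondeg_centred_gaussian_def)

text \<open>Its sign is the same everywhere, namely that of the normalising root. A negative sign
  would make the law the zero measure, because \<open>ennreal\<close> truncates negative values to
  0, which contradicts total probability 1.\<close>

lemma density_nonneg: "0 \<le> \<phi> u"
proof (rule ccontr)
  assume neg: "\<not> 0 \<le> \<phi> u"
  define s where "s = sqrt ((2 * pi) ^ card D * det_on D (cov M f))"
  have "s < 0"
    using neg unfolding gauss_density_def s_def[symmetric] by (simp add: zero_le_divide_iff not_le)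
  then have "\<phi> v \<le> 0" for v
    unfolding gauss_density_def s_def[symmetric] by (simp add: divide_le_0_iff)
  then have zero: "ennreal (\<phi> v) = 0" for v
    by (simp add: ennreal_neg)
  have "emeasure M ((\<lambda>\<omega>. \<lambda>x\<in>D. f x \<omega>) -` space (\<Pi>\<^sub>M x\<in>D. lborel) \<inter> space M) = 0"
    using distributed_emeasure[OF distributed_f sets.top] by (simp add: zero)
  moreover have "(\<lambda>\<omega>. \<lambda>x\<in>D. f x \<omega>) -` space (\<Pi>\<^sub>M x\<in>D. lborel) \<inter> space M = space M"
    using measurable_space[OF distributed_measurable[OF distributed_f]] by auto
  ultimately show False
    using emeasure_space_1 by simp
qed

lemma at_f_restrict:
  assumes "local_on_D h"
  shows "at_f h = (\<lambda>\<omega>. h (\<lambda>x\<in>D. f x \<omega>))"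
proof
  fix \<omega>
  show "at_f h \<omega> = h (\<lambda>x\<in>D. f x \<omega>)"
    unfolding at_f_def using assms unfolding local_on_D_def by (metis restrict_apply')
qed

lemma at_f_measurable:
  assumes "local_on_D h"
  shows "at_f h \<in> borel_measurable M"
  unfolding at_f_restrict[OF assms]
  by (rule measurable_compose[OF distributed_measurable[OF distributed_f]])
    (use assms in \<open>simp add: local_on_D_def\<close>)

lemma integrable_at_f:
  assumes "local_on_D h"
  shows "integrable M (at_f h) \<longleftrightarrow> integrable (\<Pi>\<^sub>M x\<in>D. lborel) (\<lambda>u. \<phi> u * h u)"
  unfolding at_f_restrict[OF assms]
  using distributed_integrable[OF distributed_f, of h] assms density_nonneg
  by (simp add: local_on_D_def)

lemma integral_at_f:
  assumes "local_on_D h"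
  shows "(\<integral>\<omega>. at_f h \<omega> \<partial>M) = (\<integral>u. \<phi> u * h u \<partial>(\<Pi>\<^sub>M x\<in>D. lborel))"
  unfolding at_f_restrict[OF assms]
  using distributed_integral[OF distributed_f, of h] assms density_nonneg
  by (simp add: local_on_D_def)

lemma at_f_mult: "at_f h \<omega> * at_f k \<omega> = at_f (\<lambda>u. h u * k u) \<omega>"
  by (simp add: at_f_def)

lemma integral_density: "(\<integral>u. \<phi> u \<partial>(\<Pi>\<^sub>M x\<in>D. lborel)) = 1"
  using integral_at_f[OF polyf_local[OF polyf_const[of D 0 1]]] by (simp add: at_f_def prob_space)

lemma polyf_at_f_L2:
  assumes "polyf D m p"
  shows "at_f p \<in> L2 M"
proof -
  note pp = polyf_mult[OF assms assms]
  have "integrable (\<Pi>\<^sub>M x\<in>D. lborel) (\<lambda>u. \<phi> u * (p u * p u))"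
    using integrable_gaussf[OF polyf_mult_gaussf[OF pp density_gaussf[of 0]]] by (simp add: mult.commute)
  then have "integrable M (at_f (\<lambda>u. p u * p u))"
    unfolding integrable_at_f[OF polyf_local[OF pp]] .
  then show ?thesis
    unfolding L2_def using at_f_measurable[OF polyf_local[OF assms]]
    by (simp add: power2_eq_square at_f_mult)
qed

lemma L2_ip_at_f:
  assumes "local_on_D h" "local_on_D k"
  shows "L2_ip M (at_f h) (at_f k) = (\<integral>u. h u * (\<phi> u * k u) \<partial>(\<Pi>\<^sub>M x\<in>D. lborel))"
  unfolding L2_ip_def at_f_mult integral_at_f[OF local_on_D_mult[OF assms]] by (simp add: mult_ac)

abbreviation hermite_f :: "('i \<Rightarrow> nat) \<Rightarrow> 'w \<Rightarrow> real" where
  "hermite_f \<alpha> \<equiv> at_f (hermite D (cov M f) \<alpha>)"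

lemma L2_ip_hermite:
  assumes "local_on_D h"
  shows "L2_ip M (at_f h) (hermite_f \<alpha>) = (\<integral>u. h u * density_deriv \<alpha> u \<partial>(\<Pi>\<^sub>M x\<in>D. lborel))"
  unfolding L2_ip_at_f[OF assms polyf_local[OF hermite_polyf]] density_times_hermite ..

lemma L2_ip_monomial_hermite:
  assumes "(\<Sum>i\<in>D. \<beta> i) \<le> (\<Sum>i\<in>D. \<alpha> i)"
  shows "L2_ip M (at_f (monomial \<beta>)) (hermite_f \<alpha>)
    = (if \<forall>i\<in>D. \<alpha> i = \<beta> i then (\<Prod>i\<in>D. fact (\<alpha> i)) else 0)"
  unfolding L2_ip_hermite[OF polyf_local[OF monomial_polyf]]
  by (rule integral_monomial_density_deriv[OF assms integral_density])

lemma hermite_f_L2: "hermite_f \<alpha> \<in> L2 M"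
  by (rule polyf_at_f_L2[OF hermite_polyf])

lemma monomial_L2: "at_f (monomial \<beta>) \<in> L2 M"
  by (rule polyf_at_f_L2[OF monomial_polyf])

section \<open>Polynomials of bounded degree in the Gaussian vector\<close>

abbreviation poly_space :: "nat \<Rightarrow> ('w \<Rightarrow> real) set" where
  "poly_space m \<equiv> lin_span (multi_indices m) (\<lambda>\<beta>. at_f (monomial \<beta>))"

lemma at_f_poly_space_iff: "Y \<in> poly_space m \<longleftrightarrow> (\<exists>p. polyf D m p \<and> Y = at_f p)"
proof
  assume "Y \<in> poly_space m"
  then obtain c where c: "Y = (\<lambda>\<omega>. \<Sum>\<beta>\<in>multi_indices m. c \<beta> * at_f (monomial \<beta>) \<omega>)"
    unfolding lin_span_def by blast
  have "polyf D m (\<lambda>u. \<Sum>\<beta>\<in>multi_indices m. c \<beta> * monomial \<beta> u)"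
    by (rule lin_span_polyf) (auto simp: lin_span_def)
  moreover have "Y = at_f (\<lambda>u. \<Sum>\<beta>\<in>multi_indices m. c \<beta> * monomial \<beta> u)"
    by (simp add: c at_f_def[abs_def])
  ultimately show "\<exists>p. polyf D m p \<and> Y = at_f p" by blast
next
  assume "\<exists>p. polyf D m p \<and> Y = at_f p"
  then obtain p where p: "polyf D m p" "Y = at_f p" by blast
  then obtain c where "p = (\<lambda>u. \<Sum>\<beta>\<in>multi_indices m. c \<beta> * monomial \<beta> u)"
    using polyf_lin_span unfolding lin_span_def by blast
  then have "Y = (\<lambda>\<omega>. \<Sum>\<beta>\<in>multi_indices m. c \<beta> * at_f (monomial \<beta>) \<omega>)"
    by (simp add: p(2) at_f_def[abs_def])
  then show "Y \<in> poly_space m" unfolding lin_span_def by blast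
qed

lemma gauss_space_polyf:
  assumes "X \<in> H"
  shows "\<exists>p. polyf D 1 p \<and> X = at_f p"
proof -
  obtain c where c: "X = (\<lambda>\<omega>. \<Sum>x\<in>D. c x * f x \<omega>)"
    using assms unfolding gauss_space_def by blast
  have "polyf D 1 (\<lambda>u. \<Sum>x\<in>D. c x * u x)"
    by (rule polyf_sum[OF finite_D], rule polyf_cmult) (use polyf_coord[of _ D 0] in simp)
  then show ?thesis using c by (auto simp: at_f_def[abs_def])
qed

lemma polys_subset_poly_space: "polys H m \<subseteq> poly_space m"
proof
  fix Y assume "Y \<in> polys H m"
  then obtain k :: nat and X A c where
    X: "\<And>i. i < k \<Longrightarrow> X i \<in> H" and A: "finite A" "\<And>\<alpha>. \<alpha> \<in> A \<Longrightarrow> (\<Sum>i<k. \<alpha> i) \<le> m"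
    and Y: "Y = (\<lambda>\<omega>. \<Sum>\<alpha>\<in>A. c \<alpha> * (\<Prod>i<k. X i \<omega> ^ \<alpha> i))"
    unfolding polys_def by blast
  have "\<forall>i. \<exists>p. i < k \<longrightarrow> polyf D 1 p \<and> X i = at_f p"
    using gauss_space_polyf X by blast
  then obtain p where p: "\<And>i. i < k \<Longrightarrow> polyf D 1 (p i)" "\<And>i. i < k \<Longrightarrow> X i = at_f (p i)"
    by metis
  have pow: "polyf D n (\<lambda>u. p i u ^ n)" if "i < k" for i n
  proof (induction n)
    case 0
    show ?case using polyf_const[of D 0 1] by simp
  next
    case (Suc n)
    show ?case using polyf_mult[OF p(1)[OF that] Suc] by simp
  qed
  have prod: "polyf D (\<Sum>i<j. \<alpha> i) (\<lambda>u. \<Prod>i<j. p i u ^ \<alpha> i)" if "j \<le> k" for \<alpha> j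
    using that
  proof (induction j)
    case 0
    show ?case using polyf_const[of D 0 1] by simp
  next
    case (Suc j)
    then show ?case using polyf_mult[OF _ pow[of j "\<alpha> j"]] by simp
  qed
  have "polyf D m (\<lambda>u. \<Sum>\<alpha>\<in>A. c \<alpha> * (\<Prod>i<k. p i u ^ \<alpha> i))"
    by (rule polyf_sum[OF A(1)], rule polyf_cmult, rule polyf_mono[OF prod A(2)]) simp_all
  moreover have "Y = at_f (\<lambda>u. \<Sum>\<alpha>\<in>A. c \<alpha> * (\<Prod>i<k. p i u ^ \<alpha> i))"
    unfolding Y using p(2) by (auto simp: at_f_def fun_eq_iff intro!: sum.cong prod.cong)
  ultimately show "Y \<in> poly_space m" unfolding at_f_poly_space_iff by blast
qed

text \<open>In \<open>polys\<close> the variables are numbered, so multi-indices on \<open>D\<close>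
  are transported along an enumeration of \<open>D\<close>. The transport is injective since the
  multi-indices vanish outside \<open>D\<close>, which allows the coefficients to be read back
  through its inverse.\<close>

lemma poly_space_subset_polys: "poly_space m \<subseteq> polys H m"
proof
  fix Y assume "Y \<in> poly_space m"
  then obtain c where Y: "Y = (\<lambda>\<omega>. \<Sum>\<beta>\<in>multi_indices m. c \<beta> * at_f (monomial \<beta>) \<omega>)"
    unfolding lin_span_def by blast
  obtain b where b: "bij_betw b {..<card D} D"
    using ex_bij_betw_nat_finite[OF finite_D] by (auto simp: atLeast0LessThan)
  define k where "k = card D"
  define t where "t \<beta> = (\<lambda>i. if i < k then \<beta> (b i) else 0)" for \<beta> :: "'i \<Rightarrow> nat"
  define X where "X i = f (b i)" for i
  have inj: "inj_on t (multi_indices m)"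
  proof (rule inj_onI)
    fix \<beta> \<gamma> assume *: "\<beta> \<in> multi_indices m" "\<gamma> \<in> multi_indices m" "t \<beta> = t \<gamma>"
    have "\<beta> x = \<gamma> x" for x
    proof (cases "x \<in> D")
      case True
      then obtain i where "i < k" "x = b i"
        using b unfolding k_def bij_betw_def by auto
      then show ?thesis using fun_cong[OF *(3), of i] by (simp add: t_def)
    qed (use * in \<open>simp add: multi_indices_def\<close>)
    then show "\<beta> = \<gamma>" by auto
  qed
  have sum_t: "(\<Sum>i<k. t \<beta> i) = (\<Sum>x\<in>D. \<beta> x)" for \<beta>
  proof -
    have "(\<Sum>i<k. t \<beta> i) = (\<Sum>i<k. \<beta> (b i))"
      by (rule sum.cong) (auto simp: t_def)
    then show ?thesis using sum.reindex_bij_betw[OF b, of \<beta>] by (simp add: k_def)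
  qed
  have prod_t: "(\<Prod>i<k. X i \<omega> ^ t \<beta> i) = at_f (monomial \<beta>) \<omega>" for \<beta> \<omega>
  proof -
    have "(\<Prod>i<k. X i \<omega> ^ t \<beta> i) = (\<Prod>i<k. f (b i) \<omega> ^ \<beta> (b i))"
      by (rule prod.cong) (auto simp: t_def X_def)
    then show ?thesis
      using prod.reindex_bij_betw[OF b, of "\<lambda>x. f x \<omega> ^ \<beta> x"] by (simp add: k_def at_f_def monomial_def)
  qed
  have "f x \<in> H" if "x \<in> D" for x
  proof -
    have "f x = (\<lambda>\<omega>. \<Sum>y\<in>D. (if y = x then 1 else 0) * f y \<omega>)"
      using that finite_D by (simp add: if_distrib[of "\<lambda>x. x * _"] cong: if_cong)
    then show ?thesis unfolding gauss_space_def by (intro CollectI exI)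
  qed
  then have "\<forall>i<k. X i \<in> H"
    using b by (auto simp: X_def k_def bij_betw_def)
  moreover have "finite (t ` multi_indices m)" using finite_multi_indices by simp
  moreover have "\<forall>\<alpha>\<in>t ` multi_indices m. (\<Sum>i<k. \<alpha> i) \<le> m"
    by (auto simp: sum_t multi_indices_def)
  moreover have "Y = (\<lambda>\<omega>. \<Sum>\<alpha>\<in>t ` multi_indices m. c (inv_into (multi_indices m) t \<alpha>) * (\<Prod>i<k. X i \<omega> ^ \<alpha> i))"
    unfolding Y sum.reindex[OF inj] comp_def prod_t
    by (intro ext sum.cong refl) (simp add: inv_into_f_f[OF inj])
  ultimately show "Y \<in> polys H m"
    unfolding polys_def
    by (intro CollectI exI[of _ k] exI[of _ X] exI[of _ "t ` multi_indices m"]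
        exI[of _ "\<lambda>\<alpha>. c (inv_into (multi_indices m) t \<alpha>)"] conjI)
qed

lemma polys_eq_poly_space: "polys H m = poly_space m"
  using polys_subset_poly_space poly_space_subset_polys by blast

lemma poly_space_subset_L2: "poly_space m \<subseteq> L2 M"
  by (rule lin_span_L2[OF finite_multi_indices monomial_L2])

lemma poly_space_mono: "m \<le> n \<Longrightarrow> poly_space m \<subseteq> poly_space n"
  by (intro lin_span_mono finite_multi_indices multi_indices_mono)

lemma poly_space_projection:
  assumes "X \<in> L2 M"
  obtains P where "P \<in> poly_space m" "P \<in> L2 M" "\<And>Z. Z \<in> poly_space m \<Longrightarrow> L2_ip M (\<lambda>\<omega>. X \<omega> - P \<omega>) Z = 0"
  using lin_span_projection[of "multi_indices m" "\<lambda>\<beta>. at_f (monomial \<beta>)" M X, OF finite_multi_indices monomial_L2 assms]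
    poly_space_subset_L2 that by blast

section \<open>Chaos spaces and their projections\<close>

lemma chaos_iff: "Y \<in> chaos m \<longleftrightarrow> Y \<in> L2_closure M (poly_space m) \<and>
    (0 < m \<longrightarrow> (\<forall>Z\<in>L2_closure M (poly_space (m - 1)). L2_ip M Y Z = 0))"
  by (auto simp: homogeneous_chaos_def polys_eq_poly_space L2_ip_def)

lemma chaos_L2: "Y \<in> chaos m \<Longrightarrow> Y \<in> L2 M"
  unfolding chaos_iff using L2_closure_subset_L2 by blast

text \<open>Continuity of the inner product extends orthogonality from polynomials of lower degree
  to their closure.\<close>

lemma chaosI:
  assumes "Y \<in> L2_closure M (poly_space m)" "\<And>Z. 0 < m \<Longrightarrow> Z \<in> poly_space (m - 1) \<Longrightarrow> L2_ip M Y Z = 0"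
  shows "Y \<in> chaos m"
  unfolding chaos_iff
proof (intro conjI impI ballI)
  fix Z assume "0 < m" "Z \<in> L2_closure M (poly_space (m - 1))"
  moreover have "Y \<in> L2 M" using assms(1) L2_closure_subset_L2 by blast
  ultimately show "L2_ip M Y Z = 0"
    using L2_closure_orthogonal[of Y M "poly_space (m - 1)" Z] assms(2) by blast
qed (rule assms(1))

lemma chaos_orthogonal: "Y \<in> chaos m \<Longrightarrow> 0 < m \<Longrightarrow> Z \<in> poly_space (m - 1) \<Longrightarrow> L2_ip M Y Z = 0"
  unfolding chaos_iff using subset_L2_closure[OF poly_space_subset_L2] by blast

lemma chaos_add:
  assumes "Y \<in> chaos m" "Y' \<in> chaos m"
  shows "(\<lambda>\<omega>. Y \<omega> + Y' \<omega>) \<in> chaos m"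
proof (rule chaosI)
  show "(\<lambda>\<omega>. Y \<omega> + Y' \<omega>) \<in> L2_closure M (poly_space m)"
    using assms by (intro L2_closure_add lin_span_add) (simp_all add: chaos_iff)
  fix Z assume Z: "0 < m" "Z \<in> poly_space (m - 1)"
  then have "Z \<in> L2 M" using poly_space_subset_L2 by blast
  then show "L2_ip M (\<lambda>\<omega>. Y \<omega> + Y' \<omega>) Z = 0"
    using assms[THEN chaos_L2] assms[THEN chaos_orthogonal] Z by (simp add: L2_ip_add_left)
qed

lemma chaos_cmult:
  assumes "Y \<in> chaos m"
  shows "(\<lambda>\<omega>. c * Y \<omega>) \<in> chaos m"
proof (rule chaosI)
  show "(\<lambda>\<omega>. c * Y \<omega>) \<in> L2_closure M (poly_space m)"
    using assms by (intro L2_closure_cmult lin_span_cmult) (simp_all add: chaos_iff)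
  fix Z assume Z: "0 < m" "Z \<in> poly_space (m - 1)"
  then show "L2_ip M (\<lambda>\<omega>. c * Y \<omega>) Z = 0"
    using assms chaos_orthogonal by (simp add: L2_ip_cmult_left)
qed

lemma chaos_diff: "Y \<in> chaos m \<Longrightarrow> Y' \<in> chaos m \<Longrightarrow> (\<lambda>\<omega>. Y \<omega> - Y' \<omega>) \<in> chaos m"
  using chaos_add[OF _ chaos_cmult[of Y' m "-1"], of Y] by simp

lemma chaos_sum:
  assumes "finite A" "\<And>a. a \<in> A \<Longrightarrow> Y a \<in> chaos m" "0 < m"
  shows "(\<lambda>\<omega>. \<Sum>a\<in>A. Y a \<omega>) \<in> chaos m"
  using assms(1,2)
proof (induction A rule: finite_induct)
  case empty
  have "(\<lambda>_. 0) \<in> poly_space m"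
    by (auto simp: lin_span_def intro!: exI[of _ "\<lambda>_. 0"])
  then have "(\<lambda>_. 0) \<in> L2_closure M (poly_space m)"
    using subset_L2_closure[OF poly_space_subset_L2] by blast
  then show ?case
    by (intro chaosI) (auto simp: L2_ip_def)
next
  case (insert a A)
  then show ?case by (simp add: chaos_add)
qed

text \<open>The chaos is the orthogonal difference of consecutive polynomial spaces, so its
  projection is the difference of theirs. P - P' is a difference of two residuals orthogonal to
  lower degrees; in X - (P - P') = (X - P) + P', the first term is orthogonal to all degrees up to m
  and the second to the chaos.\<close>

lemma chaos_difference_of_projections:
  assumes X: "X \<in> L2 M" and m: "0 < m"
    and P: "P \<in> poly_space m" "\<And>Z. Z \<in> poly_space m \<Longrightarrow> L2_ip M (\<lambda>\<omega>. X \<omega> - P \<omega>) Z = 0"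
    and P': "P' \<in> poly_space (m - 1)" "\<And>Z. Z \<in> poly_space (m - 1) \<Longrightarrow> L2_ip M (\<lambda>\<omega>. X \<omega> - P' \<omega>) Z = 0"
  shows "(\<lambda>\<omega>. P \<omega> - P' \<omega>) \<in> chaos m"
    and "\<And>Z. Z \<in> chaos m \<Longrightarrow> L2_ip M (\<lambda>\<omega>. X \<omega> - (P \<omega> - P' \<omega>)) Z = 0"
proof -
  have sub: "poly_space (m - 1) \<subseteq> poly_space m" by (rule poly_space_mono) simp
  have L: "P \<in> L2 M" "P' \<in> L2 M" "(\<lambda>\<omega>. X \<omega> - P \<omega>) \<in> L2 M" "(\<lambda>\<omega>. X \<omega> - P' \<omega>) \<in> L2 M"
    using P(1) P'(1) poly_space_subset_L2 X by (auto intro: L2_diff)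
  show "(\<lambda>\<omega>. P \<omega> - P' \<omega>) \<in> chaos m"
  proof (rule chaosI)
    have "(\<lambda>\<omega>. P \<omega> - P' \<omega>) \<in> poly_space m"
      using P(1) P'(1) sub by (intro lin_span_diff) auto
    then show "(\<lambda>\<omega>. P \<omega> - P' \<omega>) \<in> L2_closure M (poly_space m)"
      using subset_L2_closure[OF poly_space_subset_L2] by blast
    fix Z assume Z: "Z \<in> poly_space (m - 1)"
    then have ZL: "Z \<in> L2 M" using poly_space_subset_L2 by blast
    have "(\<lambda>\<omega>. P \<omega> - P' \<omega>) = (\<lambda>\<omega>. (X \<omega> - P' \<omega>) - (X \<omega> - P \<omega>))" by simp
    then show "L2_ip M (\<lambda>\<omega>. P \<omega> - P' \<omega>) Z = 0"
      using L2_ip_diff_left[OF L(4,3) ZL] P(2)[of Z] P'(2)[OF Z] Z sub by auto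
  qed
  fix Z assume Z: "Z \<in> chaos m"
  then have ZL: "Z \<in> L2 M" by (rule chaos_L2)
  have "L2_ip M (\<lambda>\<omega>. X \<omega> - P \<omega>) Z = 0"
    by (rule L2_closure_orthogonal[OF L(3) P(2) Z[unfolded chaos_iff, THEN conjunct1]])
  moreover have "L2_ip M P' Z = 0"
    using chaos_orthogonal[OF Z m P'(1)] by (simp add: L2_ip_commute)
  moreover have "(\<lambda>\<omega>. X \<omega> - (P \<omega> - P' \<omega>)) = (\<lambda>\<omega>. (X \<omega> - P \<omega>) + P' \<omega>)" by auto
  ultimately show "L2_ip M (\<lambda>\<omega>. X \<omega> - (P \<omega> - P' \<omega>)) Z = 0"
    using L2_ip_add_left[OF L(3,2) ZL] by simp
qed

text \<open>The Hilbert choice in \<open>orth_proj\<close> has these properties only because a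
  witness exists, here the difference of two polynomial projections.\<close>

lemma chaos_proj_properties:
  assumes "X \<in> L2 M" "0 < m"
  shows "chaos_proj M H m X \<in> chaos m"
    and "\<And>Z. Z \<in> chaos m \<Longrightarrow> L2_ip M (\<lambda>\<omega>. X \<omega> - chaos_proj M H m X \<omega>) Z = 0"
proof -
  obtain P where P: "P \<in> poly_space m" "\<And>Z. Z \<in> poly_space m \<Longrightarrow> L2_ip M (\<lambda>\<omega>. X \<omega> - P \<omega>) Z = 0"
    using poly_space_projection[OF assms(1)] by blast
  obtain P' where P': "P' \<in> poly_space (m - 1)" "\<And>Z. Z \<in> poly_space (m - 1) \<Longrightarrow> L2_ip M (\<lambda>\<omega>. X \<omega> - P' \<omega>) Z = 0"
    using poly_space_projection[OF assms(1)] by blast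
  note * = chaos_difference_of_projections[OF assms P P']
  let ?Q = "\<lambda>Y. Y \<in> chaos m \<and> (\<forall>Z\<in>chaos m. (\<integral>\<omega>. (X \<omega> - Y \<omega>) * Z \<omega> \<partial>M) = 0)"
  have "?Q (\<lambda>\<omega>. P \<omega> - P' \<omega>)"
    using * unfolding L2_ip_def by blast
  then have "?Q (chaos_proj M H m X)"
    unfolding chaos_proj_def orth_proj_def by (rule someI[of ?Q])
  then show "chaos_proj M H m X \<in> chaos m"
    "\<And>Z. Z \<in> chaos m \<Longrightarrow> L2_ip M (\<lambda>\<omega>. X \<omega> - chaos_proj M H m X \<omega>) Z = 0"
    by (auto simp: L2_ip_def)
qed

lemma chaos_proj_unique:
  assumes "X \<in> L2 M" "0 < m" "Y \<in> chaos m" "\<And>Z. Z \<in> chaos m \<Longrightarrow> L2_ip M (\<lambda>\<omega>. X \<omega> - Y \<omega>) Z = 0"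
  shows "AE \<omega> in M. chaos_proj M H m X \<omega> = Y \<omega>"
proof -
  let ?Q = "chaos_proj M H m X"
  note Q = chaos_proj_properties[OF assms(1,2)]
  let ?d = "\<lambda>\<omega>. ?Q \<omega> - Y \<omega>"
  have d: "?d \<in> chaos m" by (rule chaos_diff[OF Q(1) assms(3)])
  have L: "?Q \<in> L2 M" "Y \<in> L2 M" "?d \<in> L2 M"
    using Q(1) assms(3) d chaos_L2 by auto
  have "?d = (\<lambda>\<omega>. (X \<omega> - Y \<omega>) - (X \<omega> - ?Q \<omega>))" by simp
  then have "L2_ip M ?d ?d = L2_ip M (\<lambda>\<omega>. X \<omega> - Y \<omega>) ?d - L2_ip M (\<lambda>\<omega>. X \<omega> - ?Q \<omega>) ?d"
    using L2_ip_diff_left[OF L2_diff[OF assms(1) L(2)] L2_diff[OF assms(1) L(1)] L(3)] by simp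
  also have "\<dots> = 0" using assms(4)[OF d] Q(2)[OF d] by simp
  finally show ?thesis
    using L2_ip_self_zero[OF L(3)] by simp
qed

lemma hermite_f_chaos:
  assumes "(\<Sum>i\<in>D. \<alpha> i) = m"
  shows "hermite_f \<alpha> \<in> chaos m"
proof (rule chaosI)
  have "hermite_f \<alpha> \<in> poly_space m"
    unfolding at_f_poly_space_iff using hermite_polyf[of \<alpha>] assms by blast
  then show "hermite_f \<alpha> \<in> L2_closure M (poly_space m)"
    using subset_L2_closure[OF poly_space_subset_L2] by blast
  fix Z assume m: "0 < m" and Z: "Z \<in> poly_space (m - 1)"
  show "L2_ip M (hermite_f \<alpha>) Z = 0"
  proof (rule lin_span_orthogonal[OF finite_multi_indices monomial_L2 hermite_f_L2 _ Z])
    fix \<beta> assume "\<beta> \<in> multi_indices (m - 1)"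
    then have less: "(\<Sum>i\<in>D. \<beta> i) < (\<Sum>i\<in>D. \<alpha> i)"
      using m assms by (auto simp: multi_indices_def)
    then have "\<not> (\<forall>i\<in>D. \<alpha> i = \<beta> i)"
      by (metis less_irrefl sum.cong)
    then show "L2_ip M (hermite_f \<alpha>) (at_f (monomial \<beta>)) = 0"
      unfolding L2_ip_commute[of M "hermite_f \<alpha>"] L2_ip_monomial_hermite[OF less_imp_le[OF less]]
      by (rule if_not_P)
  qed
qed

text \<open>Up to a null set W is a polynomial. Pairing it with a Hermite variable of order m
  isolates one leading coefficient, so all of them vanish and the degree drops below m; but W is
  orthogonal to such polynomials, hence to itself.\<close>

lemma chaos_zero_if_orthogonal_hermite:
  assumes W: "W \<in> chaos m" and m: "0 < m"
    and orth: "\<And>\<alpha>. \<alpha> \<in> multi_indices m \<Longrightarrow> (\<Sum>i\<in>D. \<alpha> i) = m \<Longrightarrow> L2_ip M W (hermite_f \<alpha>) = 0"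
  shows "AE \<omega> in M. W \<omega> = 0"
proof -
  have WL: "W \<in> L2 M" by (rule chaos_L2[OF W])
  have "W \<in> L2_closure M (poly_space m)" using W by (simp add: chaos_iff)
  then obtain Y where Y: "Y \<in> poly_space m" "AE \<omega> in M. W \<omega> = Y \<omega>"
    using L2_closure_lin_span[of "multi_indices m" "\<lambda>\<beta>. at_f (monomial \<beta>)" M W, OF finite_multi_indices monomial_L2] by blast
  obtain c where c: "Y = (\<lambda>\<omega>. \<Sum>\<beta>\<in>multi_indices m. c \<beta> * at_f (monomial \<beta>) \<omega>)"
    using Y(1) unfolding lin_span_def by blast
  have YL: "Y \<in> L2 M" using Y(1) poly_space_subset_L2 by blast
  have "c \<alpha> = 0" if \<alpha>: "\<alpha> \<in> multi_indices m" "(\<Sum>i\<in>D. \<alpha> i) = m" for \<alpha>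
  proof -
    have "0 = L2_ip M Y (hermite_f \<alpha>)"
      using orth[OF \<alpha>] L2_ip_cong_AE[OF WL YL hermite_f_L2 Y(2), of \<alpha>] by simp
    also have "\<dots> = (\<Sum>\<beta>\<in>multi_indices m. L2_ip M (hermite_f \<alpha>) (\<lambda>\<omega>. c \<beta> * at_f (monomial \<beta>) \<omega>))"
      unfolding c L2_ip_commute[of M _ "hermite_f \<alpha>"]
      by (rule L2_ip_sum_right[OF finite_multi_indices L2_cmult[OF monomial_L2] hermite_f_L2])
    also have "\<dots> = (\<Sum>\<beta>\<in>multi_indices m. if \<beta> = \<alpha> then c \<alpha> * (\<Prod>i\<in>D. fact (\<alpha> i)) else 0)"
    proof (rule sum.cong[OF refl])
      fix \<beta> assume \<beta>: "\<beta> \<in> multi_indices m"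
      then have le: "(\<Sum>i\<in>D. \<beta> i) \<le> (\<Sum>i\<in>D. \<alpha> i)"
        using \<alpha> by (simp add: multi_indices_def)
      have "(\<forall>i\<in>D. \<alpha> i = \<beta> i) \<longleftrightarrow> \<beta> = \<alpha>"
        using \<alpha>(1) \<beta> unfolding multi_indices_def fun_eq_iff by (metis (mono_tags, lifting) mem_Collect_eq)
      then show "L2_ip M (hermite_f \<alpha>) (\<lambda>\<omega>. c \<beta> * at_f (monomial \<beta>) \<omega>)
          = (if \<beta> = \<alpha> then c \<alpha> * (\<Prod>i\<in>D. fact (\<alpha> i)) else 0)"
        unfolding L2_ip_cmult_right L2_ip_commute[of M "hermite_f \<alpha>"] L2_ip_monomial_hermite[OF le] by simp
    qed
    also have "\<dots> = c \<alpha> * (\<Prod>i\<in>D. fact (\<alpha> i))"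
      using \<alpha>(1) finite_multi_indices by simp
    finally show ?thesis using finite_D by simp
  qed
  then have "c \<beta> = 0" if "\<beta> \<in> multi_indices m - multi_indices (m - 1)" for \<beta>
    using that m by (auto simp: multi_indices_def)
  then have "Y = (\<lambda>\<omega>. \<Sum>\<beta>\<in>multi_indices (m - 1). c \<beta> * at_f (monomial \<beta>) \<omega>)"
    unfolding c by (intro ext sum.mono_neutral_right finite_multi_indices multi_indices_mono) auto
  then have Y': "Y \<in> poly_space (m - 1)" unfolding lin_span_def by blast
  have "L2_ip M W W = L2_ip M W Y"
    using L2_ip_cong_AE[OF WL YL WL Y(2)] by (simp add: L2_ip_commute)
  also have "\<dots> = 0" by (rule chaos_orthogonal[OF W m Y'])
  finally show ?thesis by (rule L2_ip_self_zero[OF WL])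
qed

section \<open>Coefficients of the chaos components\<close>

lemma wick_at_f:
  assumes "set xs \<subseteq> D"
  shows "wick M H (map f xs) = chaos_proj M H (length xs) (at_f (monomial (count_list xs)))"
proof -
  have "(\<Prod>X\<leftarrow>map f xs. X \<omega>) = at_f (monomial (count_list xs)) \<omega>" for \<omega>
    unfolding at_f_def monomial_count_list[OF assms] by (simp add: comp_def)
  then show ?thesis by (simp add: wick_def)
qed

text \<open>This identifies the pivotal intensity as a Hermite coefficient. Integration by parts
  runs once through the distinct entries of the tuple, and repeated occurrences remain as
  derivatives of the density.\<close>

lemma pivotal_intensity_eq:
  assumes "set xs \<subseteq> D"
  shows "pivotal_intensity M D f \<Xi> \<nu> xs
    = L2_ip M (at_f (\<lambda>u. \<Xi> (excursion_set D \<nu> u))) (hermite_f (count_list xs))"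
proof -
  let ?I = "set xs" and ?\<beta> = "\<lambda>x. count_list xs x - 1"
  let ?\<psi> = "gauss_density ?I (cov M f) \<nu>"
  have \<psi>: "?\<psi> \<noteq> 0" by (rule density_nonzero[OF assms])
  \<comment> \<open>Truncated subtraction removes one from each occurring point and leaves 0
    elsewhere, so adding the indicator of the support restores the counts.\<close>
  have count: "(\<lambda>i. ?\<beta> i + of_bool (i \<in> set (remdups xs))) = count_list xs"
  proof
    fix i
    show "?\<beta> i + of_bool (i \<in> set (remdups xs)) = count_list xs i"
      by (cases "i \<in> set xs") (use count_list_0_iff[of xs i] in auto)
  qed
  have "L2_ip M (at_f (\<lambda>u. \<Xi> (excursion_set D \<nu> u))) (hermite_f (count_list xs))
      = threshold_integral \<nu> {} \<Xi> (density_deriv (count_list xs))"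
    unfolding L2_ip_hermite[OF excursion_functional_local] threshold_integral_empty ..
  also have "\<dots> = threshold_integral \<nu> ?I (disc_derivs xs \<Xi>) (density_deriv ?\<beta>)"
    using threshold_integral_density_deriv[of "remdups xs" \<nu> \<Xi> ?\<beta>] assms
    unfolding count disc_derivs_def by simp
  also have "\<dots> = gauss_cond_exp M D f
       (\<lambda>u. disc_derivs xs \<Xi> (excursion_set D \<nu> u) * hermite D (cov M f) ?\<beta> u) ?I \<nu> * ?\<psi>"
  proof -
    \<comment> \<open>The full density cancels the denominator of the Hermite polynomial; the
      density of the subvector is then cancelled by the factor outside the conditional
      expectation.\<close>
    have "disc_derivs xs \<Xi> (excursion_set D \<nu> u) * hermite D (cov M f) ?\<beta> u * (\<phi> u / ?\<psi>)
        = disc_derivs xs \<Xi> (excursion_set D \<nu> u) * density_deriv ?\<beta> u / ?\<psi>" for u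
      unfolding density_times_hermite[symmetric] by simp
    from this[of "merge ?I (D - ?I) (\<nu>, z)" for z] show ?thesis
      unfolding gauss_cond_exp_def threshold_integral_def using \<psi> by (simp only:) simp
  qed
  finally show ?thesis unfolding pivotal_intensity_def by simp
qed

lemma excursion_functional_L2: "at_f (\<lambda>u. \<Xi> (excursion_set D \<nu> u)) \<in> L2 M"
proof -
  let ?X = "at_f (\<lambda>u. \<Xi> (excursion_set D \<nu> u))"
  have meas: "?X \<in> borel_measurable M"
    by (rule at_f_measurable[OF excursion_functional_local])
  have "integrable M (\<lambda>\<omega>. (?X \<omega>)\<^sup>2)"
  proof (rule integrable_const_bound[where B = "(\<Sum>E\<in>Pow D. \<bar>\<Xi> E\<bar>)\<^sup>2"])
    show "AE \<omega> in M. norm ((?X \<omega>)\<^sup>2) \<le> (\<Sum>E\<in>Pow D. \<bar>\<Xi> E\<bar>)\<^sup>2"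
      using excursion_functional_bound[OF finite_D, of \<Xi> \<nu>]
      by (intro AE_I2) (simp add: at_f_def abs_le_square_iff[symmetric] abs_of_nonneg sum_nonneg)
  qed (use meas in simp)
  then show ?thesis using meas by (simp add: L2_def)
qed

text \<open>Both sides lie in the chaos of order m, so equal pairings with its Hermite variables
  suffice. Against the one of index \<alpha>, only the m!/\<alpha>! tuples with that multi-index
  contribute, each \<alpha>! times the coefficient of the functional; the factor 1/m! leaves exactly
  that coefficient.\<close>

lemma chaos_proj_excursion_functional:
  assumes m: "0 < m"
  shows "AE \<omega> in M. chaos_proj M H m (at_f (\<lambda>u. \<Xi> (excursion_set D \<nu> u))) \<omega>
    = 1 / fact m * (\<Sum>xs | length xs = m \<and> set xs \<subseteq> D. wick M H (map f xs) \<omega> * pivotal_intensity M D f \<Xi> \<nu> xs)"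
proof -
  let ?X = "at_f (\<lambda>u. \<Xi> (excursion_set D \<nu> u))"
  let ?Q = "chaos_proj M H m ?X"
  let ?P = "pivotal_intensity M D f \<Xi> \<nu>"
  let ?T = "{xs. length xs = m \<and> set xs \<subseteq> D}"
  define w where "w xs = wick M H (map f xs)" for xs
  define R where "R = (\<lambda>\<omega>. 1 / fact m * (\<Sum>xs\<in>?T. ?P xs * w xs \<omega>))"
  have X: "?X \<in> L2 M" by (rule excursion_functional_L2)
  note Q = chaos_proj_properties[OF X m]
  have finT: "finite ?T"
    using finite_lists_length_eq[OF finite_D, of m] by (simp add: conj_commute)
  \<comment> \<open>Projecting onto the chaos preserves pairings with its elements, so a Wick
    product may be replaced by the bare monomial.\<close>
  have w: "w xs \<in> chaos m" "L2_ip M (w xs) (hermite_f \<alpha>) = L2_ip M (at_f (monomial (count_list xs))) (hermite_f \<alpha>)"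
    if "xs \<in> ?T" "(\<Sum>i\<in>D. \<alpha> i) = m" for xs \<alpha>
  proof -
    have xs: "length xs = m" "set xs \<subseteq> D" using that by auto
    note * = chaos_proj_properties[OF monomial_L2[of "count_list xs"] m]
    have w_eq: "w xs = chaos_proj M H m (at_f (monomial (count_list xs)))"
      unfolding w_def wick_at_f[OF xs(2)] xs(1) ..
    show "w xs \<in> chaos m" unfolding w_eq by (rule *(1))
    show "L2_ip M (w xs) (hermite_f \<alpha>) = L2_ip M (at_f (monomial (count_list xs))) (hermite_f \<alpha>)"
      using *(2)[OF hermite_f_chaos[OF that(2)]] chaos_L2[OF *(1)]
      unfolding w_eq by (simp add: L2_ip_diff_left monomial_L2 hermite_f_L2)
  qed
  have wc: "w xs \<in> chaos m" if "xs \<in> ?T" for xs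
  proof -
    have "set xs \<subseteq> D" "length xs = m" using that by auto
    then show ?thesis
      unfolding w_def using wick_at_f chaos_proj_properties(1)[OF monomial_L2 m] by metis
  qed
  have R: "R \<in> chaos m"
    unfolding R_def by (rule chaos_cmult, rule chaos_sum[OF finT _ m], rule chaos_cmult, rule wc)
  have QR: "(\<lambda>\<omega>. ?Q \<omega> - R \<omega>) \<in> chaos m" by (rule chaos_diff[OF Q(1) R])
  have "AE \<omega> in M. ?Q \<omega> - R \<omega> = 0"
  proof (rule chaos_zero_if_orthogonal_hermite[OF QR m])
    fix \<alpha> assume \<alpha>: "\<alpha> \<in> multi_indices m" "(\<Sum>i\<in>D. \<alpha> i) = m"
    let ?h = "hermite_f \<alpha>"
    let ?S = "{xs. count_list xs = \<alpha>}"
    have \<alpha>0: "\<alpha> x = 0" if "x \<notin> D" for x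
      using \<alpha>(1) that by (simp add: multi_indices_def)
    have ST: "?S \<subseteq> ?T"
    proof
      fix xs assume "xs \<in> ?S"
      then have eq: "count_list xs = \<alpha>" by simp
      have "set xs \<subseteq> D"
        using \<alpha>0 eq count_list_0_iff[of xs] by blast
      moreover have "length xs = m"
        using sum_count_set[OF calculation finite_D] eq \<alpha>(2) by simp
      ultimately show "xs \<in> ?T" by simp
    qed
    have "L2_ip M R ?h = 1 / fact m * (\<Sum>xs\<in>?T. ?P xs * L2_ip M (w xs) ?h)"
      unfolding R_def L2_ip_cmult_left L2_ip_commute[of M _ ?h]
      by (subst L2_ip_sum_right[OF finT L2_cmult[OF chaos_L2[OF wc]] hermite_f_L2])
        (simp_all add: L2_ip_cmult_right)
    also have "(\<Sum>xs\<in>?T. ?P xs * L2_ip M (w xs) ?h)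
        = (\<Sum>xs\<in>?T. if xs \<in> ?S then L2_ip M ?X ?h * (\<Prod>i\<in>D. fact (\<alpha> i)) else 0)"
    proof (rule sum.cong[OF refl])
      fix xs assume xs: "xs \<in> ?T"
      then have D: "set xs \<subseteq> D" "(\<Sum>i\<in>D. count_list xs i) \<le> (\<Sum>i\<in>D. \<alpha> i)"
        using sum_count_set[of xs D] finite_D \<alpha>(2) by auto
      have iff: "(\<forall>i\<in>D. \<alpha> i = count_list xs i) \<longleftrightarrow> xs \<in> ?S"
      proof
        assume *: "\<forall>i\<in>D. \<alpha> i = count_list xs i"
        have "count_list xs i = \<alpha> i" for i
          using * \<alpha>0[of i] D(1) count_list_0_iff[of xs i] by (cases "i \<in> D") auto
        then show "xs \<in> ?S" by auto
      qed auto
      show "?P xs * L2_ip M (w xs) ?h = (if xs \<in> ?S then L2_ip M ?X ?h * (\<Prod>i\<in>D. fact (\<alpha> i)) else 0)"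
        unfolding w(2)[OF xs \<alpha>(2)] L2_ip_monomial_hermite[OF D(2)] iff pivotal_intensity_eq[OF D(1)]
        by simp
    qed
    also have "\<dots> = (\<Sum>xs\<in>?S. L2_ip M ?X ?h * (\<Prod>i\<in>D. fact (\<alpha> i)))"
      using ST finT by (simp add: sum.If_cases Int_absorb1)
    also have "\<dots> = L2_ip M ?X ?h * real (card ?S * (\<Prod>i\<in>D. fact (\<alpha> i)))"
      by simp
    also have "card ?S * (\<Prod>i\<in>D. fact (\<alpha> i)) = fact m"
      using card_lists_with_count[OF finite_D \<alpha>0] \<alpha>(2) by simp
    finally have "L2_ip M R ?h = L2_ip M ?X ?h" by simp
    moreover have "L2_ip M ?Q ?h = L2_ip M ?X ?h"
      using Q(2)[OF hermite_f_chaos[OF \<alpha>(2)]]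
      by (simp add: L2_ip_diff_left X chaos_L2[OF Q(1)] hermite_f_L2)
    ultimately show "L2_ip M (\<lambda>\<omega>. ?Q \<omega> - R \<omega>) ?h = 0"
      by (simp add: L2_ip_diff_left chaos_L2[OF Q(1)] chaos_L2[OF R] hermite_f_L2)
  qed
  then show ?thesis
    by eventually_elim (simp add: R_def w_def mult.commute)
qed

end

section \<open>Density of the polynomials\<close>

lemma L2_closure_approx:
  assumes "Y \<in> L2_closure M S" "e > 0"
  shows "\<exists>Z\<in>S. (\<integral>\<omega>. (Z \<omega> - Y \<omega>)\<^sup>2 \<partial>M) < e"
proof -
  obtain Z where Z: "\<And>n. Z n \<in> S" "tendsto_L2 M Z Y"
    using assms(1) unfolding L2_closure_def by blast
  have "\<forall>\<^sub>F n in sequentially. (\<integral>\<omega>. (Z n \<omega> - Y \<omega>)\<^sup>2 \<partial>M) < e"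
    using Z(2) assms(2) by (intro order_tendstoD(2)[where y = 0]) (auto simp: tendsto_L2_def)
  then obtain n where "(\<integral>\<omega>. (Z n \<omega> - Y \<omega>)\<^sup>2 \<partial>M) < e"
    by (auto simp: eventually_sequentially)
  then show ?thesis using Z(1) by blast
qed

lemma L2_closureI:
  assumes "S \<subseteq> L2 M" "Y \<in> L2 M" "\<And>e. e > 0 \<Longrightarrow> \<exists>Z\<in>S. (\<integral>\<omega>. (Z \<omega> - Y \<omega>)\<^sup>2 \<partial>M) < e"
  shows "Y \<in> L2_closure M S"
proof -
  have "\<forall>n. \<exists>Z. Z \<in> S \<and> (\<integral>\<omega>. (Z \<omega> - Y \<omega>)\<^sup>2 \<partial>M) < inverse (real (Suc n))"
    using assms(3) by (meson inverse_positive_iff_positive of_nat_0_less_iff zero_less_Suc)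
  then obtain Z where Z: "\<And>n. Z n \<in> S" "\<And>n. (\<integral>\<omega>. (Z n \<omega> - Y \<omega>)\<^sup>2 \<partial>M) < inverse (real (Suc n))"
    by metis
  have "(\<lambda>n. \<integral>\<omega>. (Z n \<omega> - Y \<omega>)\<^sup>2 \<partial>M) \<longlonglongrightarrow> 0"
  proof (rule tendsto_sandwich[of "\<lambda>_. 0" _ _ "\<lambda>n. inverse (real (Suc n))"])
    show "\<forall>\<^sub>F n in sequentially. (\<integral>\<omega>. (Z n \<omega> - Y \<omega>)\<^sup>2 \<partial>M) \<le> inverse (real (Suc n))"
      using Z(2) by (intro always_eventually allI less_imp_le)
    show "(\<lambda>n. inverse (real (Suc n))) \<longlonglongrightarrow> 0"
      by (rule LIMSEQ_inverse_real_of_nat)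
  qed simp_all
  then have "tendsto_L2 M Z Y"
    using Z(1) assms(1,2) by (auto simp: tendsto_L2_def)
  then show ?thesis
    unfolding L2_closure_def by (intro CollectI exI[of _ Z] conjI allI Z(1))
qed

lemma square_diff_le_triangle: "((a::real) - c)\<^sup>2 \<le> 2 * (a - b)\<^sup>2 + 2 * (b - c)\<^sup>2"
proof -
  have "0 \<le> ((a - b) - (b - c))\<^sup>2" by simp
  then show ?thesis by (simp add: power2_eq_square algebra_simps)
qed

lemma L2_closure_idem:
  assumes "S \<subseteq> L2 M" "Y \<in> L2_closure M (L2_closure M S)"
  shows "Y \<in> L2_closure M S"
proof (rule L2_closureI[OF assms(1)])
  show Y: "Y \<in> L2 M" using assms(2) L2_closure_subset_L2 by blast
  fix e :: real assume "e > 0"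
  \<comment> \<open>Two approximations, each doubled by the quadratic triangle inequality, add up to
    less than \<open>e\<close>.\<close>
  then have e: "e / 4 > 0" by simp
  obtain W where W: "W \<in> L2_closure M S" "(\<integral>\<omega>. (W \<omega> - Y \<omega>)\<^sup>2 \<partial>M) < e / 4"
    using L2_closure_approx[OF assms(2) e] by blast
  obtain Z where Z: "Z \<in> S" "(\<integral>\<omega>. (Z \<omega> - W \<omega>)\<^sup>2 \<partial>M) < e / 4"
    using L2_closure_approx[OF W(1) e] by blast
  have L: "W \<in> L2 M" "Z \<in> L2 M" using W(1) Z(1) assms(1) L2_closure_subset_L2 by auto
  have i: "integrable M (\<lambda>\<omega>. (Z \<omega> - Y \<omega>)\<^sup>2)" "integrable M (\<lambda>\<omega>. (Z \<omega> - W \<omega>)\<^sup>2)"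
    "integrable M (\<lambda>\<omega>. (W \<omega> - Y \<omega>)\<^sup>2)"
    by (rule L2_D(2)[OF L2_diff[OF L(2) Y]], rule L2_D(2)[OF L2_diff[OF L(2,1)]], rule L2_D(2)[OF L2_diff[OF L(1) Y]])
  have "(\<integral>\<omega>. (Z \<omega> - Y \<omega>)\<^sup>2 \<partial>M) \<le> (\<integral>\<omega>. 2 * (Z \<omega> - W \<omega>)\<^sup>2 + 2 * (W \<omega> - Y \<omega>)\<^sup>2 \<partial>M)"
    using i by (intro integral_mono square_diff_le_triangle) auto
  also have "\<dots> < e" using i W(2) Z(2) by simp
  finally show "\<exists>Z\<in>S. (\<integral>\<omega>. (Z \<omega> - Y \<omega>)\<^sup>2 \<partial>M) < e" using Z(1) by blast
qed

lemma tendsto_L2_dominated: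
  assumes "\<And>n. Z n \<in> borel_measurable M" "G \<in> L2 M"
    and "\<And>n \<omega>. \<omega> \<in> space M \<Longrightarrow> \<bar>Z n \<omega>\<bar> \<le> \<bar>G \<omega>\<bar>" "\<And>\<omega>. \<omega> \<in> space M \<Longrightarrow> (\<lambda>n. Z n \<omega>) \<longlonglongrightarrow> Y \<omega>"
  shows "tendsto_L2 M Z Y"
proof -
  have Y: "Y \<in> borel_measurable M"
    using borel_measurable_LIMSEQ_real[OF assms(4,1)] by blast
  have Yb: "\<bar>Y \<omega>\<bar> \<le> \<bar>G \<omega>\<bar>" if "\<omega> \<in> space M" for \<omega>
    by (rule LIMSEQ_le_const2[OF tendsto_rabs[OF assms(4)[OF that]]]) (use assms(3)[OF that] in auto)
  have L: "X \<in> L2 M" if "X \<in> borel_measurable M" "\<And>\<omega>. \<omega> \<in> space M \<Longrightarrow> \<bar>X \<omega>\<bar> \<le> \<bar>G \<omega>\<bar>" for X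
  proof -
    have "integrable M (\<lambda>\<omega>. (X \<omega>)\<^sup>2)"
    proof (rule Bochner_Integration.integrable_bound[OF L2_D(2)[OF assms(2)]])
      show "(\<lambda>\<omega>. (X \<omega>)\<^sup>2) \<in> borel_measurable M" using that(1) by simp
      show "AE \<omega> in M. norm ((X \<omega>)\<^sup>2) \<le> norm ((G \<omega>)\<^sup>2)"
        using that(2) by (intro AE_I2) (simp add: abs_le_square_iff)
    qed
    then show ?thesis using that(1) by (simp add: L2_def)
  qed
  have ZL: "Z n \<in> L2 M" for n by (rule L[OF assms(1,3)])
  have YL: "Y \<in> L2 M" by (rule L[OF Y Yb])
  have "(\<lambda>n. \<integral>\<omega>. (Z n \<omega> - Y \<omega>)\<^sup>2 \<partial>M) \<longlonglongrightarrow> (\<integral>\<omega>. 0 \<partial>M)"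
  \<comment> \<open>Both the sequence and its limit are bounded by G, so the squared difference is
    at most the square of 2 G.\<close>
  proof (rule integral_dominated_convergence[where w = "\<lambda>\<omega>. 4 * (G \<omega>)\<^sup>2"])
    show "integrable M (\<lambda>\<omega>. 4 * (G \<omega>)\<^sup>2)" using L2_D(2)[OF assms(2)] by simp
    show "(\<lambda>\<omega>. (Z n \<omega> - Y \<omega>)\<^sup>2) \<in> borel_measurable M" for n
      using assms(1) Y by simp
    show "AE \<omega> in M. (\<lambda>n. (Z n \<omega> - Y \<omega>)\<^sup>2) \<longlonglongrightarrow> 0"
    proof (rule AE_I2)
      fix \<omega> assume "\<omega> \<in> space M"
      from tendsto_power[OF tendsto_diff[OF assms(4)[OF this] tendsto_const[of "Y \<omega>"]], of 2]
      show "(\<lambda>n. (Z n \<omega> - Y \<omega>)\<^sup>2) \<longlonglongrightarrow> 0" by simp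
    qed
    show "AE \<omega> in M. norm ((Z n \<omega> - Y \<omega>)\<^sup>2) \<le> 4 * (G \<omega>)\<^sup>2" for n
    proof (rule AE_I2)
      fix \<omega> assume \<omega>: "\<omega> \<in> space M"
      have "\<bar>Z n \<omega> - Y \<omega>\<bar> \<le> 2 * \<bar>G \<omega>\<bar>"
        using assms(3)[OF \<omega>, of n] Yb[OF \<omega>] by linarith
      then have "\<bar>Z n \<omega> - Y \<omega>\<bar>\<^sup>2 \<le> (2 * \<bar>G \<omega>\<bar>)\<^sup>2"
        by (rule power_mono) simp
      then show "norm ((Z n \<omega> - Y \<omega>)\<^sup>2) \<le> 4 * (G \<omega>)\<^sup>2"
        by (simp add: power_mult_distrib)
    qed
  qed simp
  then show ?thesis
    using ZL YL by (simp add: tendsto_L2_def)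
qed

text \<open>The terms are dominated by those of the exponential series, which gives a bound uniform
  in \<open>n\<close>.\<close>

lemma sin_partial_sum_bound: "\<bar>\<Sum>k<n. sin_coeff k * y ^ k\<bar> \<le> exp \<bar>y\<bar>" for y :: real
proof -
  have "\<bar>\<Sum>k<n. sin_coeff k * y ^ k\<bar> \<le> (\<Sum>k<n. \<bar>sin_coeff k * y ^ k\<bar>)"
    by (rule sum_abs)
  also have "\<dots> \<le> (\<Sum>k<n. \<bar>y\<bar> ^ k /\<^sub>R fact k)"
    by (rule sum_mono) (auto simp: sin_coeff_def abs_mult power_abs divide_inverse)
  also have "\<dots> \<le> exp \<bar>y\<bar>"
    unfolding exp_def by (rule sum_le_suminf[OF summable_exp_generic]) auto
  finally show ?thesis .
qed

context gaussian_vector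
begin

text \<open>Exponential moments of every order provide the majorants for Taylor expansion under the
  square norm.\<close>

lemma exp_at_f_integrable: "integrable M (at_f (\<lambda>u. exp (k * (\<Sum>i\<in>D. \<bar>u i\<bar>))))"
proof -
  interpret product_sigma_finite "\<lambda>_. lborel :: real measure" ..
  let ?h = "\<lambda>u::'i \<Rightarrow> real. exp (k * (\<Sum>i\<in>D. \<bar>u i\<bar>))"
  have "(\<lambda>u :: 'i \<Rightarrow> real. \<bar>u i\<bar>) \<in> borel_measurable (\<Pi>\<^sub>M x\<in>D. lborel)" if "i \<in> D" for i
    by (rule measurable_compose[OF coordinate_measurable_PiM[OF that]]) simp
  then have "(\<lambda>u :: 'i \<Rightarrow> real. \<Sum>i\<in>D. \<bar>u i\<bar>) \<in> borel_measurable (\<Pi>\<^sub>M x\<in>D. lborel)"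
    by (rule borel_measurable_sum)
  from measurable_compose[OF this, of "\<lambda>x. exp (k * x)" borel]
  have meas: "?h \<in> borel_measurable (\<Pi>\<^sub>M x\<in>D. lborel)" by simp
  have "?h u = ?h v" if "\<forall>x\<in>D. u x = v x" for u v
    using that by simp
  then have loc: "local_on_D ?h"
    unfolding local_on_D_def using meas by blast
  obtain C where C: "C \<ge> 0" "\<And>u. ?h u * \<bar>\<phi> u\<bar> \<le> C * (\<Prod>i\<in>D. bump (u i))"
    using exp_density_bound[of k] by blast
  have "integrable (\<Pi>\<^sub>M x\<in>D. lborel) (\<lambda>u. C * (\<Prod>i\<in>D. bump (u i)))"
    by (rule integrable_mult_right, rule product_integrable_prod[OF finite_D]) (rule integrable_bump)
  then have "integrable (\<Pi>\<^sub>M x\<in>D. lborel) (\<lambda>u. \<phi> u * ?h u)"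
  proof (rule Bochner_Integration.integrable_bound)
    show "(\<lambda>u. \<phi> u * ?h u) \<in> borel_measurable (\<Pi>\<^sub>M x\<in>D. lborel)"
      using density_measurable meas by simp
    have "norm (\<phi> u * ?h u) \<le> norm (C * (\<Prod>i\<in>D. bump (u i)))" for u
      using order_trans[OF C(2)[of u] abs_ge_self] by (simp add: abs_mult mult.commute)
    then show "AE u in \<Pi>\<^sub>M x\<in>D. lborel. norm (\<phi> u * ?h u) \<le> norm (C * (\<Prod>i\<in>D. bump (u i)))"
      by simp
  qed
  then show ?thesis unfolding integrable_at_f[OF loc] .
qed

lemma coordinate_f_measurable:
  assumes "x \<in> D"
  shows "f x \<in> borel_measurable M"
  using at_f_measurable[OF polyf_local[OF polyf_coord[OF assms, of 0]]] by (simp add: at_f_def[abs_def])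

section \<open>The closure of the polynomials and its multipliers\<close>

definition all_polys :: "('w \<Rightarrow> real) set" where
  "all_polys = (\<Union>m. poly_space m)"

lemma all_polys_iff: "Y \<in> all_polys \<longleftrightarrow> (\<exists>m p. polyf D m p \<and> Y = at_f p)"
  unfolding all_polys_def using at_f_poly_space_iff by blast

lemma all_polys_L2: "all_polys \<subseteq> L2 M"
  unfolding all_polys_def using poly_space_subset_L2 by blast

lemma all_polys_add: "Y \<in> all_polys \<Longrightarrow> Y' \<in> all_polys \<Longrightarrow> (\<lambda>\<omega>. Y \<omega> + Y' \<omega>) \<in> all_polys"
proof -
  assume "Y \<in> all_polys" "Y' \<in> all_polys"
  then obtain m m' p p' where p: "polyf D m p" "Y = at_f p" "polyf D m' p'" "Y' = at_f p'"
    unfolding all_polys_iff by blast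
  have "polyf D (max m m') (\<lambda>u. p u + p' u)"
    by (rule polyf_add; rule polyf_mono[OF p(1)] polyf_mono[OF p(3)]) simp_all
  moreover have "(\<lambda>\<omega>. Y \<omega> + Y' \<omega>) = at_f (\<lambda>u. p u + p' u)"
    by (simp add: p at_f_def[abs_def])
  ultimately show ?thesis unfolding all_polys_iff by blast
qed

lemma all_polys_cmult: "Y \<in> all_polys \<Longrightarrow> (\<lambda>\<omega>. c * Y \<omega>) \<in> all_polys"
  unfolding all_polys_def using lin_span_cmult by blast

abbreviation poly_closure :: "('w \<Rightarrow> real) set" where
  "poly_closure \<equiv> L2_closure M all_polys"

text \<open>Taylor polynomials of the sine times p are again polynomials in the vector. They
  converge pointwise under a single square-integrable exponential majorant.\<close>

lemma sin_times_poly_closure: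
  assumes "x \<in> D" "polyf D m p"
  shows "(\<lambda>\<omega>. sin (t * f x \<omega>) * at_f p \<omega>) \<in> poly_closure"
proof -
  define q where "q n = (\<lambda>u. (\<Sum>k<n. sin_coeff k * (t * u x) ^ k) * p u)" for n
  have q: "\<exists>m'. polyf D m' (q n)" for n
  proof -
    have pow: "polyf D k (\<lambda>u. (t * u x) ^ k)" for k
    proof (induction k)
      case 0
      show ?case using polyf_const[of D 0 1] by simp
    next
      case (Suc k)
      show ?case
        using polyf_coord_mult[OF assms(1) polyf_cmult[OF Suc, of t]] by (simp add: mult_ac)
    qed
    have "polyf D n (\<lambda>u. \<Sum>k<n. sin_coeff k * (t * u x) ^ k)"
      by (rule polyf_sum, simp, rule polyf_cmult, rule polyf_mono[OF pow]) simp
    from polyf_mult[OF this assms(2)] show ?thesis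
      unfolding q_def by blast
  qed
  obtain C k where C: "C \<ge> 0" "\<And>u. \<bar>p u\<bar> \<le> C * exp (real k * (\<Sum>i\<in>D. \<bar>u i\<bar>))"
    using polyf_exp_bound[OF finite_D assms(2)] by blast
  define G where "G = (\<lambda>\<omega>. C * at_f (\<lambda>u. exp ((\<bar>t\<bar> + real k) * (\<Sum>i\<in>D. \<bar>u i\<bar>))) \<omega>)"
  have GL: "G \<in> L2 M"
    unfolding G_def
  proof (rule L2_cmult)
    have sq: "(exp (a::real))\<^sup>2 = exp (2 * a)" for a
      by (simp add: power2_eq_square exp_add[symmetric])
    let ?g = "at_f (\<lambda>u. exp ((\<bar>t\<bar> + real k) * (\<Sum>i\<in>D. \<bar>u i\<bar>)))"
    have "(\<lambda>\<omega>. (?g \<omega>)\<^sup>2) = at_f (\<lambda>u. exp ((2 * (\<bar>t\<bar> + real k)) * (\<Sum>i\<in>D. \<bar>u i\<bar>)))"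
      by (simp add: at_f_def[abs_def] sq algebra_simps)
    then show "?g \<in> L2 M"
      unfolding L2_def using exp_at_f_integrable[of "\<bar>t\<bar> + real k"]
        exp_at_f_integrable[of "2 * (\<bar>t\<bar> + real k)"] by auto
  qed
  have "tendsto_L2 M (\<lambda>n. at_f (q n)) (\<lambda>\<omega>. sin (t * f x \<omega>) * at_f p \<omega>)"
  proof (rule tendsto_L2_dominated[OF _ GL])
    show "at_f (q n) \<in> borel_measurable M" for n
      using q[of n] polyf_at_f_L2 L2_D(1) by blast
    show "\<bar>at_f (q n) \<omega>\<bar> \<le> \<bar>G \<omega>\<bar>" for n \<omega>
    proof -
      let ?S = "\<Sum>i\<in>D. \<bar>f i \<omega>\<bar>"
      have "\<bar>f x \<omega>\<bar> \<le> ?S"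
        by (rule member_le_sum[OF assms(1) _ finite_D]) simp
      then have "\<bar>t * f x \<omega>\<bar> \<le> \<bar>t\<bar> * ?S"
        unfolding abs_mult by (rule mult_left_mono) simp
      then have "\<bar>\<Sum>k<n. sin_coeff k * (t * f x \<omega>) ^ k\<bar> \<le> exp (\<bar>t\<bar> * ?S)"
        using sin_partial_sum_bound[of "t * f x \<omega>" n] by (meson exp_le_cancel_iff order_trans)
      moreover have "\<bar>p (\<lambda>x. f x \<omega>)\<bar> \<le> C * exp (real k * ?S)"
        by (rule C(2))
      ultimately have "\<bar>at_f (q n) \<omega>\<bar> \<le> exp (\<bar>t\<bar> * ?S) * (C * exp (real k * ?S))"
        unfolding at_f_def q_def abs_mult by (rule mult_mono) auto
      also have "\<dots> = G \<omega>"
        by (simp add: G_def at_f_def distrib_right exp_add)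
      finally show ?thesis using abs_ge_self order_trans by blast
    qed
    show "(\<lambda>n. at_f (q n) \<omega>) \<longlonglongrightarrow> sin (t * f x \<omega>) * at_f p \<omega>" for \<omega>
    proof -
      have "(\<lambda>n. \<Sum>k<n. sin_coeff k * (t * f x \<omega>) ^ k) \<longlonglongrightarrow> sin (t * f x \<omega>)"
        using sin_converges[of "t * f x \<omega>"] by (simp add: sums_def)
      then show ?thesis
        unfolding at_f_def q_def by (rule tendsto_mult_right)
    qed
  qed
  moreover have "at_f (q n) \<in> all_polys" for n
    unfolding all_polys_iff using q[of n] by blast
  ultimately show ?thesis
    unfolding L2_closure_def by (intro CollectI exI[of _ "\<lambda>n. at_f (q n)"] conjI allI)
qed

text \<open>Density is shown for bounded multipliers: unlike the closure of the polynomials itself, the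
  multipliers obviously form an algebra, which contains \<open>sin (t * f x)\<close> by Taylor expansion.\<close>

definition multiplier :: "('w \<Rightarrow> real) \<Rightarrow> bool" where
  "multiplier g \<longleftrightarrow> g \<in> borel_measurable M \<and> (\<exists>B. \<forall>\<omega>. \<bar>g \<omega>\<bar> \<le> B) \<and> (\<forall>Y\<in>poly_closure. (\<lambda>\<omega>. g \<omega> * Y \<omega>) \<in> poly_closure)"

lemma poly_closure_L2: "Y \<in> poly_closure \<Longrightarrow> Y \<in> L2 M"
  using L2_closure_subset_L2 by blast

lemma L2_bounded_mult:
  assumes "g \<in> borel_measurable M" "\<And>\<omega>. \<bar>g \<omega>\<bar> \<le> B" "Y \<in> L2 M"
  shows "(\<lambda>\<omega>. g \<omega> * Y \<omega>) \<in> L2 M"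
proof -
  have "tendsto_L2 M (\<lambda>_ \<omega>. g \<omega> * Y \<omega>) (\<lambda>\<omega>. g \<omega> * Y \<omega>)"
  proof (rule tendsto_L2_dominated[where G = "\<lambda>\<omega>. B * Y \<omega>"])
    show "\<bar>g \<omega> * Y \<omega>\<bar> \<le> \<bar>B * Y \<omega>\<bar>" for \<omega>
      unfolding abs_mult using order_trans[OF assms(2) abs_ge_self] by (intro mult_right_mono) auto
  qed (use assms L2_D(1)[OF assms(3)] in \<open>auto intro: L2_cmult borel_measurable_times\<close>)
  then show ?thesis by (simp add: tendsto_L2_def)
qed

text \<open>Dominated convergence with majorant B Y places the limit product in the closure of the
  closure, which is the closure.\<close>

lemma multiplier_limit:
  assumes g: "\<And>n. multiplier (g n)" and B: "\<And>n \<omega>. \<bar>g n \<omega>\<bar> \<le> B"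
    and lim: "\<And>\<omega>. (\<lambda>n. g n \<omega>) \<longlonglongrightarrow> h \<omega>"
  shows "multiplier h"
  unfolding multiplier_def
proof (intro conjI ballI)
  show "h \<in> borel_measurable M"
    using borel_measurable_LIMSEQ_real[of M g h] lim g by (auto simp: multiplier_def)
  have "\<bar>h \<omega>\<bar> \<le> B" for \<omega>
    by (rule LIMSEQ_le_const2[OF tendsto_rabs[OF lim]]) (use B in auto)
  then show "\<exists>B. \<forall>\<omega>. \<bar>h \<omega>\<bar> \<le> B" by blast
  fix Y assume Y: "Y \<in> poly_closure"
  have gY: "(\<lambda>\<omega>. g n \<omega> * Y \<omega>) \<in> poly_closure" for n
    using g[of n] Y by (simp add: multiplier_def)
  have "tendsto_L2 M (\<lambda>n \<omega>. g n \<omega> * Y \<omega>) (\<lambda>\<omega>. h \<omega> * Y \<omega>)"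
  proof (rule tendsto_L2_dominated[where G = "\<lambda>\<omega>. B * Y \<omega>"])
    show "(\<lambda>\<omega>. g n \<omega> * Y \<omega>) \<in> borel_measurable M" for n
      using L2_D(1)[OF poly_closure_L2[OF gY]] .
    show "(\<lambda>\<omega>. B * Y \<omega>) \<in> L2 M" by (rule L2_cmult[OF poly_closure_L2[OF Y]])
    show "\<bar>g n \<omega> * Y \<omega>\<bar> \<le> \<bar>B * Y \<omega>\<bar>" for n \<omega>
      unfolding abs_mult using order_trans[OF B abs_ge_self] by (intro mult_right_mono) auto
    show "(\<lambda>n. g n \<omega> * Y \<omega>) \<longlonglongrightarrow> h \<omega> * Y \<omega>" for \<omega>
      by (rule tendsto_mult_right[OF lim])
  qed
  then have "(\<lambda>\<omega>. h \<omega> * Y \<omega>) \<in> L2_closure M poly_closure"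
    unfolding L2_closure_def[of M poly_closure] by (intro CollectI exI[of _ "\<lambda>n \<omega>. g n \<omega> * Y \<omega>"] conjI allI gY)
  then show "(\<lambda>\<omega>. h \<omega> * Y \<omega>) \<in> poly_closure"
    by (rule L2_closure_idem[OF all_polys_L2])
qed

lemma poly_closure_add: "Y \<in> poly_closure \<Longrightarrow> Y' \<in> poly_closure \<Longrightarrow> (\<lambda>\<omega>. Y \<omega> + Y' \<omega>) \<in> poly_closure"
  by (rule L2_closure_add[OF all_polys_add])

lemma poly_closure_cmult: "Y \<in> poly_closure \<Longrightarrow> (\<lambda>\<omega>. c * Y \<omega>) \<in> poly_closure"
  by (rule L2_closure_cmult[OF all_polys_cmult])

lemma multiplier_const: "multiplier (\<lambda>_. c)"
  unfolding multiplier_def using poly_closure_cmult by auto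

lemma multiplier_add:
  assumes "multiplier g" "multiplier h"
  shows "multiplier (\<lambda>\<omega>. g \<omega> + h \<omega>)"
proof -
  obtain A B where "\<And>\<omega>. \<bar>g \<omega>\<bar> \<le> A" "\<And>\<omega>. \<bar>h \<omega>\<bar> \<le> B"
    using assms unfolding multiplier_def by blast
  then have "\<bar>g \<omega> + h \<omega>\<bar> \<le> A + B" for \<omega>
    by (meson abs_triangle_ineq add_mono order_trans)
  then show ?thesis
    using assms unfolding multiplier_def distrib_right by (auto intro: poly_closure_add)
qed

lemma multiplier_mult:
  assumes "multiplier g" "multiplier h"
  shows "multiplier (\<lambda>\<omega>. g \<omega> * h \<omega>)"
proof -
  obtain A B where AB: "\<And>\<omega>. \<bar>g \<omega>\<bar> \<le> A" "\<And>\<omega>. \<bar>h \<omega>\<bar> \<le> B"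
    using assms unfolding multiplier_def by blast
  have "\<bar>g \<omega> * h \<omega>\<bar> \<le> A * B" for \<omega>
    unfolding abs_mult using AB order_trans[OF abs_ge_zero AB(1)] by (intro mult_mono) auto
  then show ?thesis
    using assms unfolding multiplier_def mult.assoc by auto
qed

lemma multiplier_sum:
  assumes "finite A" "\<And>a. a \<in> A \<Longrightarrow> multiplier (g a)"
  shows "multiplier (\<lambda>\<omega>. \<Sum>a\<in>A. g a \<omega>)"
  using assms by (induction A rule: finite_induct) (simp_all add: multiplier_const multiplier_add)

lemma multiplier_prod:
  assumes "finite A" "\<And>a. a \<in> A \<Longrightarrow> multiplier (g a)"
  shows "multiplier (\<lambda>\<omega>. \<Prod>a\<in>A. g a \<omega>)"
  using assms by (induction A rule: finite_induct) (simp_all add: multiplier_const multiplier_mult)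

lemma multiplier_power: "multiplier g \<Longrightarrow> multiplier (\<lambda>\<omega>. g \<omega> ^ n)"
  by (induction n) (simp_all add: multiplier_const multiplier_mult)

text \<open>On polynomials this is the Taylor argument. Since the sine is bounded by 1,
  multiplication by it does not increase the square norm, so approximations of Y pass to
  approximations of the product.\<close>

lemma multiplier_sin:
  assumes "x \<in> D"
  shows "multiplier (\<lambda>\<omega>. sin (t * f x \<omega>))"
  unfolding multiplier_def
proof (intro conjI ballI)
  show meas: "(\<lambda>\<omega>. sin (t * f x \<omega>)) \<in> borel_measurable M"
    using coordinate_f_measurable[OF assms] by simp
  show "\<exists>B. \<forall>\<omega>. \<bar>sin (t * f x \<omega>)\<bar> \<le> B"
    by (intro exI[of _ 1]) simp
  fix Y assume Y: "Y \<in> poly_closure"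
  let ?sY = "\<lambda>\<omega>. sin (t * f x \<omega>) * Y \<omega>"
  have YL: "Y \<in> L2 M" by (rule poly_closure_L2[OF Y])
  have sYL: "?sY \<in> L2 M"
    by (rule L2_bounded_mult[OF meas _ YL, of 1]) simp
  have "?sY \<in> L2_closure M poly_closure"
  proof (rule L2_closureI[OF L2_closure_subset_L2 sYL])
    fix e :: real assume "e > 0"
    then obtain Z where Z: "Z \<in> all_polys" "(\<integral>\<omega>. (Z \<omega> - Y \<omega>)\<^sup>2 \<partial>M) < e"
      using L2_closure_approx[OF Y] by blast
    have sZ: "(\<lambda>\<omega>. sin (t * f x \<omega>) * Z \<omega>) \<in> poly_closure"
      using Z(1) sin_times_poly_closure[OF assms] unfolding all_polys_iff by blast
    have ZL: "Z \<in> L2 M" using Z(1) all_polys_L2 by blast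
    have "(\<integral>\<omega>. (sin (t * f x \<omega>) * Z \<omega> - sin (t * f x \<omega>) * Y \<omega>)\<^sup>2 \<partial>M) \<le> (\<integral>\<omega>. (Z \<omega> - Y \<omega>)\<^sup>2 \<partial>M)"
    proof (rule integral_mono)
      show "integrable M (\<lambda>\<omega>. (sin (t * f x \<omega>) * Z \<omega> - sin (t * f x \<omega>) * Y \<omega>)\<^sup>2)"
        by (rule L2_D(2)[OF L2_diff[OF poly_closure_L2[OF sZ] sYL]])
      show "integrable M (\<lambda>\<omega>. (Z \<omega> - Y \<omega>)\<^sup>2)"
        by (rule L2_D(2)[OF L2_diff[OF ZL YL]])
      show "(sin (t * f x \<omega>) * Z \<omega> - sin (t * f x \<omega>) * Y \<omega>)\<^sup>2 \<le> (Z \<omega> - Y \<omega>)\<^sup>2" for \<omega>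
      proof -
        have "(sin (t * f x \<omega>))\<^sup>2 * (Z \<omega> - Y \<omega>)\<^sup>2 \<le> 1 * (Z \<omega> - Y \<omega>)\<^sup>2"
          by (rule mult_right_mono) (simp_all add: abs_square_le_1)
        then show ?thesis by (simp add: power_mult_distrib flip: right_diff_distrib)
      qed
    qed
    then show "\<exists>Z\<in>poly_closure. (\<integral>\<omega>. (Z \<omega> - sin (t * f x \<omega>) * Y \<omega>)\<^sup>2 \<partial>M) < e"
      using sZ Z(2) by (intro bexI[of _ "\<lambda>\<omega>. sin (t * f x \<omega>) * Z \<omega>"]) auto
  qed
  then show "?sY \<in> poly_closure" by (rule L2_closure_idem[OF all_polys_L2])
qed

text \<open>A Bernstein polynomial evaluated at g is built from powers of g and 1 - g, hence is a
  multiplier; uniform convergence on the unit interval carries this to continuous functions.\<close>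

lemma multiplier_continuous:
  fixes h :: "real \<Rightarrow> real"
  assumes g: "multiplier g" "\<And>\<omega>. g \<omega> \<in> {0..1}" and h: "continuous_on {0..1} h"
  shows "multiplier (\<lambda>\<omega>. h (g \<omega>))"
proof -
  define b where "b n s = (\<Sum>k\<le>n. h (real k / real n) * Bernstein n k s)" for n s
  have bm: "multiplier (\<lambda>\<omega>. b n (g \<omega>))" for n
  proof -
    have "multiplier (\<lambda>\<omega>. 1 - g \<omega>)"
      using multiplier_add[OF multiplier_const[of 1] multiplier_mult[OF multiplier_const[of "-1"] g(1)]] by simp
    then show ?thesis
      unfolding b_def Bernstein_def
      by (intro multiplier_sum multiplier_mult multiplier_const multiplier_power g(1)) auto
  qed
  have unif: "\<exists>N. \<forall>n\<ge>N. \<forall>s\<in>{0..1}. \<bar>h s - b n s\<bar> < e" if "e > 0" for e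
    using Bernstein_Weierstrass[OF h that] unfolding b_def by blast
  have "\<exists>N. \<forall>n\<ge>N. \<forall>s\<in>{0..1}. \<bar>h s - b n s\<bar> < 1"
    by (rule unif) simp
  then obtain N where "\<forall>n\<ge>N. \<forall>s\<in>{0..1}. \<bar>h s - b n s\<bar> < 1"
    by blast
  then have N: "\<bar>h s - b n s\<bar> < 1" if "n \<ge> N" "s \<in> {0..1}" for n s
    using that by blast
  obtain B where "\<forall>y\<in>h ` {0..1}. norm y \<le> B"
    using compact_imp_bounded[OF compact_continuous_image[OF h compact_Icc]]
    unfolding bounded_iff by blast
  then have B: "\<bar>h s\<bar> \<le> B" if "s \<in> {0..1}" for s
    using that by simp
  show ?thesis
  \<comment> \<open>Starting at \<open>N\<close>, all approximants are within 1 of \<open>h\<close>,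
    which yields the common bound that \<open>multiplier_limit\<close> demands.\<close>
  proof (rule multiplier_limit[of "\<lambda>n \<omega>. b (n + N) (g \<omega>)" "B + 1"])
    show "multiplier (\<lambda>\<omega>. b (n + N) (g \<omega>))" for n by (rule bm)
    show "\<bar>b (n + N) (g \<omega>)\<bar> \<le> B + 1" for n \<omega>
      using N[of "n + N" "g \<omega>"] B[OF g(2)[of \<omega>]] g(2)[of \<omega>] by (simp add: abs_less_iff abs_le_iff)
    show "(\<lambda>n. b (n + N) (g \<omega>)) \<longlonglongrightarrow> h (g \<omega>)" for \<omega>
    proof (rule LIMSEQ_ignore_initial_segment, rule LIMSEQ_I)
      fix r :: real assume "0 < r"
      then obtain K where "\<forall>n\<ge>K. \<forall>s\<in>{0..1}. \<bar>h s - b n s\<bar> < r" using unif by blast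
      then show "\<exists>no. \<forall>n\<ge>no. norm (b n (g \<omega>) - h (g \<omega>)) < r"
        using g(2)[of \<omega>] unfolding real_norm_def by (metis abs_minus_commute)
    qed
  qed
qed

text \<open>Continuous ramps of slope n starting at c converge pointwise to the indicator. They
  vanish at c itself, in agreement with the strict inequality.\<close>

lemma multiplier_threshold:
  assumes g: "multiplier g" "\<And>\<omega>. g \<omega> \<in> {0..1}"
  shows "multiplier (\<lambda>\<omega>. indicator {c<..} (g \<omega>))"
proof (rule multiplier_limit[of "\<lambda>n \<omega>. min 1 (max 0 (real n * (g \<omega> - c)))" 1])
  show "multiplier (\<lambda>\<omega>. min 1 (max 0 (real n * (g \<omega> - c))))" for n
    by (rule multiplier_continuous[OF g]) (intro continuous_intros)
  show "\<bar>min 1 (max 0 (real n * (g \<omega> - c)))\<bar> \<le> 1" for n \<omega>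
    by auto
  show "(\<lambda>n. min 1 (max 0 (real n * (g \<omega> - c)))) \<longlonglongrightarrow> indicator {c<..} (g \<omega>)" for \<omega>
  proof (cases "g \<omega> > c")
    case True
    obtain N where N: "1 < real N * (g \<omega> - c)"
      using True reals_Archimedean3[of "g \<omega> - c"] by auto
    have "min 1 (max 0 (real n * (g \<omega> - c))) = 1" if "n \<ge> N" for n
    proof -
      have "real N * (g \<omega> - c) \<le> real n * (g \<omega> - c)"
        using that True by (intro mult_right_mono) auto
      then show ?thesis using N by auto
    qed
    then have "\<forall>\<^sub>F n in sequentially. min 1 (max 0 (real n * (g \<omega> - c))) = indicator {c<..} (g \<omega>)"
      using True by (auto simp: eventually_sequentially)
    then show ?thesis by (rule tendsto_eventually)
  next
    case False
    have "min 1 (max 0 (real n * (g \<omega> - c))) = indicator {c<..} (g \<omega>)" for n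
    proof -
      have "real n * (g \<omega> - c) \<le> 0"
        using False by (intro mult_nonneg_nonpos) auto
      then show ?thesis using False by simp
    qed
    then show ?thesis by simp
  qed
qed

text \<open>Since \<open>sin\<close> increases near \<open>0\<close>, the events \<open>f x > a\<close> and
  \<open>sin (f x / n) > sin (a / n)\<close> eventually agree.\<close>

lemma multiplier_level:
  assumes "x \<in> D"
  shows "multiplier (\<lambda>\<omega>. indicator {a<..} (f x \<omega>))"
proof (rule multiplier_limit[of "\<lambda>n \<omega>. indicator {(1 + sin (inverse (real (Suc n)) * a)) / 2<..}
    ((1 + sin (inverse (real (Suc n)) * f x \<omega>)) / 2)" 1])
  fix n
  let ?t = "inverse (real (Suc n))"
  have "multiplier (\<lambda>\<omega>. (1 / 2) * (1 + sin (?t * f x \<omega>)))"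
    by (intro multiplier_mult multiplier_add multiplier_const multiplier_sin assms)
  then have m: "multiplier (\<lambda>\<omega>. (1 + sin (?t * f x \<omega>)) / 2)" by simp
  \<comment> \<open>The affine change of scale puts the sine into the unit interval, where
    \<open>multiplier_threshold\<close> applies, and preserves order.\<close>
  have "(1 + sin y) / 2 \<in> {0..1}" for y :: real
  proof -
    have "0 \<le> 1 + sin y" "1 + sin y \<le> 2"
      using sin_ge_minus_one[of y] sin_le_one[of y] by linarith+
    then show ?thesis by simp
  qed
  then show "multiplier (\<lambda>\<omega>. indicator {(1 + sin (?t * a)) / 2<..} ((1 + sin (?t * f x \<omega>)) / 2))"
    by (intro multiplier_threshold[OF m])
next
  fix \<omega>
  obtain N where N: "\<bar>a\<bar> + \<bar>f x \<omega>\<bar> < real N" using reals_Archimedean2 by blast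
  have "indicator {(1 + sin (inverse (real (Suc n)) * a)) / 2<..} ((1 + sin (inverse (real (Suc n)) * f x \<omega>)) / 2)
      = (indicator {a<..} (f x \<omega>) :: real)" if "n \<ge> N" for n
  proof -
    let ?t = "inverse (real (Suc n))"
    have small: "\<bar>?t * y\<bar> \<le> pi / 2" if "\<bar>y\<bar> < real N" for y
    proof -
      have "\<bar>y\<bar> \<le> real (Suc n)" using that \<open>n \<ge> N\<close> by simp
      then have "\<bar>?t * y\<bar> \<le> 1" by (simp add: abs_mult field_simps)
      then show ?thesis using pi_ge_two by linarith
    qed
    have "\<bar>?t * a\<bar> \<le> pi / 2" "\<bar>?t * f x \<omega>\<bar> \<le> pi / 2"
      using small N by auto
    then have "sin (?t * a) < sin (?t * f x \<omega>) \<longleftrightarrow> ?t * a < ?t * f x \<omega>"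
      by (intro sin_mono_less_eq) (simp_all only: abs_le_iff, linarith+)
    also have "\<dots> \<longleftrightarrow> a < f x \<omega>"
      by (rule mult_less_cancel_left_pos) simp
    finally show ?thesis by (simp add: indicator_def)
  qed
  then show "(\<lambda>n. indicator {(1 + sin (inverse (real (Suc n)) * a)) / 2<..}
      ((1 + sin (inverse (real (Suc n)) * f x \<omega>)) / 2)) \<longlonglongrightarrow> (indicator {a<..} (f x \<omega>) :: real)"
    by (intro tendsto_eventually) (auto simp: eventually_sequentially)
qed (simp add: indicator_def)

text \<open>The functional is a polynomial in level indicators, hence a multiplier; applied to the
  constant polynomial 1 it lands in the closure.\<close>

lemma excursion_functional_closure: "at_f (\<lambda>u. \<Xi> (excursion_set D \<nu> u)) \<in> poly_closure"
proof -
  have lvl: "multiplier (\<lambda>\<omega>. if x \<in> E then indicator {\<nu> x<..} (f x \<omega>) else 1 - indicator {\<nu> x<..} (f x \<omega>))"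
    if "x \<in> D" for x E
  proof (cases "x \<in> E")
    case False
    then show ?thesis
      using multiplier_add[OF multiplier_const[of 1] multiplier_mult[OF multiplier_const[of "-1"] multiplier_level[OF that]]]
      by simp
  qed (use multiplier_level[OF that] in simp)
  have "multiplier (at_f (\<lambda>u. \<Xi> (excursion_set D \<nu> u)))"
    unfolding at_f_def[abs_def] excursion_set_expansion[OF finite_D, of \<Xi>]
    by (rule multiplier_sum, use finite_D in simp, rule multiplier_mult, rule multiplier_const,
        rule multiplier_prod, rule finite_D, rule lvl)
  moreover have "at_f (\<lambda>_. 1) \<in> all_polys"
    unfolding all_polys_iff using polyf_const by blast
  then have "at_f (\<lambda>_. 1) \<in> poly_closure"
    using subset_L2_closure[OF all_polys_L2] by blast
  ultimately have "(\<lambda>\<omega>. at_f (\<lambda>u. \<Xi> (excursion_set D \<nu> u)) \<omega> * at_f (\<lambda>_. 1) \<omega>) \<in> poly_closure"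
    unfolding multiplier_def by blast
  then show ?thesis by (simp add: at_f_def[abs_def])
qed

section \<open>Best approximation and convergence of the expansion\<close>

lemma projection_minimal:
  assumes X: "X \<in> L2 M" and P: "P \<in> poly_space N" "\<And>Z. Z \<in> poly_space N \<Longrightarrow> L2_ip M (\<lambda>\<omega>. X \<omega> - P \<omega>) Z = 0"
    and Z: "Z \<in> poly_space N"
  shows "(\<integral>\<omega>. (P \<omega> - X \<omega>)\<^sup>2 \<partial>M) \<le> (\<integral>\<omega>. (Z \<omega> - X \<omega>)\<^sup>2 \<partial>M)"
proof -
  have L: "P \<in> L2 M" "Z \<in> L2 M" using P(1) Z poly_space_subset_L2 by auto
  let ?a = "\<lambda>\<omega>. X \<omega> - P \<omega>" and ?b = "\<lambda>\<omega>. P \<omega> - Z \<omega>"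
  have ab: "?a \<in> L2 M" "?b \<in> L2 M" by (rule L2_diff[OF X L(1)], rule L2_diff[OF L])
  have 0: "L2_ip M ?a ?b = 0"
    by (rule P(2)[OF lin_span_diff[OF P(1) Z]])
  have "(\<integral>\<omega>. (Z \<omega> - X \<omega>)\<^sup>2 \<partial>M) = L2_ip M (\<lambda>\<omega>. ?a \<omega> + ?b \<omega>) (\<lambda>\<omega>. ?a \<omega> + ?b \<omega>)"
    by (simp add: L2_ip_def power2_eq_square algebra_simps)
  also have "\<dots> = L2_ip M ?a ?a + L2_ip M ?b ?b"
    using 0 L2_ip_add_left[OF ab L2_add[OF ab]] L2_ip_add_right[OF ab ab(1)] L2_ip_add_right[OF ab ab(2)]
    by (simp add: L2_ip_commute[of M ?b ?a])
  also have "\<dots> \<ge> L2_ip M ?a ?a" using L2_ip_self_nonneg[of M ?b] by simp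
  finally show ?thesis
    by (simp add: L2_ip_def power2_eq_square algebra_simps)
qed

text \<open>Up to null sets each chaos component is the difference of consecutive polynomial
  projections, so the partial sums telescope to the projection of degree N. A polynomial of degree m
  close to X competes with that projection for every N \<ge> m, so density forces the error to
  0.\<close>

lemma chaos_expansion:
  assumes X: "X \<in> poly_closure"
  shows "tendsto_L2 M (\<lambda>N \<omega>. expectation X + (\<Sum>m = 1..N. chaos_proj M H m X \<omega>)) X"
proof -
  have XL: "X \<in> L2 M" by (rule poly_closure_L2[OF X])
  \<comment> \<open>In degree 0 the projection is pinned to the constant expectation, so that the
    telescoping sum starts with exactly that term.\<close>
  define proj where "proj N P \<longleftrightarrow> P \<in> poly_space N \<and> (\<forall>Z\<in>poly_space N. L2_ip M (\<lambda>\<omega>. X \<omega> - P \<omega>) Z = 0) \<and>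
      (N = 0 \<longrightarrow> P = (\<lambda>_. expectation X))" for N P
  have ex: "\<exists>P. proj N P" for N
  proof (cases "N = 0")
    case False
    obtain P where "P \<in> poly_space N" "\<And>Z. Z \<in> poly_space N \<Longrightarrow> L2_ip M (\<lambda>\<omega>. X \<omega> - P \<omega>) Z = 0"
      using poly_space_projection[OF XL, of N] by metis
    then show ?thesis
      unfolding proj_def using False by (intro exI[of _ P]) simp
  next
    case True
    let ?c = "\<lambda>_. expectation X"
    have one: "(\<lambda>_. 1) \<in> L2 M" by (simp add: L2_def)
    have c: "?c \<in> poly_space 0"
      unfolding at_f_poly_space_iff by (intro exI[of _ ?c]) (simp add: polyf_const at_f_def[abs_def])
    have cL: "?c \<in> L2 M" using c poly_space_subset_L2 by blast
    have "integrable M X" using L2_integrable_mult[OF XL one] by simp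
    then have "(\<integral>\<omega>. X \<omega> - expectation X \<partial>M) = 0" by (simp add: prob_space)
    moreover have "at_f (monomial \<beta>) = (\<lambda>_. 1)" if "\<beta> \<in> multi_indices 0" for \<beta>
      using that finite_D by (auto simp: multi_indices_def monomial_def at_f_def fun_eq_iff intro!: prod.neutral)
    ultimately have "L2_ip M (\<lambda>\<omega>. X \<omega> - expectation X) (at_f (monomial \<beta>)) = 0" if "\<beta> \<in> multi_indices 0" for \<beta>
      using that by (simp add: L2_ip_def)
    then have "L2_ip M (\<lambda>\<omega>. X \<omega> - expectation X) Z = 0" if "Z \<in> poly_space 0" for Z
      by (rule lin_span_orthogonal[OF finite_multi_indices monomial_L2 L2_diff[OF XL cL] _ that])
    then show ?thesis
      unfolding proj_def using c True by (intro exI[of _ ?c]) simp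
  qed
  obtain P where "\<And>N. proj N (P N)"
    using choice[of proj] ex by metis
  then have P: "\<And>N. P N \<in> poly_space N" "\<And>N Z. Z \<in> poly_space N \<Longrightarrow> L2_ip M (\<lambda>\<omega>. X \<omega> - P N \<omega>) Z = 0"
    and P0: "P 0 = (\<lambda>_. expectation X)"
    unfolding proj_def by simp_all
  have step: "AE \<omega> in M. chaos_proj M H (Suc n) X \<omega> = P (Suc n) \<omega> - P n \<omega>" for n
  proof -
    have "\<And>Z. Z \<in> poly_space (Suc n - 1) \<Longrightarrow> L2_ip M (\<lambda>\<omega>. X \<omega> - P n \<omega>) Z = 0" "P n \<in> poly_space (Suc n - 1)"
      using P by simp_all
    note * = chaos_difference_of_projections[OF XL zero_less_Suc P(1,2) this(2,1)]
    show ?thesis by (rule chaos_proj_unique[OF XL zero_less_Suc *])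
  qed
  let ?S = "\<lambda>N \<omega>. expectation X + (\<Sum>m = 1..N. chaos_proj M H m X \<omega>)"
  have SP: "AE \<omega> in M. ?S N \<omega> = P N \<omega>" for N
  proof (induction N)
    case (Suc N)
    then show ?case using step[of N] by eventually_elim simp
  qed (simp add: P0)
  have SL: "?S N \<in> L2 M" for N
  proof (rule L2_add)
    show "(\<lambda>_. expectation X) \<in> L2 M" by (simp add: L2_def)
    show "(\<lambda>\<omega>. \<Sum>m = 1..N. chaos_proj M H m X \<omega>) \<in> L2 M"
      by (rule L2_sum) (auto intro: chaos_L2[OF chaos_proj_properties(1)[OF XL]])
  qed
  have PL: "P N \<in> L2 M" for N using P(1) poly_space_subset_L2 by blast
  have "(\<integral>\<omega>. (?S N \<omega> - X \<omega>)\<^sup>2 \<partial>M) = (\<integral>\<omega>. (P N \<omega> - X \<omega>)\<^sup>2 \<partial>M)" for N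
  proof (rule integral_cong_AE)
    show "(\<lambda>\<omega>. (?S N \<omega> - X \<omega>)\<^sup>2) \<in> borel_measurable M"
      using L2_D(2)[OF L2_diff[OF SL XL]] by (rule borel_measurable_integrable)
    show "(\<lambda>\<omega>. (P N \<omega> - X \<omega>)\<^sup>2) \<in> borel_measurable M"
      using L2_D(2)[OF L2_diff[OF PL XL]] by (rule borel_measurable_integrable)
    show "AE \<omega> in M. (?S N \<omega> - X \<omega>)\<^sup>2 = (P N \<omega> - X \<omega>)\<^sup>2"
      using SP[of N] by eventually_elim simp
  qed
  moreover have "(\<lambda>N. \<integral>\<omega>. (P N \<omega> - X \<omega>)\<^sup>2 \<partial>M) \<longlonglongrightarrow> 0"
  proof (rule LIMSEQ_I)
    fix r :: real assume "0 < r"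
    then obtain Z where Z: "Z \<in> all_polys" "(\<integral>\<omega>. (Z \<omega> - X \<omega>)\<^sup>2 \<partial>M) < r"
      using L2_closure_approx[OF X] by blast
    then obtain m where m: "Z \<in> poly_space m" unfolding all_polys_def by blast
    have "norm ((\<integral>\<omega>. (P N \<omega> - X \<omega>)\<^sup>2 \<partial>M) - 0) < r" if "m \<le> N" for N
    proof -
      have ZN: "Z \<in> poly_space N" using m poly_space_mono[OF that] by blast
      have "(\<integral>\<omega>. (P N \<omega> - X \<omega>)\<^sup>2 \<partial>M) \<le> (\<integral>\<omega>. (Z \<omega> - X \<omega>)\<^sup>2 \<partial>M)"
        by (rule projection_minimal[OF XL P(1) _ ZN]) (rule P(2))
      then show ?thesis using Z(2) by simp
    qed
    then show "\<exists>no. \<forall>N\<ge>no. norm ((\<integral>\<omega>. (P N \<omega> - X \<omega>)\<^sup>2 \<partial>M) - 0) < r" by blast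
  qed
  ultimately have "(\<lambda>N. \<integral>\<omega>. (?S N \<omega> - X \<omega>)\<^sup>2 \<partial>M) \<longlonglongrightarrow> 0"
    by (simp only:)
  then show ?thesis
    unfolding tendsto_L2_def by (intro conjI allI SL XL)
qed

end

theorem theorem2p9:
  fixes M :: "'w measure"
    and D :: "(int ^ 'd) set"
    and f :: "int ^ 'd \<Rightarrow> 'w \<Rightarrow> real"
    and \<Xi> :: "(int ^ 'd) set \<Rightarrow> real"
    and \<nu> :: "int ^ 'd \<Rightarrow> real"
  assumes "prob_space M"
    and "finite D"
    and "nondeg_centred_gaussian M D f"
  shows "tendsto_L2 M
           (\<lambda>N \<omega>. (\<integral>\<omega>'. \<Xi> (excursion_set D \<nu> (\<lambda>x. f x \<omega>')) \<partial>M) +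
              (\<Sum>m = 1..N. chaos_proj M (gauss_space D f) m
                 (\<lambda>\<omega>'. \<Xi> (excursion_set D \<nu> (\<lambda>x. f x \<omega>'))) \<omega>))
           (\<lambda>\<omega>. \<Xi> (excursion_set D \<nu> (\<lambda>x. f x \<omega>)))
       \<and> (\<forall>m\<ge>1. AE \<omega> in M.
            chaos_proj M (gauss_space D f) m
              (\<lambda>\<omega>'. \<Xi> (excursion_set D \<nu> (\<lambda>x. f x \<omega>'))) \<omega> =
            1 / fact m * (\<Sum>xs | length xs = m \<and> set xs \<subseteq> D.
              wick M (gauss_space D f) (map f xs) \<omega> * pivotal_intensity M D f \<Xi> \<nu> xs))"
proof -
  interpret gaussian_vector M D f
    using assms by (simp add: gaussian_vector_def gaussian_vector_axioms_def)
  have eq: "at_f (\<lambda>u. \<Xi> (excursion_set D \<nu> u)) = (\<lambda>\<omega>. \<Xi> (excursion_set D \<nu> (\<lambda>x. f x \<omega>)))"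
    by (simp add: at_f_def[abs_def])
  show ?thesis
  proof (intro conjI allI impI)
    show "tendsto_L2 M
           (\<lambda>N \<omega>. (\<integral>\<omega>'. \<Xi> (excursion_set D \<nu> (\<lambda>x. f x \<omega>')) \<partial>M) +
              (\<Sum>m = 1..N. chaos_proj M (gauss_space D f) m
                 (\<lambda>\<omega>'. \<Xi> (excursion_set D \<nu> (\<lambda>x. f x \<omega>'))) \<omega>))
           (\<lambda>\<omega>. \<Xi> (excursion_set D \<nu> (\<lambda>x. f x \<omega>)))"
      using chaos_expansion[OF excursion_functional_closure[of \<Xi> \<nu>]] unfolding eq .
    fix m :: nat assume "1 \<le> m"
    then show "AE \<omega> in M. chaos_proj M (gauss_space D f) m
              (\<lambda>\<omega>'. \<Xi> (excursion_set D \<nu> (\<lambda>x. f x \<omega>'))) \<omega> =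
            1 / fact m * (\<Sum>xs | length xs = m \<and> set xs \<subseteq> D.
              wick M (gauss_space D f) (map f xs) \<omega> * pivotal_intensity M D f \<Xi> \<nu> xs)"
      using chaos_proj_excursion_functional[of m \<Xi> \<nu>] unfolding eq by simp
  qed
qed

end
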